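(* Let $\Gamma=(V,E)$ be a finite simplicial graph and let $\mathcal{G}=\{G_v\}_{v\in V}$ be a collection of groups linear over a commutative integral domain $R$. Then the graph product $\Gamma\mathcal{G}$ is an equationally noetherian group.
   Context: A group is linear over a ring $S$ if it is isomorphic to a subgroup of $\mathrm{GL}_n(S)$ for some $n\ge 1$. A simplicial graph has no loops and no multiple edges. The graph product is $$\Gamma\mathcal{G}=\langle \ast_{v\in V}G_v \mid [G_v,G_u]=e \text{ for all } \{v,u\}\in E\rangle,$$ i.e. the quotient of the free product of the $G_v$ obtained by making $G_v$ and $G_u$ commute elementwise whenever $\{v,u\}\in E$. A group $G$ is equationally noetherian if the set of solutions of any system $\mathcal{S}$ of equations over $G$ equals the set of solutions of some finite subsystem $\mathcal{S}_0\subseteq\mathcal{S}$. Here a system of equations over $G$ is, as usual, a subset $\mathcal{S}$ of $G\ast F(x_1,\dots,x_n)$ for some $n$ (finitely many variables, coefficients in $G$), and a solution is a tuple in $G^n$ whose substitution sends every element of $\mathcal{S}$ to $e$. *)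

theory Defs
  imports
    "HOL-Algebra.Generated_Groups"
    "Jordan_Normal_Form.Matrix"
begin

section \<open>Groups of words modulo relations\<close>

text \<open>
  The congruence on words over the alphabet \<open>A\<close> generated by identifying \<open>l\<close> with
  \<open>r\<close> for each \<open>(l, r) \<in> R\<close>.  Inverses of letters are not added formally; the
  alphabets and relations used below provide them.
\<close>

inductive_set word_cong :: "'l set \<Rightarrow> ('l list \<times> 'l list) set \<Rightarrow> ('l list \<times> 'l list) set"
  for A :: "'l set" and R :: "('l list \<times> 'l list) set"
where
  refl: "w \<in> lists A \<Longrightarrow> (w, w) \<in> word_cong A R"
| rel: "(l, r) \<in> R \<Longrightarrow> l \<in> lists A \<Longrightarrow> r \<in> lists A \<Longrightarrow> u \<in> lists A \<Longrightarrow> w \<in> lists A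
    \<Longrightarrow> (u @ l @ w, u @ r @ w) \<in> word_cong A R"
| sym: "(u, w) \<in> word_cong A R \<Longrightarrow> (w, u) \<in> word_cong A R"
| trans: "(u, v) \<in> word_cong A R \<Longrightarrow> (v, w) \<in> word_cong A R \<Longrightarrow> (u, w) \<in> word_cong A R"

definition word_class :: "'l set \<Rightarrow> ('l list \<times> 'l list) set \<Rightarrow> 'l list \<Rightarrow> 'l list set"
  where "word_class A R w = word_cong A R `` {w}"

definition word_monoid :: "'l set \<Rightarrow> ('l list \<times> 'l list) set \<Rightarrow> 'l list set monoid"
  where "word_monoid A R =
    \<lparr>carrier = lists A // word_cong A R,
     monoid.mult = (\<lambda>X Y. \<Union>x\<in>X. \<Union>y\<in>Y. word_class A R (x @ y)),
     one = word_class A R []\<rparr>"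


section \<open>Free groups and free products\<close>

text \<open>The letter \<open>(x, True)\<close> stands for the generator \<open>x\<close> and \<open>(x, False)\<close> for its inverse.\<close>

definition free_group_rels :: "'x set \<Rightarrow> (('x \<times> bool) list \<times> ('x \<times> bool) list) set"
  where "free_group_rels X = {([(x, b), (x, \<not> b)], []) | x b. x \<in> X}"

definition free_group :: "'x set \<Rightarrow> ('x \<times> bool) list set monoid"
  where "free_group X = word_monoid (X \<times> UNIV) (free_group_rels X)"

definition free_group_gen :: "'x set \<Rightarrow> 'x \<Rightarrow> ('x \<times> bool) list set"
  where "free_group_gen X x = word_class (X \<times> UNIV) (free_group_rels X) [(x, True)]"

definition free_product_rels ::
    "'i set \<Rightarrow> ('i \<Rightarrow> ('a, 'm) monoid_scheme) \<Rightarrow> (('i \<times> 'a) list \<times> ('i \<times> 'a) list) set"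
  where "free_product_rels I G =
    {([(i, \<one>\<^bsub>G i\<^esub>)], []) | i. i \<in> I} \<union>
    {([(i, a), (i, b)], [(i, a \<otimes>\<^bsub>G i\<^esub> b)]) | i a b.
        i \<in> I \<and> a \<in> carrier (G i) \<and> b \<in> carrier (G i)}"

definition free_product ::
    "'i set \<Rightarrow> ('i \<Rightarrow> ('a, 'm) monoid_scheme) \<Rightarrow> ('i \<times> 'a) list set monoid"
  where "free_product I G = word_monoid (SIGMA i:I. carrier (G i)) (free_product_rels I G)"

definition free_product_inj ::
    "'i set \<Rightarrow> ('i \<Rightarrow> ('a, 'm) monoid_scheme) \<Rightarrow> 'i \<Rightarrow> 'a \<Rightarrow> ('i \<times> 'a) list set"
  where "free_product_inj I G i a =
    word_class (SIGMA i:I. carrier (G i)) (free_product_rels I G) [(i, a)]"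

text \<open>
  The free product of two groups is defined separately, since the two factors may have
  carriers of different types.
\<close>

definition free_product2_rels ::
    "('a, 'm) monoid_scheme \<Rightarrow> ('b, 'k) monoid_scheme \<Rightarrow> (('a + 'b) list \<times> ('a + 'b) list) set"
  where "free_product2_rels G H =
    {([Inl \<one>\<^bsub>G\<^esub>], []), ([Inr \<one>\<^bsub>H\<^esub>], [])} \<union>
    {([Inl a, Inl b], [Inl (a \<otimes>\<^bsub>G\<^esub> b)]) | a b. a \<in> carrier G \<and> b \<in> carrier G} \<union>
    {([Inr a, Inr b], [Inr (a \<otimes>\<^bsub>H\<^esub> b)]) | a b. a \<in> carrier H \<and> b \<in> carrier H}"

definition free_product2 ::
    "('a, 'm) monoid_scheme \<Rightarrow> ('b, 'k) monoid_scheme \<Rightarrow> ('a + 'b) list set monoid"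
  where "free_product2 G H = word_monoid (carrier G <+> carrier H) (free_product2_rels G H)"

definition free_product2_inl ::
    "('a, 'm) monoid_scheme \<Rightarrow> ('b, 'k) monoid_scheme \<Rightarrow> 'a \<Rightarrow> ('a + 'b) list set"
  where "free_product2_inl G H a =
    word_class (carrier G <+> carrier H) (free_product2_rels G H) [Inl a]"

definition free_product2_inr ::
    "('a, 'm) monoid_scheme \<Rightarrow> ('b, 'k) monoid_scheme \<Rightarrow> 'b \<Rightarrow> ('a + 'b) list set"
  where "free_product2_inr G H b =
    word_class (carrier G <+> carrier H) (free_product2_rels G H) [Inr b]"


section \<open>Graph products\<close>

definition finite_simplicial_graph :: "'v set \<Rightarrow> 'v set set \<Rightarrow> bool"
  where "finite_simplicial_graph V E \<longleftrightarrow> finite V \<and> (\<forall>e\<in>E. e \<subseteq> V \<and> card e = 2)"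

definition normal_closure :: "('a, 'm) monoid_scheme \<Rightarrow> 'a set \<Rightarrow> 'a set"
  where "normal_closure G S =
    generate G {g \<otimes>\<^bsub>G\<^esub> s \<otimes>\<^bsub>G\<^esub> inv\<^bsub>G\<^esub> g | g s. g \<in> carrier G \<and> s \<in> S}"

definition commutator :: "('a, 'm) monoid_scheme \<Rightarrow> 'a \<Rightarrow> 'a \<Rightarrow> 'a"
  where "commutator G x y = x \<otimes>\<^bsub>G\<^esub> y \<otimes>\<^bsub>G\<^esub> inv\<^bsub>G\<^esub> x \<otimes>\<^bsub>G\<^esub> inv\<^bsub>G\<^esub> y"

definition graph_product_rels ::
    "'v set \<Rightarrow> 'v set set \<Rightarrow> ('v \<Rightarrow> ('a, 'm) monoid_scheme) \<Rightarrow> ('v \<times> 'a) list set set"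
  where "graph_product_rels V E G =
    {commutator (free_product V G) (free_product_inj V G v a) (free_product_inj V G u b) | v u a b.
        {v, u} \<in> E \<and> a \<in> carrier (G v) \<and> b \<in> carrier (G u)}"

definition graph_product ::
    "'v set \<Rightarrow> 'v set set \<Rightarrow> ('v \<Rightarrow> ('a, 'm) monoid_scheme) \<Rightarrow> ('v \<times> 'a) list set set monoid"
  where "graph_product V E G =
    free_product V G Mod normal_closure (free_product V G) (graph_product_rels V E G)"


section \<open>Linear groups\<close>

definition GL :: "nat \<Rightarrow> 'r::comm_ring_1 mat monoid"
  where "GL n = units_of (ring_mat TYPE('r) n ())"

definition linear_over :: "'r::comm_ring_1 itself \<Rightarrow> ('a, 'm) monoid_scheme \<Rightarrow> bool"
  where "linear_over _ G \<longleftrightarrow>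
    (\<exists>n\<ge>1. \<exists>H. subgroup H (GL n :: 'r mat monoid) \<and> G \<cong> (GL n :: 'r mat monoid)\<lparr>carrier := H\<rparr>)"


section \<open>Equationally noetherian groups\<close>

text \<open>The group of equations over \<open>G\<close> in \<open>n\<close> variables, indexed by \<open>0, \<dots>, n - 1\<close>.\<close>

definition equation_group ::
    "('a, 'm) monoid_scheme \<Rightarrow> nat \<Rightarrow> ('a + (nat \<times> bool) list set) list set monoid"
  where "equation_group G n = free_product2 G (free_group {..<n})"

definition equation_const ::
    "('a, 'm) monoid_scheme \<Rightarrow> nat \<Rightarrow> 'a \<Rightarrow> ('a + (nat \<times> bool) list set) list set"
  where "equation_const G n a = free_product2_inl G (free_group {..<n}) a"

definition equation_var ::
    "('a, 'm) monoid_scheme \<Rightarrow> nat \<Rightarrow> nat \<Rightarrow> ('a + (nat \<times> bool) list set) list set"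
  where "equation_var G n i =
    free_product2_inr G (free_group {..<n}) (free_group_gen {..<n} i)"

text \<open>
  Substituting \<open>g\<close> for the variables is the homomorphism to \<open>G\<close> that fixes the
  coefficients and maps the \<open>i\<close>-th variable to \<open>g i\<close>.  For a group \<open>G\<close> it exists and is
  unique on the carrier: see \<open>ex_is_substitution\<close> and \<open>is_substitution_unique\<close> below.
\<close>

definition is_substitution ::
    "('a, 'm) monoid_scheme \<Rightarrow> nat \<Rightarrow> (nat \<Rightarrow> 'a)
      \<Rightarrow> (('a + (nat \<times> bool) list set) list set \<Rightarrow> 'a) \<Rightarrow> bool"
  where "is_substitution G n g \<phi> \<longleftrightarrow>
    \<phi> \<in> hom (equation_group G n) G \<and>
    (\<forall>a\<in>carrier G. \<phi> (equation_const G n a) = a) \<and>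
    (\<forall>i<n. \<phi> (equation_var G n i) = g i)"

definition solutions ::
    "('a, 'm) monoid_scheme \<Rightarrow> nat \<Rightarrow> ('a + (nat \<times> bool) list set) list set set \<Rightarrow> (nat \<Rightarrow> 'a) set"
  where "solutions G n S =
    {g \<in> {..<n} \<rightarrow>\<^sub>E carrier G. \<exists>\<phi>. is_substitution G n g \<phi> \<and> (\<forall>w\<in>S. \<phi> w = \<one>\<^bsub>G\<^esub>)}"

definition equationally_noetherian :: "('a, 'm) monoid_scheme \<Rightarrow> bool"
  where "equationally_noetherian G \<longleftrightarrow>
    (\<forall>n. \<forall>S \<subseteq> carrier (equation_group G n).
       \<exists>S\<^sub>0 \<subseteq> S. finite S\<^sub>0 \<and> solutions G n S = solutions G n S\<^sub>0)"


section \<open>Basic facts\<close>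

declare in_listsD [rule del] in_listsI [rule del]

lemma word_cong_lists: "(u, w) \<in> word_cong A R \<Longrightarrow> u \<in> lists A \<and> w \<in> lists A"
  by (induction rule: word_cong.induct) auto

lemma equiv_word_cong: "equiv (lists A) (word_cong A R)"
proof (rule equivI)
  show "word_cong A R \<subseteq> lists A \<times> lists A"
    using word_cong_lists by fast
  show "refl_on (lists A) (word_cong A R)"
    by (auto intro!: refl_onI word_cong.refl)
  show "Relation.sym (word_cong A R)"
    by (rule symI) (rule word_cong.sym)
  show "Relation.trans (word_cong A R)"
    by (rule transI) (rule word_cong.trans)
qed

lemma word_cong_context:
  assumes "(u, w) \<in> word_cong A R" "p \<in> lists A" "q \<in> lists A"
  shows "(p @ u @ q, p @ w @ q) \<in> word_cong A R"
  using assms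
proof (induction rule: word_cong.induct)
  case (rel l r u w)
  then show ?case
    using word_cong.rel[of l r R A "p @ u" "w @ q"] by simp
next
  case (refl w)
  then show ?case by (auto intro: word_cong.refl)
next
  case (sym u w)
  then show ?case by (blast intro: word_cong.sym)
next
  case (trans u v w)
  from trans.IH[OF trans.prems] show ?case by (rule word_cong.trans)
qed

lemma word_cong_append:
  assumes "(u, u') \<in> word_cong A R" "(w, w') \<in> word_cong A R"
  shows "(u @ w, u' @ w') \<in> word_cong A R"
proof -
  have "u' \<in> lists A" "w \<in> lists A"
    using assms word_cong_lists by blast+
  then show ?thesis
    using word_cong_context[OF assms(1), of "[]" w] word_cong_context[OF assms(2), of u' "[]"]
    by simp (rule word_cong.trans)
qed

lemma word_class_eq_iff:
  assumes "u \<in> lists A" "w \<in> lists A"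
  shows "word_class A R u = word_class A R w \<longleftrightarrow> (u, w) \<in> word_cong A R"
  unfolding word_class_def using equiv_word_cong assms by (rule eq_equiv_class_iff)

lemma word_class_eqI: "(u, w) \<in> word_cong A R \<Longrightarrow> word_class A R u = word_class A R w"
  unfolding word_class_def by (rule equiv_class_eq[OF equiv_word_cong])

lemma mem_word_class: "u \<in> word_class A R w \<longleftrightarrow> (w, u) \<in> word_cong A R"
  by (simp add: word_class_def)

lemma word_class_rel:
  "(l, r) \<in> R \<Longrightarrow> l \<in> lists A \<Longrightarrow> r \<in> lists A \<Longrightarrow> word_class A R l = word_class A R r"
  using word_cong.rel[of l r R A "[]" "[]"] by (intro word_class_eqI) auto

lemma carrier_word_monoid: "carrier (word_monoid A R) = word_class A R ` lists A"
  by (auto simp: word_monoid_def quotient_def word_class_def)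

lemma word_class_closed: "w \<in> lists A \<Longrightarrow> word_class A R w \<in> carrier (word_monoid A R)"
  by (simp add: carrier_word_monoid)

lemma one_word_monoid: "\<one>\<^bsub>word_monoid A R\<^esub> = word_class A R []"
  by (simp add: word_monoid_def)

lemma mult_word_monoid:
  assumes "u \<in> lists A" "w \<in> lists A"
  shows "word_class A R u \<otimes>\<^bsub>word_monoid A R\<^esub> word_class A R w = word_class A R (u @ w)"
proof -
  have "word_class A R (x @ y) = word_class A R (u @ w)"
    if "x \<in> word_class A R u" "y \<in> word_class A R w" for x y
    using that word_cong_append[of u x A R w y]
    unfolding mem_word_class by (intro word_class_eqI) (rule word_cong.sym)
  moreover have "u \<in> word_class A R u" "w \<in> word_class A R w"
    using assms by (simp_all add: mem_word_class word_cong.refl)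
  ultimately show ?thesis
    unfolding word_monoid_def monoid.simps by blast
qed

lemma monoid_word_monoid: "Group.monoid (word_monoid A R)"
proof (rule monoidI)
  fix X Y assume "X \<in> carrier (word_monoid A R)" "Y \<in> carrier (word_monoid A R)"
  then obtain u v where "u \<in> lists A" "X = word_class A R u" "v \<in> lists A" "Y = word_class A R v"
    unfolding carrier_word_monoid by blast
  then show "X \<otimes>\<^bsub>word_monoid A R\<^esub> Y \<in> carrier (word_monoid A R)"
    by (simp only: mult_word_monoid append_in_lists_conv word_class_closed simp_thms)
next
  fix X Y Z assume "X \<in> carrier (word_monoid A R)" "Y \<in> carrier (word_monoid A R)"
    "Z \<in> carrier (word_monoid A R)"
  then obtain u v w where "u \<in> lists A" "X = word_class A R u" "v \<in> lists A" "Y = word_class A R v"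
    "w \<in> lists A" "Z = word_class A R w"
    unfolding carrier_word_monoid by blast
  then show "X \<otimes>\<^bsub>word_monoid A R\<^esub> Y \<otimes>\<^bsub>word_monoid A R\<^esub> Z =
      X \<otimes>\<^bsub>word_monoid A R\<^esub> (Y \<otimes>\<^bsub>word_monoid A R\<^esub> Z)"
    by (simp only: mult_word_monoid append_in_lists_conv append_assoc simp_thms)
next
  fix X assume "X \<in> carrier (word_monoid A R)"
  then obtain u where "u \<in> lists A" "X = word_class A R u"
    unfolding carrier_word_monoid by blast
  then show "\<one>\<^bsub>word_monoid A R\<^esub> \<otimes>\<^bsub>word_monoid A R\<^esub> X = X"
    "X \<otimes>\<^bsub>word_monoid A R\<^esub> \<one>\<^bsub>word_monoid A R\<^esub> = X"
    by (simp_all only: one_word_monoid mult_word_monoid lists.Nil append_Nil append_Nil2)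
qed (simp add: one_word_monoid word_class_closed)

lemma group_word_monoid:
  assumes "\<And>x. x \<in> A \<Longrightarrow> \<exists>w\<in>lists A. (w @ [x], []) \<in> word_cong A R"
  shows "group (word_monoid A R)"
proof -
  interpret monoid "word_monoid A R" by (rule monoid_word_monoid)
  have inv: "\<exists>w\<in>lists A. (w @ u, []) \<in> word_cong A R" if "u \<in> lists A" for u
    using that
  proof (induction u)
    case Nil
    then show ?case by (auto intro!: bexI[of _ "[]"] word_cong.refl)
  next
    case (Cons x u)
    obtain w where w: "w \<in> lists A" "(w @ u, []) \<in> word_cong A R"
      using Cons.IH by blast
    obtain v where v: "v \<in> lists A" "(v @ [x], []) \<in> word_cong A R"
      using assms Cons.hyps by blast
    have "(w @ (v @ [x]) @ u, w @ [] @ u) \<in> word_cong A R"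
      using Cons.hyps w v by (intro word_cong_context) auto
    then show ?case
      using w v by (intro bexI[of _ "w @ v"]) (auto intro: word_cong.trans)
  qed
  show ?thesis
  proof (rule group_l_invI)
    fix X assume "X \<in> carrier (word_monoid A R)"
    then obtain u where u: "u \<in> lists A" "X = word_class A R u"
      by (auto simp: carrier_word_monoid)
    then obtain w where "w \<in> lists A" "(w @ u, []) \<in> word_cong A R"
      using inv by blast
    with u show "\<exists>Y\<in>carrier (word_monoid A R). Y \<otimes>\<^bsub>word_monoid A R\<^esub> X = \<one>\<^bsub>word_monoid A R\<^esub>"
      by (intro bexI[of _ "word_class A R w"])
        (simp_all add: mult_word_monoid one_word_monoid word_class_closed word_class_eqI)
  qed
qed

definition word_eval :: "('b, 'm) monoid_scheme \<Rightarrow> ('l \<Rightarrow> 'b) \<Rightarrow> 'l list \<Rightarrow> 'b"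
  where "word_eval G f w = foldr (\<lambda>x y. f x \<otimes>\<^bsub>G\<^esub> y) w \<one>\<^bsub>G\<^esub>"

lemma word_eval_simps [simp]:
  "word_eval G f [] = \<one>\<^bsub>G\<^esub>" "word_eval G f (x # w) = f x \<otimes>\<^bsub>G\<^esub> word_eval G f w"
  by (simp_all add: word_eval_def)

context Group.monoid
begin

lemma word_eval_closed: "f ` A \<subseteq> carrier G \<Longrightarrow> w \<in> lists A \<Longrightarrow> word_eval G f w \<in> carrier G"
  by (induction w) auto

lemma word_eval_append:
  assumes "f ` A \<subseteq> carrier G" "u \<in> lists A" "w \<in> lists A"
  shows "word_eval G f (u @ w) = word_eval G f u \<otimes> word_eval G f w"
  using assms(2)
proof (induction u)
  case (Cons x u)
  then show ?case
    using assms word_eval_closed[OF assms(1)] by (simp add: m_assoc image_subset_iff)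
qed (simp add: word_eval_closed[OF assms(1,3)])

lemma word_eval_cong:
  assumes f: "f ` A \<subseteq> carrier G"
    and R: "\<And>l r. (l, r) \<in> R \<Longrightarrow> l \<in> lists A \<Longrightarrow> r \<in> lists A \<Longrightarrow> word_eval G f l = word_eval G f r"
    and "(u, w) \<in> word_cong A R"
  shows "word_eval G f u = word_eval G f w"
  using assms(3) by (induction rule: word_cong.induct) (auto simp: word_eval_append[OF f] R)

lemma word_monoid_lift:
  assumes f: "f ` A \<subseteq> carrier G"
    and R: "\<And>l r. (l, r) \<in> R \<Longrightarrow> l \<in> lists A \<Longrightarrow> r \<in> lists A \<Longrightarrow> word_eval G f l = word_eval G f r"
  shows "\<exists>\<phi> \<in> hom (word_monoid A R) G. \<forall>x\<in>A. \<phi> (word_class A R [x]) = f x"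
proof -
  define \<phi> where "\<phi> X = word_eval G f (SOME w. w \<in> X)" for X
  have eq: "\<phi> (word_class A R w) = word_eval G f w" if "w \<in> lists A" for w
  proof -
    have "w \<in> word_class A R w"
      using that by (simp add: mem_word_class word_cong.refl)
    then have "(SOME u. u \<in> word_class A R w) \<in> word_class A R w"
      by (rule someI)
    then have "(w, SOME u. u \<in> word_class A R w) \<in> word_cong A R"
      by (simp only: mem_word_class)
    then show ?thesis
      unfolding \<phi>_def using word_eval_cong[OF f R] by metis
  qed
  have "\<phi> \<in> hom (word_monoid A R) G"
  proof (rule homI)
    fix X assume "X \<in> carrier (word_monoid A R)"
    then obtain u where "u \<in> lists A" "X = word_class A R u"
      unfolding carrier_word_monoid by blast
    then show "\<phi> X \<in> carrier G"
      by (simp only: eq word_eval_closed[OF f])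
  next
    fix X Y assume "X \<in> carrier (word_monoid A R)" "Y \<in> carrier (word_monoid A R)"
    then obtain u v where "u \<in> lists A" "X = word_class A R u" "v \<in> lists A" "Y = word_class A R v"
      unfolding carrier_word_monoid by blast
    then show "\<phi> (X \<otimes>\<^bsub>word_monoid A R\<^esub> Y) = \<phi> X \<otimes> \<phi> Y"
      by (simp only: mult_word_monoid append_in_lists_conv eq word_eval_append[OF f] simp_thms)
  qed
  moreover have "\<forall>x\<in>A. \<phi> (word_class A R [x]) = f x"
    using f by (auto simp: eq)
  ultimately show ?thesis by blast
qed

end

lemma word_monoid_hom_unique:
  assumes G: "group G" and \<phi>: "\<phi> \<in> hom (word_monoid A R) G" and \<psi>: "\<psi> \<in> hom (word_monoid A R) G"
    and eq: "\<And>x. x \<in> A \<Longrightarrow> \<phi> (word_class A R [x]) = \<psi> (word_class A R [x])"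
    and X: "X \<in> carrier (word_monoid A R)"
  shows "\<phi> X = \<psi> X"
proof -
  interpret G: group G by (rule G)
  interpret M: monoid "word_monoid A R" by (rule monoid_word_monoid)
  have one: "\<chi> (word_class A R []) = \<one>\<^bsub>G\<^esub>" if "\<chi> \<in> hom (word_monoid A R) G" for \<chi>
  proof -
    have "\<chi> \<one>\<^bsub>word_monoid A R\<^esub> \<otimes>\<^bsub>G\<^esub> \<chi> \<one>\<^bsub>word_monoid A R\<^esub> = \<chi> \<one>\<^bsub>word_monoid A R\<^esub>"
      using hom_mult[OF that M.one_closed M.one_closed] by simp
    then show ?thesis
      using hom_in_carrier[OF that M.one_closed] by (simp add: one_word_monoid)
  qed
  have "\<phi> (word_class A R w) = \<psi> (word_class A R w)" if "w \<in> lists A" for w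
    using that
  proof (induction w)
    case Nil
    then show ?case by (simp add: one \<phi> \<psi>)
  next
    case (Cons x w)
    then have x: "[x] \<in> lists A" "w \<in> lists A" by auto
    show ?case
      using hom_mult[OF \<phi> word_class_closed[OF x(1)] word_class_closed[OF x(2)]]
        hom_mult[OF \<psi> word_class_closed[OF x(1)] word_class_closed[OF x(2)]] Cons eq
      by (simp add: mult_word_monoid x)
  qed
  with X show ?thesis by (auto simp: carrier_word_monoid)
qed

lemma group_free_group: "group (free_group X)"
  unfolding free_group_def
proof (rule group_word_monoid)
  fix y :: "'a \<times> bool" assume "y \<in> X \<times> UNIV"
  then obtain x b where y: "y = (x, b)" "x \<in> X" by auto
  have "([] @ [(x, \<not> b), (x, b)] @ [], [] @ [] @ []) \<in> word_cong (X \<times> UNIV) (free_group_rels X)"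
    using y by (intro word_cong.rel) (auto simp: free_group_rels_def)
  with y show "\<exists>w\<in>lists (X \<times> UNIV). (w @ [y], []) \<in> word_cong (X \<times> UNIV) (free_group_rels X)"
    by (intro bexI[of _ "[(x, \<not> b)]"]) auto
qed

lemma group_free_product:
  assumes "\<And>i. i \<in> I \<Longrightarrow> group (G i)"
  shows "group (free_product I G)"
  unfolding free_product_def
proof (rule group_word_monoid)
  let ?A = "SIGMA i:I. carrier (G i)" and ?R = "free_product_rels I G"
  fix y assume "y \<in> ?A"
  then obtain i a where y: "y = (i, a)" "i \<in> I" "a \<in> carrier (G i)" by auto
  interpret group "G i" using assms y by blast
  have "([] @ [(i, inv\<^bsub>G i\<^esub> a), (i, a)] @ [], [] @ [(i, inv\<^bsub>G i\<^esub> a \<otimes>\<^bsub>G i\<^esub> a)] @ []) \<in> word_cong ?A ?R"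
    using y by (intro word_cong.rel) (auto simp: free_product_rels_def simp del: l_inv l_inv_ex)
  moreover have "([] @ [(i, \<one>\<^bsub>G i\<^esub>)] @ [], [] @ [] @ []) \<in> word_cong ?A ?R"
    using y by (intro word_cong.rel) (auto simp: free_product_rels_def)
  ultimately have "([(i, inv\<^bsub>G i\<^esub> a)] @ [y], []) \<in> word_cong ?A ?R"
    using y by (simp add: l_inv) (rule word_cong.trans)
  then show "\<exists>w\<in>lists ?A. (w @ [y], []) \<in> word_cong ?A ?R"
    using y by (intro bexI[of _ "[(i, inv\<^bsub>G i\<^esub> a)]"]) auto
qed

lemma group_free_product2:
  assumes "group G" "group H"
  shows "group (free_product2 G H)"
  unfolding free_product2_def
proof (rule group_word_monoid)
  interpret G: group G by fact
  interpret H: group H by fact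
  let ?A = "carrier G <+> carrier H" and ?R = "free_product2_rels G H"
  fix y assume "y \<in> ?A"
  then consider (l) a where "y = Inl a" "a \<in> carrier G" | (r) b where "y = Inr b" "b \<in> carrier H"
    by blast
  then show "\<exists>w\<in>lists ?A. (w @ [y], []) \<in> word_cong ?A ?R"
  proof cases
    case l
    have "inv\<^bsub>G\<^esub> a \<in> carrier G" using l by simp
    then have "([Inl (inv\<^bsub>G\<^esub> a), Inl a], [Inl (inv\<^bsub>G\<^esub> a \<otimes>\<^bsub>G\<^esub> a)]) \<in> ?R"
      unfolding free_product2_rels_def using l(2) by blast
    then have "([] @ [Inl (inv\<^bsub>G\<^esub> a), Inl a] @ [], [] @ [Inl (inv\<^bsub>G\<^esub> a \<otimes>\<^bsub>G\<^esub> a)] @ []) \<in> word_cong ?A ?R"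
      using l by (intro word_cong.rel) auto
    moreover have "([] @ [Inl \<one>\<^bsub>G\<^esub>] @ [], [] @ [] @ []) \<in> word_cong ?A ?R"
      by (intro word_cong.rel) (auto simp: free_product2_rels_def)
    ultimately have "([Inl (inv\<^bsub>G\<^esub> a)] @ [y], []) \<in> word_cong ?A ?R"
      using l by simp (rule word_cong.trans)
    then show ?thesis
      using l by (intro bexI[of _ "[Inl (inv\<^bsub>G\<^esub> a)]"]) auto
  next
    case r
    have "inv\<^bsub>H\<^esub> b \<in> carrier H" using r by simp
    then have "([Inr (inv\<^bsub>H\<^esub> b), Inr b], [Inr (inv\<^bsub>H\<^esub> b \<otimes>\<^bsub>H\<^esub> b)]) \<in> ?R"
      unfolding free_product2_rels_def using r(2) by blast
    then have "([] @ [Inr (inv\<^bsub>H\<^esub> b), Inr b] @ [], [] @ [Inr (inv\<^bsub>H\<^esub> b \<otimes>\<^bsub>H\<^esub> b)] @ []) \<in> word_cong ?A ?R"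
      using r by (intro word_cong.rel) auto
    moreover have "([] @ [Inr \<one>\<^bsub>H\<^esub>] @ [], [] @ [] @ []) \<in> word_cong ?A ?R"
      by (intro word_cong.rel) (auto simp: free_product2_rels_def)
    ultimately have "([Inr (inv\<^bsub>H\<^esub> b)] @ [y], []) \<in> word_cong ?A ?R"
      using r by simp (rule word_cong.trans)
    then show ?thesis
      using r by (intro bexI[of _ "[Inr (inv\<^bsub>H\<^esub> b)]"]) auto
  qed
qed

lemma free_product_inj_closed:
  "i \<in> I \<Longrightarrow> a \<in> carrier (G i) \<Longrightarrow> free_product_inj I G i a \<in> carrier (free_product I G)"
  unfolding free_product_inj_def free_product_def by (rule word_class_closed) simp

lemma normal_normal_closure:
  assumes "group G" "S \<subseteq> carrier G"
  shows "normal_closure G S \<lhd> G"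
proof -
  interpret group G by fact
  show ?thesis
    unfolding normal_closure_def
  proof (rule normal_generateI)
    show "{g \<otimes>\<^bsub>G\<^esub> s \<otimes>\<^bsub>G\<^esub> inv\<^bsub>G\<^esub> g | g s. g \<in> carrier G \<and> s \<in> S} \<subseteq> carrier G"
      using assms(2) by auto
  next
    fix h k assume "h \<in> {g \<otimes>\<^bsub>G\<^esub> s \<otimes>\<^bsub>G\<^esub> inv\<^bsub>G\<^esub> g | g s. g \<in> carrier G \<and> s \<in> S}" and k: "k \<in> carrier G"
    then obtain g s where g: "g \<in> carrier G" "s \<in> S" and h: "h = g \<otimes>\<^bsub>G\<^esub> s \<otimes>\<^bsub>G\<^esub> inv\<^bsub>G\<^esub> g"
      by blast
    have "s \<in> carrier G" using g assms(2) by blast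
    then have "k \<otimes>\<^bsub>G\<^esub> h \<otimes>\<^bsub>G\<^esub> inv\<^bsub>G\<^esub> k = (k \<otimes>\<^bsub>G\<^esub> g) \<otimes>\<^bsub>G\<^esub> s \<otimes>\<^bsub>G\<^esub> inv\<^bsub>G\<^esub> (k \<otimes>\<^bsub>G\<^esub> g)"
      using g k unfolding h by (simp add: inv_mult_group m_assoc)
    moreover have "k \<otimes>\<^bsub>G\<^esub> g \<in> carrier G" using k g by simp
    ultimately show "k \<otimes>\<^bsub>G\<^esub> h \<otimes>\<^bsub>G\<^esub> inv\<^bsub>G\<^esub> k
        \<in> {g \<otimes>\<^bsub>G\<^esub> s \<otimes>\<^bsub>G\<^esub> inv\<^bsub>G\<^esub> g | g s. g \<in> carrier G \<and> s \<in> S}"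
      using g(2) by blast
  qed
qed

lemma group_graph_product:
  assumes "finite_simplicial_graph V E" and G: "\<And>v. v \<in> V \<Longrightarrow> group (G v)"
  shows "group (graph_product V E G)"
proof -
  interpret group "free_product V G" using G by (rule group_free_product)
  have "graph_product_rels V E G \<subseteq> carrier (free_product V G)"
  proof
    fix x assume "x \<in> graph_product_rels V E G"
    then obtain v u a b where x: "x = commutator (free_product V G)
          (free_product_inj V G v a) (free_product_inj V G u b)"
      and e: "{v, u} \<in> E" and ab: "a \<in> carrier (G v)" "b \<in> carrier (G u)"
      unfolding graph_product_rels_def by blast
    have "v \<in> V" "u \<in> V"
      using assms(1) e by (auto simp: finite_simplicial_graph_def)
    then have "free_product_inj V G v a \<in> carrier (free_product V G)"
      "free_product_inj V G u b \<in> carrier (free_product V G)"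
      using ab by (auto intro: free_product_inj_closed)
    then show "x \<in> carrier (free_product V G)"
      unfolding x commutator_def by (intro m_closed inv_closed)
  qed
  then show ?thesis
    unfolding graph_product_def
    by (rule normal.factorgroup_is_group[OF normal_normal_closure[OF is_group]])
qed

lemma group_GL: "group (GL n :: 'r::comm_ring_1 mat monoid)"
proof -
  interpret ring "ring_mat TYPE('r) n ()" by (rule ring_mat)
  show ?thesis unfolding GL_def by (rule units_group)
qed

lemma group_equation_group: "group G \<Longrightarrow> group (equation_group G n)"
  unfolding equation_group_def by (rule group_free_product2) (auto intro: group_free_group)

lemma free_group_gen_closed: "x \<in> X \<Longrightarrow> free_group_gen X x \<in> carrier (free_group X)"
  unfolding free_group_gen_def free_group_def by (rule word_class_closed) simp

lemma free_group_gen_inv: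
  assumes "x \<in> X"
  shows "inv\<^bsub>free_group X\<^esub> (free_group_gen X x) = word_class (X \<times> UNIV) (free_group_rels X) [(x, False)]"
proof -
  interpret group "free_group X" by (rule group_free_group)
  have "word_class (X \<times> UNIV) (free_group_rels X) [(x, False), (x, True)]
      = word_class (X \<times> UNIV) (free_group_rels X) []"
    by (rule word_class_rel) (use assms in \<open>auto simp: free_group_rels_def\<close>)
  then have "word_class (X \<times> UNIV) (free_group_rels X) [(x, False)] \<otimes>\<^bsub>free_group X\<^esub> free_group_gen X x
      = \<one>\<^bsub>free_group X\<^esub>"
    using assms by (simp add: free_group_def free_group_gen_def mult_word_monoid one_word_monoid)
  moreover have "word_class (X \<times> UNIV) (free_group_rels X) [(x, False)] \<in> carrier (free_group X)"
    unfolding free_group_def by (rule word_class_closed) (use assms in simp)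
  ultimately show ?thesis
    by (intro inv_equality free_group_gen_closed assms)
qed

lemma free_group_lift:
  assumes "group G" "g ` X \<subseteq> carrier G"
  shows "\<exists>\<phi> \<in> hom (free_group X) G. \<forall>x\<in>X. \<phi> (free_group_gen X x) = g x"
proof -
  interpret group G by fact
  let ?f = "\<lambda>(x, b). if b then g x else inv\<^bsub>G\<^esub> (g x)"
  have "\<exists>\<phi> \<in> hom (free_group X) G.
      \<forall>y\<in>X \<times> UNIV. \<phi> (word_class (X \<times> UNIV) (free_group_rels X) [y]) = ?f y"
    unfolding free_group_def
    by (rule word_monoid_lift)
      (use assms(2) in \<open>auto simp: free_group_rels_def image_subset_iff\<close>)
  then obtain \<phi> where \<phi>: "\<phi> \<in> hom (free_group X) G"
    and eq: "\<And>y. y \<in> X \<times> UNIV \<Longrightarrow> \<phi> (word_class (X \<times> UNIV) (free_group_rels X) [y]) = ?f y"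
    by blast
  have "\<phi> (free_group_gen X x) = g x" if "x \<in> X" for x
    unfolding free_group_gen_def using eq[of "(x, True)"] that by simp
  with \<phi> show ?thesis by blast
qed

lemma free_group_hom_unique:
  assumes "group G" "\<phi> \<in> hom (free_group X) G" "\<psi> \<in> hom (free_group X) G"
    and "\<And>x. x \<in> X \<Longrightarrow> \<phi> (free_group_gen X x) = \<psi> (free_group_gen X x)"
    and "w \<in> carrier (free_group X)"
  shows "\<phi> w = \<psi> w"
proof -
  interpret \<phi>: group_hom "free_group X" G \<phi>
    using assms group_free_group by (simp add: group_hom_def group_hom_axioms_def)
  interpret \<psi>: group_hom "free_group X" G \<psi>
    using assms group_free_group by (simp add: group_hom_def group_hom_axioms_def)
  have "\<phi> (word_class (X \<times> UNIV) (free_group_rels X) [y])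
      = \<psi> (word_class (X \<times> UNIV) (free_group_rels X) [y])" if y: "y \<in> X \<times> UNIV" for y
  proof (cases "snd y")
    case True
    then have "y = (fst y, True)" by (metis prod.collapse)
    then show ?thesis using assms(4)[of "fst y"] y unfolding free_group_gen_def by (metis mem_Sigma_iff)
  next
    case False
    have x: "fst y \<in> X" using y by auto
    have "word_class (X \<times> UNIV) (free_group_rels X) [y] = inv\<^bsub>free_group X\<^esub> (free_group_gen X (fst y))"
      using free_group_gen_inv[OF x] False by (metis prod.collapse)
    then show ?thesis using assms(4) x by (simp add: free_group_gen_closed)
  qed
  then show ?thesis
    using word_monoid_hom_unique[OF assms(1), of \<phi> "X \<times> UNIV" "free_group_rels X" \<psi> w] assms
    by (simp add: free_group_def)
qed

lemma free_product2_lift: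
  assumes "group G" "group H" "group K" "f \<in> hom G K" "h \<in> hom H K"
  shows "\<exists>\<phi> \<in> hom (free_product2 G H) K.
    (\<forall>a\<in>carrier G. \<phi> (free_product2_inl G H a) = f a) \<and>
    (\<forall>b\<in>carrier H. \<phi> (free_product2_inr G H b) = h b)"
proof -
  interpret f: group_hom G K f using assms by (simp add: group_hom_def group_hom_axioms_def)
  interpret h: group_hom H K h using assms by (simp add: group_hom_def group_hom_axioms_def)
  have "\<exists>\<phi> \<in> hom (free_product2 G H) K. \<forall>y\<in>carrier G <+> carrier H.
      \<phi> (word_class (carrier G <+> carrier H) (free_product2_rels G H) [y]) = case_sum f h y"
    unfolding free_product2_def
    by (rule f.H.word_monoid_lift) (auto simp: free_product2_rels_def)
  then obtain \<phi> where \<phi>: "\<phi> \<in> hom (free_product2 G H) K"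
    and eq: "\<And>y. y \<in> carrier G <+> carrier H \<Longrightarrow>
      \<phi> (word_class (carrier G <+> carrier H) (free_product2_rels G H) [y]) = case_sum f h y"
    by blast
  have "\<phi> (free_product2_inl G H a) = f a" if "a \<in> carrier G" for a
    unfolding free_product2_inl_def using eq[OF InlI, OF that] by simp
  moreover have "\<phi> (free_product2_inr G H b) = h b" if "b \<in> carrier H" for b
    unfolding free_product2_inr_def using eq[OF InrI, OF that] by simp
  ultimately show ?thesis using \<phi> by blast
qed

lemma free_product2_inr_hom:
  assumes "group G" "group H"
  shows "free_product2_inr G H \<in> hom H (free_product2 G H)"
proof -
  interpret H: group H by fact
  show ?thesis
  proof (rule homI)
    fix a b assume ab: "a \<in> carrier H" "b \<in> carrier H"
    have "word_class (carrier G <+> carrier H) (free_product2_rels G H) [Inr a, Inr b]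
        = word_class (carrier G <+> carrier H) (free_product2_rels G H) [Inr (a \<otimes>\<^bsub>H\<^esub> b)]"
      by (rule word_class_rel) (use ab in \<open>auto simp: free_product2_rels_def\<close>)
    then show "free_product2_inr G H (a \<otimes>\<^bsub>H\<^esub> b) =
        free_product2_inr G H a \<otimes>\<^bsub>free_product2 G H\<^esub> free_product2_inr G H b"
      using ab by (simp add: free_product2_inr_def free_product2_def mult_word_monoid InrI)
  qed (auto simp: free_product2_inr_def free_product2_def intro!: word_class_closed)
qed

lemma ex_is_substitution:
  assumes "group G" "g \<in> {..<n} \<rightarrow>\<^sub>E carrier G"
  shows "\<exists>\<phi>. is_substitution G n g \<phi>"
proof -
  obtain \<psi> where \<psi>: "\<psi> \<in> hom (free_group {..<n}) G" "\<forall>i\<in>{..<n}. \<psi> (free_group_gen {..<n} i) = g i"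
    using free_group_lift[OF assms(1), of g "{..<n}"] assms(2) by auto
  have "(\<lambda>x. x) \<in> hom G G" by (auto intro: homI)
  from free_product2_lift[OF assms(1) group_free_group assms(1) this \<psi>(1)]
  show ?thesis
    using \<psi>(2) by (auto simp: is_substitution_def equation_group_def equation_const_def
        equation_var_def free_group_gen_closed)
qed

lemma is_substitution_unique:
  assumes G: "group G" and \<phi>: "is_substitution G n g \<phi>" and \<psi>: "is_substitution G n g \<psi>"
    and w: "w \<in> carrier (equation_group G n)"
  shows "\<phi> w = \<psi> w"
proof -
  let ?F = "free_group {..<n}"
  have hom: "\<phi> \<in> hom (free_product2 G ?F) G" "\<psi> \<in> hom (free_product2 G ?F) G"
    using \<phi> \<psi> by (auto simp: is_substitution_def equation_group_def)
  have inr: "free_product2_inr G ?F \<in> hom ?F (free_product2 G ?F)"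
    using G group_free_group by (rule free_product2_inr_hom)
  have "(\<phi> \<circ> free_product2_inr G ?F) b = (\<psi> \<circ> free_product2_inr G ?F) b" if "b \<in> carrier ?F" for b
    by (rule free_group_hom_unique[OF G hom_compose[OF inr hom(1)] hom_compose[OF inr hom(2)] _ that])
      (use \<phi> \<psi> in \<open>auto simp: is_substitution_def equation_var_def\<close>)
  then have r: "\<phi> (free_product2_inr G ?F b) = \<psi> (free_product2_inr G ?F b)"
    if "b \<in> carrier ?F" for b using that by simp
  have l: "\<phi> (free_product2_inl G ?F a) = \<psi> (free_product2_inl G ?F a)" if "a \<in> carrier G" for a
    using that \<phi> \<psi> by (auto simp: is_substitution_def equation_const_def)
  show ?thesis
    by (rule word_monoid_hom_unique[OF G hom[unfolded free_product2_def] _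
          w[unfolded equation_group_def free_product2_def]])
      (use l r in \<open>auto simp: free_product2_inl_def free_product2_inr_def\<close>)
qed

declare in_listsD [dest!] in_listsI [intro!]

end

(*
  The graph product is linear over the polynomial ring in countably many variables over the given
  domain. Say that a representation M of a group H with a vector e and a linear form f separates a
  subgroup K if f(e) = 0, K fixes e and f, and f(M(h) e) is nonzero for h outside K; for trivial K
  the representation is faithful. By induction on the number of vertices, the subgroup of a vertex set U
  has such a representation relative to the subgroup of any S inside U. In the induction step a
  vertex v outside S is split off: the graph product over U is the amalgam of the one over U - {v}
  and of G_v times the link of v, over the link of v. A separating representation of the first
  group relative to the link and one of G_v relative to the trivial group are glued by a transvection-like
  formula with a fresh variable t, and the leading coefficient in t shows that alternating words
  do not fix the vector. Linear groups are equationally noetherian by Hilbert's basis theorem.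
*)
theory Submission
  imports Defs
    "HOL-Library.Function_Algebras"
    "HOL-Library.Nat_Bijection"
    "HOL-Library.Poly_Mapping"
    "HOL-Computational_Algebra.Polynomial"
    "HOL-Computational_Algebra.Fraction_Field"
begin

section \<open>Noetherian subrings and Hilbert's basis theorem\<close>

text \<open>Faithful representations of the two factors would not be enough for the gluing: an
  alternating word mixes the factors, and each inner block outside the amalgamated subgroup has to
  contribute a nonzero scalar. The value f(M(h) e) is such a scalar and depends only on the double
  coset of h. As the scalars form a domain, the leading coefficient, which is a product of such
  values, cannot vanish. The pair of vertex sets S and U in the induction has the same origin: the
  gluing needs separation relative to the link and only yields separation relative to U - {v}, so a
  direct sum with a second representation has to descend from there to S. Every step enlarges the
  scalars and the dimension, while the types stay fixed. Hence a single polynomial ring with a bound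
  \<open>k\<close> on the variables in use, vectors indexed by all natural numbers, and a finite set
  \<open>I\<close> of coordinates on which the finite-dimensional representation lives. This ring is
  not noetherian, so the basis theorem is applied over its fraction field.\<close>

definition is_subring :: "'b::comm_ring_1 set \<Rightarrow> bool"
  where "is_subring A \<longleftrightarrow> 0 \<in> A \<and> 1 \<in> A \<and>
    (\<forall>x\<in>A. \<forall>y\<in>A. x + y \<in> A) \<and> (\<forall>x\<in>A. \<forall>y\<in>A. x * y \<in> A) \<and> (\<forall>x\<in>A. - x \<in> A)"

lemma is_subringD:
  assumes "is_subring A"
  shows "0 \<in> A" "1 \<in> A" "\<And>x y. x \<in> A \<Longrightarrow> y \<in> A \<Longrightarrow> x + y \<in> A"
    "\<And>x y. x \<in> A \<Longrightarrow> y \<in> A \<Longrightarrow> x * y \<in> A" "\<And>x. x \<in> A \<Longrightarrow> - x \<in> A"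
  using assms by (auto simp: is_subring_def)

lemma is_subring_sum:
  assumes "is_subring A" "\<And>x. x \<in> X \<Longrightarrow> f x \<in> A"
  shows "sum f X \<in> A"
  using assms(2) by (induction X rule: infinite_finite_induct) (auto intro: is_subringD[OF assms(1)])

text \<open>The coefficients come from a subring \<open>A\<close> of an ambient ring and not from a
  type of their own, so that adjoining elements one after the other never changes the type.\<close>

inductive_set ideal_span :: "'b::comm_ring_1 set \<Rightarrow> 'b set \<Rightarrow> 'b set"
  for A F :: "'b set"
where
  zero: "0 \<in> ideal_span A F"
| step: "a \<in> A \<Longrightarrow> y \<in> F \<Longrightarrow> x \<in> ideal_span A F \<Longrightarrow> a * y + x \<in> ideal_span A F"

lemma ideal_span_add:
  assumes "x \<in> ideal_span A F" "z \<in> ideal_span A F"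
  shows "x + z \<in> ideal_span A F"
  using assms by (induction rule: ideal_span.induct) (auto simp: add.assoc intro: ideal_span.step)

lemma ideal_span_mult:
  assumes "is_subring A" "a \<in> A" "x \<in> ideal_span A F"
  shows "a * x \<in> ideal_span A F"
  using assms(3)
proof (induction rule: ideal_span.induct)
  case zero
  then show ?case by (simp add: ideal_span.zero)
next
  case (step b y x)
  have "a * b \<in> A" using assms step by (auto intro: is_subringD)
  from ideal_span.step[OF this step(2) step.IH] show ?case
    by (simp add: distrib_left mult.assoc)
qed

lemma ideal_span_superset:
  assumes "is_subring A" "x \<in> F"
  shows "x \<in> ideal_span A F"
  using ideal_span.step[OF is_subringD(2)[OF assms(1)] assms(2) ideal_span.zero] by simp

lemma ideal_span_uminus:
  assumes "is_subring A" "x \<in> ideal_span A F"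
  shows "- x \<in> ideal_span A F"
  using ideal_span_mult[OF assms(1) _ assms(2), of "-1"] assms(1) by (auto intro: is_subringD)

lemma ideal_span_minimal:
  assumes "is_subring A" "F \<subseteq> ideal_span A F'"
  shows "ideal_span A F \<subseteq> ideal_span A F'"
proof
  fix x assume "x \<in> ideal_span A F"
  then show "x \<in> ideal_span A F'"
    by (induction rule: ideal_span.induct)
      (use assms in \<open>auto intro!: ideal_span.zero ideal_span_add ideal_span_mult\<close>)
qed

lemma ideal_span_mono: "is_subring A \<Longrightarrow> F \<subseteq> F' \<Longrightarrow> ideal_span A F \<subseteq> ideal_span A F'"
  by (rule ideal_span_minimal) (auto intro: ideal_span_superset)

lemma ideal_span_subset:
  assumes "is_subring A" "F \<subseteq> A"
  shows "ideal_span A F \<subseteq> A"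
proof
  fix x assume "x \<in> ideal_span A F"
  then show "x \<in> A"
    by (induction rule: ideal_span.induct) (use assms in \<open>auto intro: is_subringD\<close>)
qed

lemma ideal_span_finite:
  assumes "is_subring A" "finite X" "X \<subseteq> ideal_span A F"
  shows "\<exists>F0\<subseteq>F. finite F0 \<and> X \<subseteq> ideal_span A F0"
  using assms(2,3)
proof (induction X)
  case (insert x X)
  have "x \<in> ideal_span A F" using insert.prems by simp
  then have "\<exists>F1\<subseteq>F. finite F1 \<and> x \<in> ideal_span A F1"
  proof (induction rule: ideal_span.induct)
    case zero
    then show ?case by (auto intro: ideal_span.zero)
  next
    case (step a y x)
    then obtain F0 where F0: "F0 \<subseteq> F" "finite F0" "x \<in> ideal_span A F0" by blast
    have "a * y + x \<in> ideal_span A (insert y F0)"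
      using ideal_span_mono[OF assms(1), of F0 "insert y F0"] F0 step
      by (intro ideal_span.step) auto
    then show ?case using F0 step by (intro exI[of _ "insert y F0"]) auto
  qed
  then obtain F1 where F1: "F1 \<subseteq> F" "finite F1" "x \<in> ideal_span A F1"
    by blast
  have "X \<subseteq> ideal_span A F" using insert.prems by simp
  from insert.IH[OF this] obtain F0 where F0: "F0 \<subseteq> F" "finite F0" "X \<subseteq> ideal_span A F0"
    by blast
  have "ideal_span A F0 \<subseteq> ideal_span A (F0 \<union> F1)" "ideal_span A F1 \<subseteq> ideal_span A (F0 \<union> F1)"
    by (intro ideal_span_mono[OF assms(1)]; simp)+
  then have "insert x X \<subseteq> ideal_span A (F0 \<union> F1)"
    using F0(3) F1(3) by blast
  then show ?case using F0 F1 by (intro exI[of _ "F0 \<union> F1"]) simp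
qed auto

text \<open>The generators are chosen inside the given set \<open>F\<close>, which need not be an
  ideal; this is the form that cuts a system of equations down to a finite subsystem.\<close>

definition noetherian_subring :: "'b::comm_ring_1 set \<Rightarrow> bool"
  where "noetherian_subring A \<longleftrightarrow> is_subring A \<and>
    (\<forall>F\<subseteq>A. \<exists>F0\<subseteq>F. finite F0 \<and> F \<subseteq> ideal_span A F0)"

definition polys_over :: "'b::comm_ring_1 set \<Rightarrow> 'b poly set"
  where "polys_over A = {p. \<forall>i. coeff p i \<in> A}"

lemma is_subring_polys_over:
  assumes "is_subring A"
  shows "is_subring (polys_over A)"
  unfolding is_subring_def polys_over_def
  using assms
  by (auto simp: coeff_mult intro!: is_subring_sum intro: is_subringD)

text \<open>Monomial factors raise all generators to degree \<open>d\<close>, so a combination of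
  leading coefficients lifts to a polynomial in the ideal with that coefficient at
  \<open>d\<close>.\<close>

lemma ideal_span_lead_coeffs:
  assumes A: "is_subring A" and X: "X \<subseteq> polys_over A" and d: "\<And>p. p \<in> X \<Longrightarrow> degree p \<le> d"
    and c: "c \<in> ideal_span A (lead_coeff ` X)"
  shows "\<exists>q\<in>ideal_span (polys_over A) X. degree q \<le> d \<and> coeff q d = c"
  using c
proof (induction rule: ideal_span.induct)
  case zero
  then show ?case by (auto intro!: bexI[of _ 0] ideal_span.zero)
next
  case (step a y x)
  then obtain q p where q: "q \<in> ideal_span (polys_over A) X" "degree q \<le> d" "coeff q d = x"
    and p: "p \<in> X" "y = lead_coeff p" by blast
  let ?m = "monom a (d - degree p)"
  have m: "?m \<in> polys_over A"
    using step(1) A by (auto simp: polys_over_def intro: is_subringD)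
  have "degree (?m * p) \<le> d"
    using degree_mult_le[of ?m p] degree_monom_le[of a "d - degree p"] d[OF p(1)] by linarith
  then have "degree (?m * p + q) \<le> d" using q(2) by (rule degree_add_le)
  moreover have "coeff (?m * p + q) d = a * y + x"
    using q(3) d[OF p(1)] by (simp add: coeff_monom_mult p(2))
  moreover have "?m * p + q \<in> ideal_span (polys_over A) X"
    using m p(1) q(1) by (rule ideal_span.step)
  ultimately show ?case by blast
qed

theorem hilbert_basis:
  assumes "noetherian_subring A"
  shows "noetherian_subring (polys_over A)"
proof -
  let ?P = "polys_over A"
  from assms have A: "is_subring A" and noeth: "\<And>F. F \<subseteq> A \<Longrightarrow> \<exists>F0\<subseteq>F. finite F0 \<and> F \<subseteq> ideal_span A F0"
    by (auto simp: noetherian_subring_def)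
  note P = is_subring_polys_over[OF A]
  have "\<exists>F0\<subseteq>F. finite F0 \<and> F \<subseteq> ideal_span ?P F0" if F: "F \<subseteq> ?P" for F
  proof -
    let ?I = "ideal_span ?P F"
    have "\<exists>X\<subseteq>?I. finite X \<and> ?I \<subseteq> ideal_span ?P X"
    proof (rule ccontr)
      assume contra: "\<not> ?thesis"
      \<comment> \<open>A missing element of least degree: the degrees of successive choices cannot
        drop, and every element of the ideal of smaller degree is already generated.\<close>
      define nxt where "nxt X = (ARG_MIN degree p. p \<in> ?I - ideal_span ?P X)" for X
      have nxt: "nxt X \<in> ?I - ideal_span ?P X"
        "\<And>q. q \<in> ?I - ideal_span ?P X \<Longrightarrow> degree (nxt X) \<le> degree q"
        if "X \<subseteq> ?I" "finite X" for X
      proof -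
        have "\<not> ?I \<subseteq> ideal_span ?P X" using contra that by simp
        then obtain p where p: "p \<in> ?I - ideal_span ?P X" by blast
        show "nxt X \<in> ?I - ideal_span ?P X"
          unfolding nxt_def using arg_min_natI[of "\<lambda>p. p \<in> ?I - ideal_span ?P X" p degree, OF p] .
        show "degree (nxt X) \<le> degree q" if "q \<in> ?I - ideal_span ?P X" for q
          unfolding nxt_def using arg_min_nat_le[of "\<lambda>p. p \<in> ?I - ideal_span ?P X" q degree, OF that] .
      qed
      define X where "X = rec_nat {} (\<lambda>_ Y. insert (nxt Y) Y)"
      define p where "p n = nxt (X n)" for n
      have X_eq: "X n = p ` {..<n}" for n
        by (induction n) (auto simp: X_def p_def lessThan_Suc)
      have XI: "X n \<subseteq> ?I \<and> finite (X n)" for n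
      proof (induction n)
        case (Suc n)
        then show ?case using nxt(1)[of "X n"] by (auto simp: X_def)
      qed (auto simp: X_def)
      have pI: "p n \<in> ?I" and pX: "p n \<notin> ideal_span ?P (X n)" for n
        using nxt(1)[of "X n"] XI by (auto simp: p_def)
      have mono: "degree (p m) \<le> degree (p n)" if "m \<le> n" for m n
      proof -
        have "X m \<subseteq> X n" using that by (auto simp: X_eq)
        then have "p n \<notin> ideal_span ?P (X m)"
          using ideal_span_mono[OF P, of "X m" "X n"] pX[of n] by blast
        then show ?thesis using nxt(2)[of "X m" "p n"] XI pI by (auto simp: p_def)
      qed
      have IP: "?I \<subseteq> ?P" using ideal_span_subset[OF P F] .
      have "range (\<lambda>n. lead_coeff (p n)) \<subseteq> A"
        using pI IP by (auto simp: polys_over_def)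
      from noeth[OF this] obtain F0 where F0: "F0 \<subseteq> range (\<lambda>n. lead_coeff (p n))" "finite F0"
        "range (\<lambda>n. lead_coeff (p n)) \<subseteq> ideal_span A F0" by blast
      then obtain M where M: "finite M" "F0 = (\<lambda>n. lead_coeff (p n)) ` M"
        by (meson finite_subset_image)
      then obtain N where N: "M \<subseteq> {..<N}" by (meson finite_nat_iff_bounded)
      have "F0 \<subseteq> lead_coeff ` X N" using N M(2) by (auto simp: X_eq)
      then have c: "lead_coeff (p N) \<in> ideal_span A (lead_coeff ` X N)"
        using F0(3) ideal_span_mono[OF A, of F0 "lead_coeff ` X N"] by auto
      have "\<exists>q\<in>ideal_span ?P (X N). degree q \<le> degree (p N) \<and> coeff q (degree (p N)) = lead_coeff (p N)"
        by (rule ideal_span_lead_coeffs[OF A _ _ c]) (use XI IP mono in \<open>auto simp: X_eq\<close>)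
      then obtain q where q: "q \<in> ideal_span ?P (X N)" "degree q \<le> degree (p N)"
        "coeff q (degree (p N)) = lead_coeff (p N)" by blast
      \<comment> \<open>\<open>q\<close> cancels the leading term of \<open>p N\<close>. The
        difference is still not generated, so by minimality its degree cannot be smaller than that
        of \<open>p N\<close>, although its coefficient there is zero.\<close>
      have nz: "p N - q \<notin> ideal_span ?P (X N)"
      proof
        assume "p N - q \<in> ideal_span ?P (X N)"
        from ideal_span_add[OF this q(1)] show False using pX by simp
      qed
      have "q \<in> ?I" using q(1) ideal_span_minimal[OF P, of "X N" F] XI by blast
      then have "p N - q \<in> ?I"
        using ideal_span_add[OF pI ideal_span_uminus[OF P]] by simp
      with nz have "degree (p N) \<le> degree (p N - q)"
        using nxt(2)[of "X N" "p N - q"] XI by (simp add: p_def)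
      moreover have "degree (p N - q) \<le> degree (p N)"
        using q(2) by (simp add: degree_diff_le)
      ultimately have "degree (p N - q) = degree (p N)" by simp
      then have "lead_coeff (p N - q) = 0" using q(3) by (simp del: leading_coeff_0_iff)
      then have "p N - q = 0" by (simp only: leading_coeff_0_iff)
      then show False using nz ideal_span.zero by metis
    qed
    then obtain X where X: "X \<subseteq> ?I" "finite X" "?I \<subseteq> ideal_span ?P X" by blast
    obtain F0 where F0: "F0 \<subseteq> F" "finite F0" "X \<subseteq> ideal_span ?P F0"
      using ideal_span_finite[OF P X(2,1)] by blast
    have "F \<subseteq> ideal_span ?P F0"
      using X(3) ideal_span_minimal[OF P F0(3)] ideal_span_superset[OF P, of _ F] by blast
    with F0 show ?thesis by blast
  qed
  with P show ?thesis by (auto simp: noetherian_subring_def)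
qed

text \<open>The subring generated by \<open>A\<close> and \<open>x\<close> is the image of
  \<open>polys_over A\<close> under evaluation at \<open>x\<close>. Generators of the preimage of
  \<open>F\<close> are mapped to generators of \<open>F\<close>.\<close>

lemma noetherian_subring_adjoin:
  fixes A :: "'b::comm_ring_1 set"
  assumes "noetherian_subring A"
  shows "\<exists>A'. noetherian_subring A' \<and> A \<subseteq> A' \<and> x \<in> A'"
proof -
  let ?P = "polys_over A" and ?h = "\<lambda>p. poly p x"
  have A: "is_subring A" using assms by (simp add: noetherian_subring_def)
  note P = is_subring_polys_over[OF A]
  have "noetherian_subring ?P" using assms by (rule hilbert_basis)
  then have noeth: "\<exists>F0\<subseteq>F. finite F0 \<and> F \<subseteq> ideal_span ?P F0" if "F \<subseteq> ?P" for F
    using that by (auto simp: noetherian_subring_def)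
  have sub: "is_subring (?h ` ?P)"
    unfolding is_subring_def
  proof (intro conjI ballI)
    show "0 \<in> ?h ` ?P" using is_subringD(1)[OF P] by (rule rev_image_eqI) simp
    show "1 \<in> ?h ` ?P" using is_subringD(2)[OF P] by (rule rev_image_eqI) simp
    fix a assume "a \<in> ?h ` ?P"
    then obtain p where p: "p \<in> ?P" "a = poly p x" by blast
    show "- a \<in> ?h ` ?P" using is_subringD(5)[OF P p(1)] by (rule rev_image_eqI) (simp add: p)
    fix b assume "b \<in> ?h ` ?P"
    then obtain q where q: "q \<in> ?P" "b = poly q x" by blast
    show "a + b \<in> ?h ` ?P" using is_subringD(3)[OF P p(1) q(1)] by (rule rev_image_eqI) (simp add: p q)
    show "a * b \<in> ?h ` ?P" using is_subringD(4)[OF P p(1) q(1)] by (rule rev_image_eqI) (simp add: p q)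
  qed
  moreover have "\<exists>F0\<subseteq>F. finite F0 \<and> F \<subseteq> ideal_span (?h ` ?P) F0" if F: "F \<subseteq> ?h ` ?P" for F
  proof -
    obtain F0 where F0: "F0 \<subseteq> {p \<in> ?P. poly p x \<in> F}" "finite F0"
      "{p \<in> ?P. poly p x \<in> F} \<subseteq> ideal_span ?P F0"
      using noeth[of "{p \<in> ?P. poly p x \<in> F}"] by blast
    have "?h p \<in> ideal_span (?h ` ?P) (?h ` F0)" if "p \<in> ideal_span ?P F0" for p
      using that by (induction rule: ideal_span.induct) (auto intro: ideal_span.intros)
    then have "F \<subseteq> ideal_span (?h ` ?P) (?h ` F0)" using F F0(3) by blast
    then show ?thesis using F0(1,2) by (intro exI[of _ "?h ` F0"]) auto
  qed
  moreover have "A \<subseteq> ?h ` ?P"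
  proof
    fix a assume "a \<in> A"
    then have "[:a:] \<in> ?P"
      using A by (auto simp: polys_over_def coeff_pCons intro: is_subringD split: nat.splits)
    then show "a \<in> ?h ` ?P" by (rule rev_image_eqI) simp
  qed
  moreover have "x \<in> ?h ` ?P"
  proof -
    have "[:0, 1:] \<in> ?P"
      using A by (auto simp: polys_over_def coeff_pCons intro: is_subringD split: nat.splits)
    then show ?thesis by (rule rev_image_eqI) simp
  qed
  ultimately show ?thesis by (auto simp: noetherian_subring_def)
qed

lemma noetherian_subring_adjoin_finite:
  assumes "finite X" "noetherian_subring A"
  shows "\<exists>A'. noetherian_subring A' \<and> A \<subseteq> A' \<and> X \<subseteq> A'"
  using assms(1)
proof (induction X)
  case empty
  then show ?case using assms(2) by blast
next
  case (insert x X)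
  then obtain A' where "noetherian_subring A'" "A \<subseteq> A'" "X \<subseteq> A'" by blast
  with noetherian_subring_adjoin[OF this(1), of x] show ?case by blast
qed

text \<open>One nonzero constant generates all others. This is the base to which the coordinate
  functions on tuples of group elements will be adjoined.\<close>

lemma noetherian_subring_constants:
  "noetherian_subring (range (\<lambda>(c::'k::field) (_::'x). c))"
proof -
  let ?K = "range (\<lambda>(c::'k) (_::'x). c)"
  have K: "is_subring ?K"
    by (auto simp: is_subring_def zero_fun_def one_fun_def plus_fun_def times_fun_def fun_Compl_def)
  moreover have "\<exists>F0\<subseteq>F. finite F0 \<and> F \<subseteq> ideal_span ?K F0" if F: "F \<subseteq> ?K" for F
  proof (cases "F \<subseteq> {0}")
    case True
    then show ?thesis by (intro exI[of _ "{}"]) (auto intro: ideal_span.zero)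
  next
    case False
    then obtain y where y: "y \<in> F" "y \<noteq> 0" by blast
    then obtain c where c: "y = (\<lambda>_. c)" "c \<noteq> 0" using F by (auto simp: zero_fun_def)
    have "F \<subseteq> ideal_span ?K {y}"
    proof
      fix z assume "z \<in> F"
      then obtain d where d: "z = (\<lambda>_. d)" using F by blast
      have "(\<lambda>_. d / c) * y \<in> ideal_span ?K {y}"
        by (intro ideal_span_mult[OF K] ideal_span_superset[OF K]) auto
      moreover have "(\<lambda>_. d / c) * y = z" using c d by (simp add: times_fun_def)
      ultimately show "z \<in> ideal_span ?K {y}" by simp
    qed
    then show ?thesis using y by blast
  qed
  ultimately show ?thesis by (auto simp: noetherian_subring_def)
qed

section \<open>Linear groups are equationally noetherian\<close>

lemma word_monoid_induct [consumes 1, case_names one mult]: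
  assumes "X \<in> carrier (word_monoid A R)"
    and one: "P \<one>\<^bsub>word_monoid A R\<^esub>"
    and mult: "\<And>x Y. x \<in> A \<Longrightarrow> Y \<in> carrier (word_monoid A R) \<Longrightarrow> P Y \<Longrightarrow>
      P (word_class A R [x] \<otimes>\<^bsub>word_monoid A R\<^esub> Y)"
  shows "P X"
proof -
  have "P (word_class A R w)" if "w \<in> lists A" for w
    using that
  proof (induction w)
    case Nil
    then show ?case using one by (simp add: one_word_monoid)
  next
    case (Cons x w)
    then show ?case
      using mult[of x "word_class A R w"] mult_word_monoid[of "[x]" A w R]
      by (simp add: word_class_closed)
  qed
  then show ?thesis using assms(1) by (auto simp: carrier_word_monoid)
qed

text \<open>Inverses are listed for variables only, since the inverse of a constant is a constant.
  The property need not be closed under inversion, which for matrix entries would mean dividing by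
  determinants.\<close>

lemma equation_group_induct [consumes 2, case_names one const var var_inv mult]:
  assumes "group G" and w: "w \<in> carrier (equation_group G n)"
    and one: "P \<one>\<^bsub>equation_group G n\<^esub>"
    and const: "\<And>a. a \<in> carrier G \<Longrightarrow> P (equation_const G n a)"
    and var: "\<And>i. i < n \<Longrightarrow> P (equation_var G n i)"
    and var_inv: "\<And>i. i < n \<Longrightarrow> P (inv\<^bsub>equation_group G n\<^esub> equation_var G n i)"
    and mult: "\<And>x y. x \<in> carrier (equation_group G n) \<Longrightarrow> y \<in> carrier (equation_group G n) \<Longrightarrow>
      P x \<Longrightarrow> P y \<Longrightarrow> P (x \<otimes>\<^bsub>equation_group G n\<^esub> y)"
  shows "P w"
proof -
  let ?E = "equation_group G n" and ?F = "free_group {..<n}"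
  let ?inl = "free_product2_inl G ?F" and ?inr = "free_product2_inr G ?F"
  have hom: "?inr \<in> hom ?F ?E"
    unfolding equation_group_def by (rule free_product2_inr_hom[OF assms(1) group_free_group])
  interpret inr: group_hom ?F ?E ?inr
    using hom group_free_group group_equation_group[OF assms(1)]
    by (simp add: group_hom_def group_hom_axioms_def)
  have inl_closed: "?inl a \<in> carrier ?E" if "a \<in> carrier G" for a
    unfolding free_product2_inl_def equation_group_def free_product2_def
    by (rule word_class_closed) (use that in auto)
  have inr: "P (?inr b)" if "b \<in> carrier ?F" for b
    using that unfolding free_group_def
  proof (induction rule: word_monoid_induct)
    case one
    then show ?case using inr.hom_one assms(3) by (simp add: free_group_def)
  next
    case (mult x Y)
    obtain i c where x: "x = (i, c)" "i < n" using mult(1) by auto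
    let ?x = "word_class ({..<n} \<times> UNIV) (free_group_rels {..<n}) [x]"
    have xF: "?x \<in> carrier ?F" using x unfolding free_group_def by (intro word_class_closed) auto
    have "P (?inr ?x)"
    proof (cases c)
      case True
      then show ?thesis using var[of i] x by (simp add: equation_var_def free_group_gen_def)
    next
      case False
      then have "?x = inv\<^bsub>?F\<^esub> free_group_gen {..<n} i"
        using free_group_gen_inv[of i "{..<n}"] x by simp
      then show ?thesis
        using var_inv[of i] x free_group_gen_closed[of i "{..<n}"] by (simp add: equation_var_def)
    qed
    then show ?case
      using assms(7)[of "?inr ?x" "?inr Y"] inr.hom_closed[OF xF] inr.hom_closed[of Y]
        inr.hom_mult[OF xF, of Y] mult(2,3) by (simp add: free_group_def)
  qed
  have w': "w \<in> carrier (word_monoid (carrier G <+> carrier ?F) (free_product2_rels G ?F))"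
    using w by (simp add: equation_group_def free_product2_def)
  have "w \<in> carrier ?E \<and> P w"
    using w'
  proof (induction rule: word_monoid_induct)
    case one
    then show ?case using assms(3) inr.H.one_closed by (simp add: equation_group_def free_product2_def)
  next
    case (mult x Y)
    let ?x = "word_class (carrier G <+> carrier ?F) (free_product2_rels G ?F) [x]"
    have "?x \<in> carrier ?E \<and> P ?x"
    proof (cases x)
      case (Inl a)
      then have "a \<in> carrier G" using mult(1) by auto
      then show ?thesis
        using const[of a] inl_closed[of a] Inl by (simp add: equation_const_def free_product2_inl_def)
    next
      case (Inr b)
      then have "b \<in> carrier ?F" using mult(1) by auto
      then show ?thesis
        using inr[of b] inr.hom_closed[of b] Inr by (simp add: free_product2_inr_def)
    qed
    then show ?case
      using assms(7)[of ?x Y] mult(3) inr.H.m_closed[of ?x Y]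
      by (simp add: equation_group_def free_product2_def)
  qed
  then show ?thesis by simp
qed

lemma sum_fun_apply: "(\<Sum>i\<in>I. f i) x = (\<Sum>i\<in>I. f i x)"
  by (induction I rule: infinite_finite_induct) auto

lemma ideal_span_vanish:
  assumes "h \<in> ideal_span A F" "\<And>f. f \<in> F \<Longrightarrow> f x = 0"
  shows "h x = (0::'k::comm_ring_1)"
  using assms(1) by (induction rule: ideal_span.induct) (auto simp: assms(2))

text \<open>After substitution, the matrix entries of an equation are polynomial functions of the
  entries of the variables and of their inverses. They lie in one noetherian ring of functions,
  where finitely many of them generate all the others and therefore have the same common
  zeros.\<close>

lemma equationally_noetherian_if_linear_field:
  fixes Q :: "('q, 'm) monoid_scheme" and \<theta> :: "'q \<Rightarrow> 'i \<Rightarrow> 'i \<Rightarrow> 'k::field"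
  assumes "group Q" "finite I"
    and mult: "\<And>x y i j. x \<in> carrier Q \<Longrightarrow> y \<in> carrier Q \<Longrightarrow> i \<in> I \<Longrightarrow> j \<in> I \<Longrightarrow>
      \<theta> (x \<otimes>\<^bsub>Q\<^esub> y) i j = (\<Sum>l\<in>I. \<theta> x i l * \<theta> y l j)"
    and faithful: "\<And>x. x \<in> carrier Q \<Longrightarrow>
      (\<And>i j. i \<in> I \<Longrightarrow> j \<in> I \<Longrightarrow> \<theta> x i j = \<theta> \<one>\<^bsub>Q\<^esub> i j) \<Longrightarrow> x = \<one>\<^bsub>Q\<^esub>"
  shows "equationally_noetherian Q"
  unfolding equationally_noetherian_def
proof (intro allI impI)
  interpret Q: group Q by fact
  fix n S assume S: "S \<subseteq> carrier (equation_group Q n)"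
  let ?E = "equation_group Q n" and ?D = "{..<n} \<rightarrow>\<^sub>E carrier Q"
  interpret E: group ?E using assms(1) by (rule group_equation_group)
  define \<phi> where "\<phi> g = (SOME \<phi>. is_substitution Q n g \<phi>)" for g
  have \<phi>: "is_substitution Q n g (\<phi> g)" if "g \<in> ?D" for g
    unfolding \<phi>_def using ex_is_substitution[OF assms(1) that] by (rule someI_ex)
  have hom: "group_hom ?E Q (\<phi> g)" if "g \<in> ?D" for g
    using \<phi>[OF that] assms(1) E.is_group
    by (simp add: group_hom_def group_hom_axioms_def is_substitution_def)
  \<comment> \<open>The entries of the inverses are adjoined as further functions, so the ring is
    finitely generated over the constants without localising at a determinant.\<close>
  define X where "X = (\<lambda>(i, j, v) (g :: nat \<Rightarrow> 'q). \<theta> (g v) i j) ` (I \<times> I \<times> {..<n})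
    \<union> (\<lambda>(i, j, v) (g :: nat \<Rightarrow> 'q). \<theta> (inv\<^bsub>Q\<^esub> (g v)) i j) ` (I \<times> I \<times> {..<n})"
  have "finite X" unfolding X_def using assms(2) by simp
  from noetherian_subring_adjoin_finite[OF this noetherian_subring_constants]
  obtain A where noeth: "noetherian_subring A" and const: "range (\<lambda>(c::'k) (_::nat \<Rightarrow> 'q). c) \<subseteq> A"
    and X: "X \<subseteq> A" by blast
  have A: "is_subring A" using noeth by (simp add: noetherian_subring_def)
  \<comment> \<open>Elements of \<open>A\<close> are functions on all maps
    \<open>nat \<Rightarrow> 'q\<close>; agreement with the matrix entry makes sense only on tuples
    in \<open>?D\<close>.\<close>
  define good where "good s \<longleftrightarrow> (\<forall>i\<in>I. \<forall>j\<in>I. \<exists>a\<in>A. \<forall>g\<in>?D. a g = \<theta> (\<phi> g s) i j)" for s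
  have goodI: "good s" if "\<And>i j. i \<in> I \<Longrightarrow> j \<in> I \<Longrightarrow> a i j \<in> A"
    "\<And>i j g. i \<in> I \<Longrightarrow> j \<in> I \<Longrightarrow> g \<in> ?D \<Longrightarrow> a i j g = \<theta> (\<phi> g s) i j" for s a
    using that unfolding good_def by blast
  have good: "good s" if "s \<in> carrier ?E" for s
    using assms(1) that
  proof (induction rule: equation_group_induct)
    case one
    show ?case
      by (rule goodI[of "\<lambda>i j _. \<theta> \<one>\<^bsub>Q\<^esub> i j"])
        (use const in \<open>auto simp: group_hom.hom_one[OF hom]\<close>)
  next
    case (const a)
    then show ?case
      by (intro goodI[of "\<lambda>i j _. \<theta> a i j"])
        (use \<open>range _ \<subseteq> A\<close> \<phi> in \<open>auto simp: is_substitution_def\<close>)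
  next
    case (var v)
    have eq: "\<phi> g (equation_var Q n v) = g v" if "g \<in> ?D" for g
      using \<phi>[OF that] var by (simp add: is_substitution_def)
    show ?case
    proof (rule goodI[of "\<lambda>i j g. \<theta> (g v) i j"])
      show "(\<lambda>g. \<theta> (g v) i j) \<in> A" if "i \<in> I" "j \<in> I" for i j
        using X var that by (force simp: X_def)
    qed (simp add: eq)
  next
    case (var_inv v)
    have closed: "equation_var Q n v \<in> carrier ?E"
      using hom_in_carrier[OF free_product2_inr_hom[OF assms(1) group_free_group]
          free_group_gen_closed[of v "{..<n}"]] var_inv
      by (simp add: equation_var_def equation_group_def)
    have eq: "\<phi> g (inv\<^bsub>?E\<^esub> equation_var Q n v) = inv\<^bsub>Q\<^esub> (g v)" if "g \<in> ?D" for g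
      using \<phi>[OF that] var_inv group_hom.hom_inv[OF hom[OF that] closed]
      by (simp add: is_substitution_def)
    show ?case
    proof (rule goodI[of "\<lambda>i j g. \<theta> (inv\<^bsub>Q\<^esub> (g v)) i j"])
      show "(\<lambda>g. \<theta> (inv\<^bsub>Q\<^esub> (g v)) i j) \<in> A" if "i \<in> I" "j \<in> I" for i j
        using X var_inv that by (force simp: X_def)
    qed (simp add: eq)
  next
    case (mult x y)
    from mult(3) have "\<forall>i\<in>I. \<forall>j\<in>I. \<exists>a. a \<in> A \<and> (\<forall>g\<in>?D. a g = \<theta> (\<phi> g x) i j)"
      unfolding good_def by blast
    then obtain a where a: "\<And>i j. i \<in> I \<Longrightarrow> j \<in> I \<Longrightarrow> a i j \<in> A \<and> (\<forall>g\<in>?D. a i j g = \<theta> (\<phi> g x) i j)"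
      by (metis (no_types, lifting))
    from mult(4) have "\<forall>i\<in>I. \<forall>j\<in>I. \<exists>a. a \<in> A \<and> (\<forall>g\<in>?D. a g = \<theta> (\<phi> g y) i j)"
      unfolding good_def by blast
    then obtain b where b: "\<And>i j. i \<in> I \<Longrightarrow> j \<in> I \<Longrightarrow> b i j \<in> A \<and> (\<forall>g\<in>?D. b i j g = \<theta> (\<phi> g y) i j)"
      by (metis (no_types, lifting))
    show ?case
    proof (rule goodI[of "\<lambda>i j. \<Sum>l\<in>I. a i l * b l j"])
      show "(\<Sum>l\<in>I. a i l * b l j) \<in> A" if "i \<in> I" "j \<in> I" for i j
        using a b that by (intro is_subring_sum[OF A] is_subringD(4)[OF A]) auto
      fix i j g assume ij: "i \<in> I" "j \<in> I" and g: "g \<in> ?D"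
      interpret \<phi>: group_hom ?E Q "\<phi> g" using hom[OF g] .
      show "(\<Sum>l\<in>I. a i l * b l j) g = \<theta> (\<phi> g (x \<otimes>\<^bsub>?E\<^esub> y)) i j"
        using a b g ij mult(1,2) assms(3)[of "\<phi> g x" "\<phi> g y" i j] by (simp add: sum_fun_apply)
    qed
  qed
  \<comment> \<open>These differences vanish at every solution of \<open>s\<close>; conversely, if
    all of them vanish at a tuple, faithfulness shows that the tuple solves
    \<open>s\<close>.\<close>
  have "\<exists>a\<in>A. \<forall>g\<in>?D. a g = \<theta> (\<phi> g s) i j - \<theta> \<one>\<^bsub>Q\<^esub> i j" if "s \<in> S" "i \<in> I" "j \<in> I" for s i j
  proof -
    have "good s" using good that(1) S by blast
    then obtain a where a: "a \<in> A" "\<forall>g\<in>?D. a g = \<theta> (\<phi> g s) i j"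
      using \<open>i \<in> I\<close> \<open>j \<in> I\<close> unfolding good_def by blast
    have "(\<lambda>_. - \<theta> \<one>\<^bsub>Q\<^esub> i j) \<in> A" using const by blast
    then have "a + (\<lambda>_. - \<theta> \<one>\<^bsub>Q\<^esub> i j) \<in> A" using a(1) by (intro is_subringD(3)[OF A])
    then show ?thesis using a(2) by (intro bexI[of _ "a + (\<lambda>_. - \<theta> \<one>\<^bsub>Q\<^esub> i j)"]) auto
  qed
  then have "\<forall>z\<in>S \<times> I \<times> I. \<exists>a. a \<in> A \<and>
      (\<forall>g\<in>?D. a g = \<theta> (\<phi> g (fst z)) (fst (snd z)) (snd (snd z)) - \<theta> \<one>\<^bsub>Q\<^esub> (fst (snd z)) (snd (snd z)))"
    by force
  from bchoice[OF this] obtain a where a: "\<And>s i j. s \<in> S \<Longrightarrow> i \<in> I \<Longrightarrow> j \<in> I \<Longrightarrow> a (s, i, j) \<in> A"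
    "\<And>s i j g. s \<in> S \<Longrightarrow> i \<in> I \<Longrightarrow> j \<in> I \<Longrightarrow> g \<in> ?D \<Longrightarrow>
      a (s, i, j) g = \<theta> (\<phi> g s) i j - \<theta> \<one>\<^bsub>Q\<^esub> i j"
    by force
  let ?F = "a ` (S \<times> I \<times> I)"
  have "?F \<subseteq> A" using a(1) by auto
  then obtain F0 where F0: "F0 \<subseteq> ?F" "finite F0" "?F \<subseteq> ideal_span A F0"
    using noeth unfolding noetherian_subring_def by meson
  then obtain T where T: "T \<subseteq> S \<times> I \<times> I" "finite T" "F0 = a ` T"
    by (meson finite_subset_image)
  \<comment> \<open>The equations that contribute an entry to the finite generating set.\<close>
  let ?S0 = "fst ` T"
  have S0: "?S0 \<subseteq> S" "finite ?S0" using T by auto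
  have sol: "g \<in> solutions Q n S' \<longleftrightarrow> g \<in> ?D \<and> (\<forall>s\<in>S'. \<phi> g s = \<one>\<^bsub>Q\<^esub>)" if S': "S' \<subseteq> S" for g S'
  proof -
    have "\<psi> s = \<phi> g s" if "is_substitution Q n g \<psi>" "g \<in> ?D" "s \<in> S'" for \<psi> s
      using is_substitution_unique[OF assms(1) that(1) \<phi>[OF that(2)]] that S S' by blast
    then show ?thesis unfolding solutions_def using \<phi> by auto
  qed
  have S0_S: "\<phi> g s = \<one>\<^bsub>Q\<^esub>" if g: "g \<in> ?D" and z: "\<And>s. s \<in> ?S0 \<Longrightarrow> \<phi> g s = \<one>\<^bsub>Q\<^esub>" and s: "s \<in> S" for g s
  proof (rule faithful)
    interpret \<phi>: group_hom ?E Q "\<phi> g" using hom[OF g] .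
    show "\<phi> g s \<in> carrier Q" using s S by auto
    fix i j assume ij: "i \<in> I" "j \<in> I"
    have "a (s, i, j) \<in> ideal_span A F0" using F0(3) s ij by blast
    moreover have "f g = 0" if fF: "f \<in> F0" for f
    proof -
      obtain s' i' j' where f: "(s', i', j') \<in> T" "f = a (s', i', j')" using fF T(3) by auto
      then have "s' \<in> ?S0" by force
      then show ?thesis using a(2)[of s' i' j' g] f T(1) g z by auto
    qed
    ultimately have "a (s, i, j) g = 0" by (rule ideal_span_vanish)
    then show "\<theta> (\<phi> g s) i j = \<theta> \<one>\<^bsub>Q\<^esub> i j" using a(2)[OF s ij g] by simp
  qed
  have "solutions Q n S = solutions Q n ?S0"
  proof (rule Set.set_eqI)
    fix g
    have "(\<forall>s\<in>S. \<phi> g s = \<one>\<^bsub>Q\<^esub>) \<longleftrightarrow> (\<forall>s\<in>?S0. \<phi> g s = \<one>\<^bsub>Q\<^esub>)" if "g \<in> ?D"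
      using S0_S[OF that] S0(1) by blast
    then show "g \<in> solutions Q n S \<longleftrightarrow> g \<in> solutions Q n ?S0"
      unfolding sol[OF order.refl] sol[OF S0(1)] by blast
  qed
  with S0 show "\<exists>S0\<subseteq>S. finite S0 \<and> solutions Q n S = solutions Q n S0" by blast
qed

text \<open>The entries of all coefficients have to be constants at the same time, so the constants
  must form a noetherian ring. The fraction field provides one, and faithfulness is kept because a
  domain embeds into it.\<close>

lemma equationally_noetherian_if_linear:
  fixes Q :: "('q, 'm) monoid_scheme" and \<theta> :: "'q \<Rightarrow> 'i \<Rightarrow> 'i \<Rightarrow> 'k::idom"
  assumes "group Q" "finite I"
    and mult: "\<And>x y i j. x \<in> carrier Q \<Longrightarrow> y \<in> carrier Q \<Longrightarrow> i \<in> I \<Longrightarrow> j \<in> I \<Longrightarrow>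
      \<theta> (x \<otimes>\<^bsub>Q\<^esub> y) i j = (\<Sum>l\<in>I. \<theta> x i l * \<theta> y l j)"
    and faithful: "\<And>x. x \<in> carrier Q \<Longrightarrow>
      (\<And>i j. i \<in> I \<Longrightarrow> j \<in> I \<Longrightarrow> \<theta> x i j = \<theta> \<one>\<^bsub>Q\<^esub> i j) \<Longrightarrow> x = \<one>\<^bsub>Q\<^esub>"
  shows "equationally_noetherian Q"
proof (rule equationally_noetherian_if_linear_field[OF assms(1,2), of "\<lambda>x i j. Fract (\<theta> x i j) 1"])
  have add: "Fract (a + b) 1 = Fract a 1 + Fract b 1" for a b :: 'k
    by simp
  have sum: "Fract (sum f J) 1 = (\<Sum>j\<in>J. Fract (f j) 1)" for f :: "'i \<Rightarrow> 'k" and J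
    by (induction J rule: infinite_finite_induct)
      (auto simp: Fraction_Field.Zero_fract_def[symmetric] add simp del: add_fract)
  show "Fract (\<theta> (x \<otimes>\<^bsub>Q\<^esub> y) i j) 1 = (\<Sum>l\<in>I. Fract (\<theta> x i l) 1 * Fract (\<theta> y l j) 1)"
    if "x \<in> carrier Q" "y \<in> carrier Q" "i \<in> I" "j \<in> I" for x y i j
    using mult[OF that] by (simp add: sum Fraction_Field.mult_fract)
  show "x = \<one>\<^bsub>Q\<^esub>" if "x \<in> carrier Q"
    "\<And>i j. i \<in> I \<Longrightarrow> j \<in> I \<Longrightarrow> Fract (\<theta> x i j) 1 = Fract (\<theta> \<one>\<^bsub>Q\<^esub> i j) 1" for x
    using faithful[OF that(1)] that(2) by (simp add: Fraction_Field.eq_fract)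
qed

section \<open>Words for the elements of a graph product\<close>

abbreviation letters :: "'v set \<Rightarrow> ('v \<Rightarrow> ('a, 'm) monoid_scheme) \<Rightarrow> ('v \<times> 'a) set"
  where "letters V G \<equiv> SIGMA v:V. carrier (G v)"

text \<open>The graph product presented in one step on letters. Commutators are replaced by swaps of
  two letters, so no inverses appear in the relations.\<close>

definition graph_word_rels ::
    "'v set \<Rightarrow> 'v set set \<Rightarrow> ('v \<Rightarrow> ('a, 'm) monoid_scheme) \<Rightarrow> (('v \<times> 'a) list \<times> ('v \<times> 'a) list) set"
  where "graph_word_rels V E G = free_product_rels V G \<union>
    {([(v, a), (u, b)], [(u, b), (v, a)]) | v u a b.
      {v, u} \<in> E \<and> a \<in> carrier (G v) \<and> b \<in> carrier (G u)}"

lemma word_cong_mono: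
  assumes "R \<subseteq> R'" "(u, w) \<in> word_cong A R"
  shows "(u, w) \<in> word_cong A R'"
  using assms(2)
proof (induction rule: word_cong.induct)
  case (rel l r u w)
  then show ?case using assms(1) by (intro word_cong.rel) auto
qed (auto intro: word_cong.intros)

lemma group_word_cong_mono:
  assumes "group (word_monoid A R)" "R \<subseteq> R'"
  shows "group (word_monoid A R')"
proof (rule group_word_monoid)
  interpret group "word_monoid A R" by fact
  fix y assume y: "y \<in> A"
  then have cy: "word_class A R [y] \<in> carrier (word_monoid A R)" by (intro word_class_closed) simp
  then have "inv\<^bsub>word_monoid A R\<^esub> (word_class A R [y]) \<in> carrier (word_monoid A R)" by (rule inv_closed)
  then obtain w where w: "w \<in> lists A" "inv\<^bsub>word_monoid A R\<^esub> (word_class A R [y]) = word_class A R w"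
    unfolding carrier_word_monoid by blast
  have "word_class A R (w @ [y]) = word_class A R []"
    using l_inv[OF cy] w y mult_word_monoid[of w A "[y]" R] by (simp add: one_word_monoid)
  then have "(w @ [y], []) \<in> word_cong A R"
    using w y by (subst (asm) word_class_eq_iff) auto
  then show "\<exists>w\<in>lists A. (w @ [y], []) \<in> word_cong A R'"
    using w(1) word_cong_mono[OF assms(2)] by blast
qed

text \<open>Swapped words have the same coset because the commutators lie in the normal closure.
  Conversely, the homomorphism from the free product to words modulo all relations kills the
  commutators, hence their normal closure, so words with equal cosets are congruent.\<close>

lemma graph_product_words:
  fixes G :: "'v \<Rightarrow> ('a, 'm) monoid_scheme"
  assumes graph: "finite_simplicial_graph V E" and G: "\<And>v. v \<in> V \<Longrightarrow> group (G v)"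
  defines "A \<equiv> letters V G" and "R \<equiv> graph_word_rels V E G" and "Q \<equiv> graph_product V E G"
  shows "\<exists>\<pi>. carrier Q = \<pi> ` lists A \<and> \<pi> [] = \<one>\<^bsub>Q\<^esub> \<and>
    (\<forall>u\<in>lists A. \<forall>w\<in>lists A. \<pi> (u @ w) = \<pi> u \<otimes>\<^bsub>Q\<^esub> \<pi> w) \<and>
    (\<forall>u\<in>lists A. \<forall>w\<in>lists A. \<pi> u = \<pi> w \<longleftrightarrow> (u, w) \<in> word_cong A R)"
proof -
  let ?F = "free_product V G" and ?R0 = "free_product_rels V G"
  let ?c = "word_class A ?R0" and ?C = "graph_product_rels V E G"
  let ?W = "word_monoid A R"
  have F_eq: "?F = word_monoid A ?R0" by (simp add: free_product_def A_def)
  interpret F: group ?F using G by (rule group_free_product)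
  interpret W: group ?W
    by (rule group_word_cong_mono[of A ?R0]) (use F.is_group in \<open>auto simp: F_eq R_def graph_word_rels_def\<close>)
  have c_closed: "?c w \<in> carrier ?F" if "w \<in> lists A" for w
    unfolding F_eq using that by (rule word_class_closed)
  have c_mult: "?c u \<otimes>\<^bsub>?F\<^esub> ?c w = ?c (u @ w)" if "u \<in> lists A" "w \<in> lists A" for u w
    unfolding F_eq using that by (rule mult_word_monoid)
  have edge: "v \<in> V \<and> u \<in> V" if "{v, u} \<in> E" for v u
    using graph that by (auto simp: finite_simplicial_graph_def)
  have C_eq: "?C = {commutator ?F (?c [(v, a)]) (?c [(u, b)]) | v u a b.
      {v, u} \<in> E \<and> a \<in> carrier (G v) \<and> b \<in> carrier (G u)}"
    by (simp add: graph_product_rels_def free_product_inj_def A_def)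
  have C: "?C \<subseteq> carrier ?F"
  proof
    fix x assume "x \<in> ?C"
    then obtain v u a b where x: "x = commutator ?F (?c [(v, a)]) (?c [(u, b)])"
      "{v, u} \<in> E" "a \<in> carrier (G v)" "b \<in> carrier (G u)" unfolding C_eq by blast
    then have "(v, a) \<in> A" "(u, b) \<in> A" using edge by (auto simp: A_def)
    then have "?c [(v, a)] \<in> carrier ?F" "?c [(u, b)] \<in> carrier ?F" by (auto intro!: c_closed)
    then show "x \<in> carrier ?F" unfolding x commutator_def by (intro F.m_closed F.inv_closed)
  qed
  define N where "N = normal_closure ?F ?C"
  interpret N: normal N ?F
    unfolding N_def using F.is_group C by (rule normal_normal_closure)
  have Q_eq: "Q = ?F Mod N" by (simp add: Q_def graph_product_def N_def)
  have C_N: "x \<in> N" if "x \<in> ?C" for x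
  proof -
    have "\<one>\<^bsub>?F\<^esub> \<otimes>\<^bsub>?F\<^esub> x \<otimes>\<^bsub>?F\<^esub> inv\<^bsub>?F\<^esub> \<one>\<^bsub>?F\<^esub> \<in> N"
      unfolding N_def normal_closure_def using that F.one_closed by (intro generate.incl) blast
    then show ?thesis using that C by auto
  qed
  define \<pi> where "\<pi> w = N #>\<^bsub>?F\<^esub> ?c w" for w
  have carrier: "carrier Q = \<pi> ` lists A"
    by (auto simp: Q_eq FactGroup_def RCOSETS_def \<pi>_def F_eq carrier_word_monoid)
  have one: "\<pi> [] = \<one>\<^bsub>Q\<^esub>"
    using F.coset_mult_one[OF N.subset] by (simp add: Q_eq FactGroup_def \<pi>_def F_eq one_word_monoid)
  have mult: "\<pi> (u @ w) = \<pi> u \<otimes>\<^bsub>Q\<^esub> \<pi> w" if "u \<in> lists A" "w \<in> lists A" for u w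
    using that by (simp add: Q_eq FactGroup_def \<pi>_def N.rcos_sum c_closed c_mult)
  have comm: "\<pi> [x, y] = \<pi> [y, x]"
    if C': "commutator ?F (?c [x]) (?c [y]) \<in> ?C" and xy: "x \<in> A" "y \<in> A" for x y
  proof -
    have X: "?c [x] \<in> carrier ?F" "?c [y] \<in> carrier ?F" using xy by (auto intro: c_closed)
    let ?z = "commutator ?F (?c [x]) (?c [y])"
    have z: "?z \<in> N" "?z \<in> carrier ?F" using C_N[OF C'] N.subset by auto
    \<comment> \<open>The identity [x, y] y x = x y puts x y and y x into the same coset of
      \<open>N\<close>.\<close>
    have "?z \<otimes>\<^bsub>?F\<^esub> (?c [y] \<otimes>\<^bsub>?F\<^esub> ?c [x]) = ?c [x] \<otimes>\<^bsub>?F\<^esub> ?c [y]"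
      using X by (simp add: commutator_def F.m_assoc F.inv_solve_left' flip: F.m_assoc)
        (simp add: F.m_assoc)
    then have "N #>\<^bsub>?F\<^esub> (?c [x] \<otimes>\<^bsub>?F\<^esub> ?c [y]) = N #>\<^bsub>?F\<^esub> ?z #>\<^bsub>?F\<^esub> (?c [y] \<otimes>\<^bsub>?F\<^esub> ?c [x])"
      using X z N.subset by (simp add: F.coset_mult_assoc)
    also have "N #>\<^bsub>?F\<^esub> ?z = N" using z N.subgroup_axioms by (intro F.coset_join2)
    finally show ?thesis using xy by (simp add: \<pi>_def c_mult)
  qed
  have imp1: "\<pi> u = \<pi> w" if "(u, w) \<in> word_cong A R" for u w
    using that
  proof (induction rule: word_cong.induct)
    case (rel l r u w)
    have "\<pi> l = \<pi> r"
    proof (cases "(l, r) \<in> ?R0")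
      case True
      then show ?thesis using rel word_class_rel[of l r ?R0 A] by (simp add: \<pi>_def)
    next
      case False
      then obtain v v' a b where lr: "l = [(v, a), (v', b)]" "r = [(v', b), (v, a)]" "{v, v'} \<in> E"
        "a \<in> carrier (G v)" "b \<in> carrier (G v')"
        using rel(1) by (auto simp: R_def graph_word_rels_def)
      show ?thesis
        unfolding lr
      proof (rule comm)
        show "commutator ?F (?c [(v, a)]) (?c [(v', b)]) \<in> ?C" unfolding C_eq using lr by blast
      qed (use lr edge in \<open>auto simp: A_def\<close>)
    qed
    then show ?case using rel by (simp add: mult)
  qed auto
  have "\<exists>\<psi> \<in> hom (word_monoid A ?R0) ?W. \<forall>x\<in>A. \<psi> (?c [x]) = word_class A R [x]"
  proof (rule W.word_monoid_lift)
    show "(\<lambda>x. word_class A R [x]) ` A \<subseteq> carrier ?W" by (auto intro: word_class_closed)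
    have ev: "word_eval ?W (\<lambda>x. word_class A R [x]) w = word_class A R w" if "w \<in> lists A" for w
      using that by (induction w) (auto simp: one_word_monoid mult_word_monoid)
    show "word_eval ?W (\<lambda>x. word_class A R [x]) l = word_eval ?W (\<lambda>x. word_class A R [x]) r"
      if "(l, r) \<in> ?R0" "l \<in> lists A" "r \<in> lists A" for l r
      using that by (simp add: ev) (rule word_class_rel; auto simp: R_def graph_word_rels_def)
  qed
  then obtain \<psi> where \<psi>: "\<psi> \<in> hom ?F ?W" and \<psi>1: "\<And>x. x \<in> A \<Longrightarrow> \<psi> (?c [x]) = word_class A R [x]"
    by (auto simp: F_eq)
  interpret \<psi>: group_hom ?F ?W \<psi>
    using \<psi> F.is_group W.is_group by (simp add: group_hom_def group_hom_axioms_def)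
  have \<psi>c: "\<psi> (?c w) = word_class A R w" if "w \<in> lists A" for w
    using that
  proof (induction w)
    case Nil
    then show ?case using \<psi>.hom_one by (simp add: F_eq one_word_monoid)
  next
    case (Cons x w)
    then have "\<psi> (?c ([x] @ w)) = word_class A R ([x] @ w)"
      using \<psi>.hom_mult[of "?c [x]" "?c w"] c_mult[of "[x]" w] mult_word_monoid[of "[x]" A w R]
      by (simp add: \<psi>1 c_closed del: append.simps)
    then show ?case by simp
  qed
  have ker: "x \<in> kernel ?F ?W \<psi>" if "x \<in> ?C" for x
  proof -
    from that obtain v u a b where x: "x = commutator ?F (?c [(v, a)]) (?c [(u, b)])"
      "{v, u} \<in> E" "a \<in> carrier (G v)" "b \<in> carrier (G u)" unfolding C_eq by blast
    then have A: "(v, a) \<in> A" "(u, b) \<in> A" using edge by (auto simp: A_def)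
    then have cl: "?c [(v, a)] \<in> carrier ?F" "?c [(u, b)] \<in> carrier ?F" by (auto intro: c_closed)
    have "word_class A R [(v, a), (u, b)] = word_class A R [(u, b), (v, a)]"
      by (rule word_class_rel) (use x A in \<open>auto simp: R_def graph_word_rels_def\<close>)
    then have eq: "\<psi> (?c [(v, a)]) \<otimes>\<^bsub>?W\<^esub> \<psi> (?c [(u, b)]) = \<psi> (?c [(u, b)]) \<otimes>\<^bsub>?W\<^esub> \<psi> (?c [(v, a)])"
      using A by (simp add: \<psi>1 mult_word_monoid)
    have "\<psi> x = \<psi> (?c [(v, a)]) \<otimes>\<^bsub>?W\<^esub> \<psi> (?c [(u, b)]) \<otimes>\<^bsub>?W\<^esub> inv\<^bsub>?W\<^esub> \<psi> (?c [(v, a)])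
        \<otimes>\<^bsub>?W\<^esub> inv\<^bsub>?W\<^esub> \<psi> (?c [(u, b)])"
      using cl by (simp add: x commutator_def)
    also have "\<dots> = \<one>\<^bsub>?W\<^esub>" using cl unfolding eq by (simp add: W.m_assoc)
    finally show ?thesis using that C by (auto simp: kernel_def)
  qed
  have N_ker: "N \<subseteq> kernel ?F ?W \<psi>"
    unfolding N_def normal_closure_def
  proof (rule F.generate_subgroup_incl)
    show "{g \<otimes>\<^bsub>?F\<^esub> s \<otimes>\<^bsub>?F\<^esub> inv\<^bsub>?F\<^esub> g | g s. g \<in> carrier ?F \<and> s \<in> ?C} \<subseteq> kernel ?F ?W \<psi>"
      using normal.inv_op_closed2[OF \<psi>.normal_kernel] ker by blast
    show "subgroup (kernel ?F ?W \<psi>) ?F" by (rule \<psi>.subgroup_kernel)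
  qed
  have imp2: "(u, w) \<in> word_cong A R" if uw: "u \<in> lists A" "w \<in> lists A" and eq: "\<pi> u = \<pi> w" for u w
  proof -
    have "?c u \<in> N #>\<^bsub>?F\<^esub> ?c w"
      using F.rcos_self[OF c_closed[OF uw(1)] N.subgroup_axioms] eq by (simp add: \<pi>_def)
    then obtain n where n: "n \<in> N" "?c u = n \<otimes>\<^bsub>?F\<^esub> ?c w" by (auto simp: r_coset_def)
    then have "\<psi> (?c u) = \<psi> (?c w)"
      using N_ker c_closed[OF uw(2)] by (auto simp: kernel_def)
    then show ?thesis using uw by (simp add: \<psi>c word_class_eq_iff)
  qed
  show ?thesis
  proof (intro exI[of _ \<pi>] conjI ballI)
    show "carrier Q = \<pi> ` lists A" by (rule carrier)
    show "\<pi> [] = \<one>\<^bsub>Q\<^esub>" by (rule one)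
    fix u w assume uw: "u \<in> lists A" "w \<in> lists A"
    show "\<pi> (u @ w) = \<pi> u \<otimes>\<^bsub>Q\<^esub> \<pi> w" using uw by (rule mult)
    show "\<pi> u = \<pi> w \<longleftrightarrow> (u, w) \<in> word_cong A R"
      using imp1[of u w] imp2[OF uw] by argo
  qed
qed

section \<open>Congruence of words and alternating words with respect to a vertex\<close>

locale graph_of_groups =
  fixes V :: "'v set" and E :: "'v set set" and G :: "'v \<Rightarrow> ('a, 'm) monoid_scheme"
  assumes graph: "finite_simplicial_graph V E"
    and group_G: "\<And>v. v \<in> V \<Longrightarrow> group (G v)"
begin

abbreviation cong_words :: "('v \<times> 'a) list \<Rightarrow> ('v \<times> 'a) list \<Rightarrow> bool"  (infix "\<simeq>" 50)
  where "u \<simeq> w \<equiv> (u, w) \<in> word_cong (letters V G) (graph_word_rels V E G)"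

abbreviation words :: "'v set \<Rightarrow> ('v \<times> 'a) list set"
  where "words U \<equiv> lists (letters U G)"

definition link :: "'v \<Rightarrow> 'v set"
  where "link v = {u. {u, v} \<in> E}"

lemma words_mono: "w \<in> words U \<Longrightarrow> U \<subseteq> U' \<Longrightarrow> w \<in> words U'"
  by (meson Sigma_mono lists_mono order.refl subsetD)

lemma cong_append: "u \<simeq> u' \<Longrightarrow> w \<simeq> w' \<Longrightarrow> u @ w \<simeq> u' @ w'"
  by (rule word_cong_append)

lemma cong_Cons: "x \<in> letters V G \<Longrightarrow> w \<simeq> w' \<Longrightarrow> x # w \<simeq> x # w'"
  using cong_append[of "[x]" "[x]" w w'] by (simp add: word_cong.refl)

lemma cong_one:
  assumes "v \<in> V" "w \<in> words V"
  shows "(v, \<one>\<^bsub>G v\<^esub>) # w \<simeq> w"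
proof -
  interpret group "G v" using group_G assms by blast
  show ?thesis
    using word_cong.rel[of "[(v, \<one>\<^bsub>G v\<^esub>)]" "[]" "graph_word_rels V E G" "letters V G" "[]" w] assms
    by (auto simp: graph_word_rels_def free_product_rels_def)
qed

lemma cong_merge:
  assumes "v \<in> V" "w \<in> words V" "a \<in> carrier (G v)" "b \<in> carrier (G v)"
  shows "(v, a) # (v, b) # w \<simeq> (v, a \<otimes>\<^bsub>G v\<^esub> b) # w"
proof -
  interpret group "G v" using group_G assms by blast
  show ?thesis
    using word_cong.rel[of "[(v, a), (v, b)]" "[(v, a \<otimes>\<^bsub>G v\<^esub> b)]" "graph_word_rels V E G"
        "letters V G" "[]" w] assms
    by (auto simp: graph_word_rels_def free_product_rels_def)
qed

lemma cong_swap: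
  assumes "{v, u} \<in> E" "w \<in> words V" "a \<in> carrier (G v)" "b \<in> carrier (G u)"
  shows "(v, a) # (u, b) # w \<simeq> (u, b) # (v, a) # w"
proof -
  have "v \<in> V" "u \<in> V" using graph assms(1) by (auto simp: finite_simplicial_graph_def)
  moreover have "([(v, a), (u, b)], [(u, b), (v, a)]) \<in> graph_word_rels V E G"
    unfolding graph_word_rels_def using assms by blast
  ultimately show ?thesis
    using word_cong.rel[of "[(v, a), (u, b)]" "[(u, b), (v, a)]" "graph_word_rels V E G"
        "letters V G" "[]" w] assms by auto
qed

lemma link_subset: "link v \<subseteq> V"
  using graph by (auto simp: link_def finite_simplicial_graph_def)

lemma cong_swap_link:
  assumes "v \<in> V" "c \<in> words (link v)" "w \<in> words V" "a \<in> carrier (G v)"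
  shows "(v, a) # c @ w \<simeq> c @ (v, a) # w"
  using assms(2)
proof (induction c)
  case Nil
  have "(v, a) # w \<in> words V" using assms by simp
  then show ?case by (simp add: word_cong.refl)
next
  case (Cons x c)
  obtain u b where xu: "x = (u, b)" "u \<in> link v" "b \<in> carrier (G u)"
    using Cons(1) by (cases x) auto
  then have x: "x = (u, b)" "{v, u} \<in> E" "b \<in> carrier (G u)" "u \<in> V"
    using subsetD[OF link_subset xu(2)] by (auto simp: link_def insert_commute)
  have c: "c \<in> words V" using Cons(2) link_subset by (rule words_mono)
  have "(v, a) # x # c @ w \<simeq> x # (v, a) # c @ w"
    using cong_swap[of v u "c @ w" a b] x c assms by auto
  moreover have "x # (v, a) # c @ w \<simeq> x # c @ (v, a) # w"
    using Cons.IH x by (intro cong_Cons) auto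
  ultimately show ?case by (auto intro: word_cong.trans)
qed

text \<open>Inner blocks have to lie outside the subgroup of the link, whereas the last block is
  unrestricted: it will be applied to a vector that all of \<open>U\<close> fixes.\<close>

inductive_set alternating :: "'v set \<Rightarrow> 'v \<Rightarrow> ('v \<times> 'a) list set"
  for U :: "'v set" and v :: 'v
where
  base: "b \<in> carrier (G v) \<Longrightarrow> b \<noteq> \<one>\<^bsub>G v\<^esub> \<Longrightarrow> h \<in> words U \<Longrightarrow> (v, b) # h \<in> alternating U v"
| step: "b \<in> carrier (G v) \<Longrightarrow> b \<noteq> \<one>\<^bsub>G v\<^esub> \<Longrightarrow> h \<in> words U \<Longrightarrow>
    \<not> (\<exists>c\<in>words (link v \<inter> U). h \<simeq> c) \<Longrightarrow> y \<in> alternating U v \<Longrightarrow> (v, b) # h @ y \<in> alternating U v"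

lemma alternating_words:
  assumes "y \<in> alternating U v" "U \<subseteq> V" "v \<in> V"
  shows "y \<in> words V"
  using assms(1)
  by (induction rule: alternating.induct) (use assms words_mono[of _ U V] in auto)

text \<open>The syllables from \<open>G v\<close> cut a word into blocks; a block lying in the subgroup of the link
  of \<open>v\<close> is moved to the left, and its neighbouring syllables merge.\<close>

lemma words_insert_cases:
  assumes v: "v \<in> V" and U: "U \<subseteq> V" and w: "w \<in> words (insert v U)"
  shows "(\<exists>h\<in>words U. w \<simeq> h) \<or> (\<exists>h\<in>words U. \<exists>y\<in>alternating U v. w \<simeq> h @ y)"
  using w
proof (induction w)
  case Nil
  then show ?case by (auto intro!: bexI[of _ "[]"] word_cong.refl)
next
  case (Cons x w)
  interpret Gv: group "G v" using group_G v by blast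
  obtain u a where x: "x = (u, a)" "u \<in> insert v U" "a \<in> carrier (G u)" using Cons(1) by (cases x) auto
  have xV: "x \<in> letters V G" using x v U by auto
  note UV = words_mono[OF _ U]
  note alt = alternating_words[OF _ U v]
  have link: "c \<in> words V" "c \<in> words (link v)" "c \<in> words U" if "c \<in> words (link v \<inter> U)" for c
    using words_mono[OF that] link_subset by auto
  show ?case
  proof (cases "u = v")
    case False
    then have xU: "x \<in> letters U G" using x by auto
    from Cons.IH show ?thesis
    proof (elim disjE bexE)
      fix h assume "h \<in> words U" "w \<simeq> h"
      then show ?thesis using cong_Cons[OF xV, of w h] xU by (intro disjI1 bexI[of _ "x # h"]) auto
    next
      fix h y assume "h \<in> words U" "y \<in> alternating U v" "w \<simeq> h @ y"
      then show ?thesis using cong_Cons[OF xV, of w "h @ y"] xU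
        by (intro disjI2 bexI[of _ "x # h"] bexI[of _ y]) auto
    qed
  next
    case True
    note x = x[unfolded True]
    show ?thesis
    proof (cases "a = \<one>\<^bsub>G v\<^esub>")
      case True
      have "w \<in> words V" using Cons(2) U v words_mono[of w "insert v U" V] by auto
      then have "x # w \<simeq> w" using cong_one[OF v, of w] x True by simp
      then show ?thesis using Cons.IH by (blast intro: word_cong.trans)
    next
      case a: False
      from Cons.IH show ?thesis
      proof (elim disjE bexE)
        fix h assume h: "h \<in> words U" "w \<simeq> h"
        then have "x # h \<in> alternating U v" unfolding x(1) using a x by (intro alternating.base) auto
        moreover have "x # w \<simeq> [] @ x # h" using cong_Cons[OF xV h(2)] by simp
        ultimately show ?thesis by blast
      next
        fix h y assume h: "h \<in> words U" and y: "y \<in> alternating U v" and w: "w \<simeq> h @ y"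
        show ?thesis
        proof (cases "\<exists>c\<in>words (link v \<inter> U). h \<simeq> c")
          case False
          then have "x # h @ y \<in> alternating U v"
            unfolding x(1) using a x h y by (intro alternating.step) auto
          moreover have "x # w \<simeq> [] @ x # h @ y" using cong_Cons[OF xV w] by simp
          ultimately show ?thesis by blast
        next
          case True
          then obtain c where c: "c \<in> words (link v \<inter> U)" "h \<simeq> c" by blast
          have yV: "y \<in> words V" using alt[OF y] .
          have "w \<simeq> c @ y"
            using w cong_append[OF c(2), of y y] yV by (auto intro: word_cong.refl word_cong.trans)
          then have "x # w \<simeq> x # c @ y" by (rule cong_Cons[OF xV])
          moreover have "x # c @ y \<simeq> c @ x # y"
            unfolding x(1) using cong_swap_link[OF v link(2)[OF c(1)] yV] x by blast
          ultimately have xw: "x # w \<simeq> c @ x # y" by (rule word_cong.trans)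
          have merge: "x # w \<simeq> c @ (v, a \<otimes>\<^bsub>G v\<^esub> b) # z" if "y = (v, b) # z" "b \<in> carrier (G v)" for b z
          proof -
            have "x # y \<simeq> (v, a \<otimes>\<^bsub>G v\<^esub> b) # z"
              unfolding that(1) x(1) using that yV by (intro cong_merge v x(3)) auto
            then have "c @ x # y \<simeq> c @ (v, a \<otimes>\<^bsub>G v\<^esub> b) # z"
              using link(1)[OF c(1)] by (intro cong_append word_cong.refl)
            then show ?thesis using xw by (blast intro: word_cong.trans)
          qed
          have cancel: "x # w \<simeq> c @ z" if "y = (v, b) # z" "b \<in> carrier (G v)" "a \<otimes>\<^bsub>G v\<^esub> b = \<one>\<^bsub>G v\<^esub>" for b z
          proof -
            have "(v, a \<otimes>\<^bsub>G v\<^esub> b) # z \<simeq> z"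
              unfolding that(3) using that yV by (intro cong_one v) auto
            then have "c @ (v, a \<otimes>\<^bsub>G v\<^esub> b) # z \<simeq> c @ z"
              using link(1)[OF c(1)] by (intro cong_append word_cong.refl)
            then show ?thesis using merge[OF that(1,2)] by (blast intro: word_cong.trans)
          qed
          from y show ?thesis
          proof (cases rule: alternating.cases)
            case (base b h')
            show ?thesis
            proof (cases "a \<otimes>\<^bsub>G v\<^esub> b = \<one>\<^bsub>G v\<^esub>")
              case True
              then show ?thesis using cancel[of b h'] base link(3)[OF c(1)]
                by (intro disjI1 bexI[of _ "c @ h'"]) auto
            next
              case False
              then have "(v, a \<otimes>\<^bsub>G v\<^esub> b) # h' \<in> alternating U v"
                using base x by (intro alternating.base) auto
              then show ?thesis using merge[of b h'] base link(3)[OF c(1)] by blast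
            qed
          next
            case (step b h' y')
            show ?thesis
            proof (cases "a \<otimes>\<^bsub>G v\<^esub> b = \<one>\<^bsub>G v\<^esub>")
              case True
              \<comment> \<open>The two blocks fuse into a new block in front of the alternating
                word \<open>y'\<close>. No condition is imposed on a block in that position, so the
                cancellation does not propagate.\<close>
              then have "x # w \<simeq> (c @ h') @ y'" using cancel[of b "h' @ y'"] step by simp
              moreover have "c @ h' \<in> words U" using step link(3)[OF c(1)] by auto
              ultimately show ?thesis using step by blast
            next
              case False
              then have "(v, a \<otimes>\<^bsub>G v\<^esub> b) # h' @ y' \<in> alternating U v"
                using step x by (intro alternating.step) auto
              then show ?thesis using merge[of b "h' @ y'"] step link(3)[OF c(1)] by blast
            qed
          qed
        qed
      qed
    qed
  qed
qed

end

section \<open>A polynomial ring in countably many variables\<close>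

type_synonym 'r mvpoly = "(nat \<Rightarrow>\<^sub>0 nat) \<Rightarrow>\<^sub>0 'r"

definition vars_below :: "nat \<Rightarrow> 'r::idom mvpoly set"
  where "vars_below k = {p. \<forall>m\<in>Poly_Mapping.keys p. \<forall>i\<ge>k. Poly_Mapping.lookup m i = 0}"

definition pvar :: "nat \<Rightarrow> 'r::idom mvpoly"
  where "pvar k = Poly_Mapping.single (Poly_Mapping.single k 1) 1"

lemma vars_below_mono: "p \<in> vars_below k \<Longrightarrow> k \<le> l \<Longrightarrow> p \<in> vars_below l"
  by (auto simp: vars_below_def)

lemma vars_below_0 [simp, intro]: "0 \<in> vars_below k"
  by (simp add: vars_below_def)

lemma vars_below_single_0 [simp, intro]: "Poly_Mapping.single 0 c \<in> vars_below k"
  by (simp add: vars_below_def)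

lemma vars_below_1 [simp, intro]: "1 \<in> vars_below k"
  by (simp add: vars_below_def)

lemma vars_below_add [intro]: "p \<in> vars_below k \<Longrightarrow> q \<in> vars_below k \<Longrightarrow> p + q \<in> vars_below k"
  unfolding vars_below_def using keys_add[of p q] by blast

lemma vars_below_uminus [intro]: "p \<in> vars_below k \<Longrightarrow> - p \<in> vars_below k"
  by (simp add: vars_below_def in_keys_iff)

lemma vars_below_diff [intro]: "p \<in> vars_below k \<Longrightarrow> q \<in> vars_below k \<Longrightarrow> p - q \<in> vars_below k"
  using vars_below_add[of p k "- q"] by auto

lemma vars_below_mult [intro]: "p \<in> vars_below k \<Longrightarrow> q \<in> vars_below k \<Longrightarrow> p * q \<in> vars_below k"
  unfolding vars_below_def using keys_mult[of p q] by (fastforce simp: lookup_add)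

lemma vars_below_sum: "(\<And>i. i \<in> X \<Longrightarrow> f i \<in> vars_below k) \<Longrightarrow> sum f X \<in> vars_below k"
  by (induction X rule: infinite_finite_induct) auto

lemma vars_below_power [intro]: "p \<in> vars_below k \<Longrightarrow> p ^ n \<in> vars_below k"
  by (induction n) auto

lemma pvar_in_vars_below: "k < l \<Longrightarrow> pvar k \<in> vars_below l"
  by (auto simp: vars_below_def pvar_def lookup_single)

lemma pvar_power: "pvar k ^ d = Poly_Mapping.single (Poly_Mapping.single k d) 1"
  by (induction d) (auto simp: pvar_def mult_single simp flip: single_add)

lemma pvar_nonzero [simp]: "pvar k \<noteq> 0"
  by (metis lookup_single_eq lookup_zero pvar_def zero_neq_one)

lemma lookup_monomial_mult:
  fixes q :: "'r::idom mvpoly"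
  shows "Poly_Mapping.lookup (Poly_Mapping.single a 1 * q) (a + m) = Poly_Mapping.lookup q m"
  by (simp add: lookup_mult lookup_single when_mult)

text \<open>In every monomial of \<open>pvar k ^ d * c d\<close> the variable \<open>k\<close> has
  exponent exactly \<open>d\<close>, so summands with different \<open>d\<close> have no monomial in
  common.\<close>

lemma pvar_transcendental:
  fixes c :: "nat \<Rightarrow> 'r::idom mvpoly"
  assumes "finite D" "\<And>d. d \<in> D \<Longrightarrow> c d \<in> vars_below k"
    and zero: "(\<Sum>d\<in>D. pvar k ^ d * c d) = 0" and d: "d \<in> D"
  shows "c d = 0"
proof (rule poly_mapping_eqI)
  fix m
  show "Poly_Mapping.lookup (c d) m = Poly_Mapping.lookup 0 m"
  proof (cases "Poly_Mapping.lookup m k = 0")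
    case False
    then have "m \<notin> Poly_Mapping.keys (c d)" using assms(2)[OF d] by (auto simp: vars_below_def)
    then show ?thesis by (simp add: in_keys_iff)
  next
    case True
    \<comment> \<open>The monomial at which the sum shows the coefficient of \<open>c d\<close> at
      \<open>m\<close> and nothing else.\<close>
    let ?n = "Poly_Mapping.single k d + m"
    have other: "Poly_Mapping.lookup (pvar k ^ d' * c d') ?n = 0" if d': "d' \<in> D - {d}" for d'
    proof (rule ccontr)
      assume "\<not> ?thesis"
      then have "?n \<in> Poly_Mapping.keys (pvar k ^ d' * c d')" by (simp add: in_keys_iff)
      then obtain m' where m': "m' \<in> Poly_Mapping.keys (c d')" "?n = Poly_Mapping.single k d' + m'"
        using keys_mult[of "pvar k ^ d'" "c d'"] by (auto simp: pvar_power)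
      then have "Poly_Mapping.lookup ?n k = d' + Poly_Mapping.lookup m' k" by (simp add: lookup_add)
      moreover have "Poly_Mapping.lookup m' k = 0" using assms(2)[of d'] d' m' by (auto simp: vars_below_def)
      ultimately show False using d' True by (simp add: lookup_add)
    qed
    have "0 = (\<Sum>d'\<in>D. Poly_Mapping.lookup (pvar k ^ d' * c d') ?n)"
      using zero by (simp flip: lookup_sum)
    also have "\<dots> = Poly_Mapping.lookup (pvar k ^ d * c d) ?n"
      using other by (subst sum.remove[OF assms(1) d]) simp
    finally show ?thesis by (simp add: pvar_power lookup_monomial_mult)
  qed
qed

text \<open>Degree strictly below \<open>D\<close> in the variable \<open>k\<close>. The bound is
  strict so that \<open>D = 0\<close> leaves only 0, the remainder with which the leading-term
  induction starts.\<close>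

definition degree_below :: "nat \<Rightarrow> nat \<Rightarrow> 'r::idom mvpoly set"
  where "degree_below k D = {\<Sum>d<D. pvar k ^ d * c d | c. \<forall>d. c d \<in> vars_below k}"

lemma degree_below_0 [simp]: "degree_below k 0 = {0}"
  by (auto simp: degree_below_def)

lemma degree_below_zero [simp, intro]: "0 \<in> degree_below k D"
  unfolding degree_below_def by (rule CollectI, rule exI[of _ "\<lambda>_. 0"]) simp

lemma degree_below_add [intro]:
  assumes "p \<in> degree_below k D" "q \<in> degree_below k D"
  shows "p + q \<in> degree_below k D"
proof -
  obtain c c' where "p = (\<Sum>d<D. pvar k ^ d * c d)" "\<forall>d. c d \<in> vars_below k"
    "q = (\<Sum>d<D. pvar k ^ d * c' d)" "\<forall>d. c' d \<in> vars_below k"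
    using assms by (auto simp: degree_below_def)
  then show ?thesis
    unfolding degree_below_def
    by (intro CollectI exI[of _ "\<lambda>d. c d + c' d"]) (auto simp: distrib_left sum.distrib)
qed

lemma degree_below_mult [intro]:
  assumes "p \<in> degree_below k D" "q \<in> vars_below k"
  shows "p * q \<in> degree_below k D"
proof -
  obtain c where "p = (\<Sum>d<D. pvar k ^ d * c d)" "\<forall>d. c d \<in> vars_below k"
    using assms by (auto simp: degree_below_def)
  then show ?thesis
    unfolding degree_below_def using assms(2)
    by (intro CollectI exI[of _ "\<lambda>d. c d * q"]) (auto simp: sum_distrib_right mult.assoc)
qed

lemma degree_below_uminus [intro]:
  assumes "p \<in> degree_below k D"
  shows "- p \<in> degree_below k D"
  using degree_below_mult[OF assms, of "-1"] by auto

lemma degree_below_diff [intro]: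
  "p \<in> degree_below k D \<Longrightarrow> q \<in> degree_below k D \<Longrightarrow> p - q \<in> degree_below k D"
  using degree_below_add[of p k D "- q"] by auto

lemma degree_below_Suc: "p \<in> degree_below k D \<Longrightarrow> p \<in> degree_below k (Suc D)"
proof -
  assume "p \<in> degree_below k D"
  then obtain c where c: "p = (\<Sum>d<D. pvar k ^ d * c d)" "\<forall>d. c d \<in> vars_below k"
    by (auto simp: degree_below_def)
  then have "p = (\<Sum>d<Suc D. pvar k ^ d * (if d < D then c d else 0))" by simp
  then show ?thesis
    unfolding degree_below_def using c(2)
    by (intro CollectI exI[of _ "\<lambda>d. if d < D then c d else 0"]) auto
qed

lemma degree_below_monomial: "c \<in> vars_below k \<Longrightarrow> pvar k ^ D * c \<in> degree_below k (Suc D)"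
  unfolding degree_below_def
  by (intro CollectI exI[of _ "\<lambda>d. if d < D then 0 else c"]) auto

lemma degree_below_shift:
  assumes "p \<in> degree_below k D"
  shows "pvar k * p \<in> degree_below k (Suc D)"
proof -
  obtain c where c: "p = (\<Sum>d<D. pvar k ^ d * c d)" "\<forall>d. c d \<in> vars_below k"
    using assms by (auto simp: degree_below_def)
  have "pvar k * p = (\<Sum>d<Suc D. pvar k ^ d * (case d of 0 \<Rightarrow> 0 | Suc d \<Rightarrow> c d))"
    unfolding sum.lessThan_Suc_shift using c by (simp add: sum_distrib_left mult.assoc)
  then show ?thesis
    unfolding degree_below_def using c(2)
    by (intro CollectI exI[of _ "\<lambda>d. case d of 0 \<Rightarrow> 0 | Suc d \<Rightarrow> c d"]) (auto split: nat.splits)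
qed

lemma degree_below_nonzero:
  fixes p :: "'r::idom mvpoly"
  assumes "p \<in> degree_below k D" "c \<in> vars_below k" "c \<noteq> 0"
  shows "p + pvar k ^ D * c \<noteq> 0"
proof
  assume *: "p + pvar k ^ D * c = 0"
  obtain a where a: "p = (\<Sum>d<D. pvar k ^ d * a d)" "\<forall>d. a d \<in> vars_below k"
    using assms(1) by (auto simp: degree_below_def)
  let ?c = "\<lambda>d. if d < D then a d else c"
  have "(\<Sum>d<Suc D. pvar k ^ d * ?c d) = 0" using * a(1) by simp
  moreover have "?c d \<in> vars_below k" for d using a(2) assms(2) by simp
  ultimately have "?c D = 0" by (intro pvar_transcendental[of "{..<Suc D}" ?c k D]) simp_all
  then show False using assms(3) by simp
qed

section \<open>Operators on vectors\<close>

text \<open>Infinite sequences leave room for growth: the direct sum of two representations is again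
  interleaved into this type.\<close>

type_synonym 'p vec = "nat \<Rightarrow> 'p"

definition scale :: "'p::idom \<Rightarrow> 'p vec \<Rightarrow> 'p vec"  (infixr "\<odot>" 70)
  where "c \<odot> x = (\<lambda>i. c * x i)"

lemma scale_apply: "(c \<odot> x) i = c * x i"
  by (simp add: scale_def)

lemma scale_simps [simp]:
  "c \<odot> (x + y) = c \<odot> x + c \<odot> y" "c \<odot> (x - y) = c \<odot> x - c \<odot> y" "(c + d) \<odot> x = c \<odot> x + d \<odot> x"
  "(c - d) \<odot> x = c \<odot> x - d \<odot> x"
  "c \<odot> d \<odot> x = (c * d) \<odot> x" "1 \<odot> x = x" "0 \<odot> x = 0" "c \<odot> 0 = 0"
  by (auto simp: fun_eq_iff scale_apply algebra_simps)

definition linear_op :: "('p::idom vec \<Rightarrow> 'p vec) \<Rightarrow> bool"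
  where "linear_op T \<longleftrightarrow> (\<forall>x y. T (x + y) = T x + T y) \<and> (\<forall>c x. T (c \<odot> x) = c \<odot> T x)"

definition linear_form :: "('p::idom vec \<Rightarrow> 'p) \<Rightarrow> bool"
  where "linear_form f \<longleftrightarrow> (\<forall>x y. f (x + y) = f x + f y) \<and> (\<forall>c x. f (c \<odot> x) = c * f x)"

lemma linear_opD:
  assumes "linear_op T"
  shows "T (x + y) = T x + T y" "T (c \<odot> x) = c \<odot> T x" "T 0 = 0" "T (x - y) = T x - T y"
proof -
  show add: "T (x + y) = T x + T y" for x y using assms by (simp add: linear_op_def)
  show scale: "T (c \<odot> x) = c \<odot> T x" for x c using assms by (simp add: linear_op_def)
  show "T 0 = 0" using scale[of 0 0] by simp
  show "T (x - y) = T x - T y" using add[of "x - y" y] by (simp add: eq_diff_eq)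
qed

lemma linear_formD:
  assumes "linear_form f"
  shows "f (x + y) = f x + f y" "f (c \<odot> x) = c * f x" "f 0 = 0" "f (x - y) = f x - f y"
proof -
  show add: "f (x + y) = f x + f y" for x y using assms by (simp add: linear_form_def)
  show scale: "f (c \<odot> x) = c * f x" for x c using assms by (simp add: linear_form_def)
  show "f 0 = 0" using scale[of 0 0] by simp
  show "f (x - y) = f x - f y" using add[of "x - y" y] by (simp add: eq_diff_eq)
qed

lemma linear_op_sum: "linear_op T \<Longrightarrow> T (\<Sum>i\<in>I. x i) = (\<Sum>i\<in>I. T (x i))"
  by (induction I rule: infinite_finite_induct) (auto simp: linear_opD)

lemma linear_form_sum: "linear_form f \<Longrightarrow> f (\<Sum>i\<in>I. x i) = (\<Sum>i\<in>I. f (x i))"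
  by (induction I rule: infinite_finite_induct) (auto simp: linear_formD)

definition agree :: "nat set \<Rightarrow> 'p vec \<Rightarrow> 'p vec \<Rightarrow> bool"
  where "agree I x y \<longleftrightarrow> (\<forall>i\<in>I. x i = y i)"

lemma agree_add: "agree I x y \<Longrightarrow> agree I x' y' \<Longrightarrow> agree I (x + x') (y + y')"
  and agree_diff: "agree I x y \<Longrightarrow> agree I x' y' \<Longrightarrow> agree I (x - x') (y - y')"
  for x y :: "'p::ab_group_add vec"
  by (auto simp: agree_def)

lemma agree_refl [simp]: "agree I x x"
  by (simp add: agree_def)

definition vecs_below :: "nat \<Rightarrow> 'r::idom mvpoly vec set"
  where "vecs_below k = {x. \<forall>i. x i \<in> vars_below k}"

lemma vecs_below_mono: "x \<in> vecs_below k \<Longrightarrow> k \<le> l \<Longrightarrow> x \<in> vecs_below l"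
  by (auto simp: vecs_below_def intro: vars_below_mono)

lemma vecs_below_intros [intro]:
  "0 \<in> vecs_below k" "x \<in> vecs_below k \<Longrightarrow> y \<in> vecs_below k \<Longrightarrow> x + y \<in> vecs_below k"
  "x \<in> vecs_below k \<Longrightarrow> y \<in> vecs_below k \<Longrightarrow> x - y \<in> vecs_below k"
  "c \<in> vars_below k \<Longrightarrow> x \<in> vecs_below k \<Longrightarrow> c \<odot> x \<in> vecs_below k"
  by (auto simp: vecs_below_def scale_apply)

text \<open>An operator is defined over the variables below \<open>k\<close> if it preserves the vectors over any
  larger set of variables; it need not preserve the coordinates outside the finite set \<open>I\<close>, which
  carries the finite-dimensional quotient representation of interest.\<close>

definition matrix_op :: "nat \<Rightarrow> nat set \<Rightarrow> ('r::idom mvpoly vec \<Rightarrow> 'r mvpoly vec) \<Rightarrow> bool"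
  where "matrix_op k I T \<longleftrightarrow> linear_op T \<and>
    (\<forall>l\<ge>k. \<forall>x\<in>vecs_below l. T x \<in> vecs_below l) \<and> (\<forall>x y. agree I x y \<longrightarrow> agree I (T x) (T y))"

definition matrix_form :: "nat \<Rightarrow> nat set \<Rightarrow> ('r::idom mvpoly vec \<Rightarrow> 'r mvpoly) \<Rightarrow> bool"
  where "matrix_form k I f \<longleftrightarrow> linear_form f \<and>
    (\<forall>l\<ge>k. \<forall>x\<in>vecs_below l. f x \<in> vars_below l) \<and> (\<forall>x y. agree I x y \<longrightarrow> f x = f y)"

lemma matrix_opD:
  assumes "matrix_op k I T"
  shows "linear_op T" "\<And>l x. k \<le> l \<Longrightarrow> x \<in> vecs_below l \<Longrightarrow> T x \<in> vecs_below l"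
    "\<And>x y. agree I x y \<Longrightarrow> agree I (T x) (T y)"
  using assms by (auto simp: matrix_op_def)

lemma matrix_formD:
  assumes "matrix_form k I f"
  shows "linear_form f" "\<And>l x. k \<le> l \<Longrightarrow> x \<in> vecs_below l \<Longrightarrow> f x \<in> vars_below l"
    "\<And>x y. agree I x y \<Longrightarrow> f x = f y"
  using assms by (auto simp: matrix_form_def)

lemma matrix_op_mono: "matrix_op k I T \<Longrightarrow> k \<le> l \<Longrightarrow> matrix_op l I T"
  by (auto simp: matrix_op_def)

lemma matrix_form_mono: "matrix_form k I f \<Longrightarrow> k \<le> l \<Longrightarrow> matrix_form l I f"
  by (auto simp: matrix_form_def)

lemma matrix_op_id: "matrix_op k I (\<lambda>x. x)"
  by (auto simp: matrix_op_def linear_op_def)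

lemma matrix_op_foldr:
  assumes "\<And>l. l \<in> set w \<Longrightarrow> matrix_op k I (T l)"
  shows "matrix_op k I (foldr T w)"
  using assms by (induction w) (auto simp: matrix_op_def linear_op_def)

definition vecs_degree_below :: "nat \<Rightarrow> nat \<Rightarrow> 'r::idom mvpoly vec set"
  where "vecs_degree_below k D = {x. \<forall>i. x i \<in> degree_below k D}"

lemma vecs_degree_below_intros:
  "0 \<in> vecs_degree_below k D"
  "x \<in> vecs_degree_below k D \<Longrightarrow> y \<in> vecs_degree_below k D \<Longrightarrow> x + y \<in> vecs_degree_below k D"
  "x \<in> vecs_degree_below k D \<Longrightarrow> y \<in> vecs_degree_below k D \<Longrightarrow> x - y \<in> vecs_degree_below k D"
  "c \<in> degree_below k D \<Longrightarrow> x \<in> vecs_below k \<Longrightarrow> c \<odot> x \<in> vecs_degree_below k D"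
  "x \<in> vecs_degree_below k D \<Longrightarrow> x \<in> vecs_degree_below k (Suc D)"
  "x \<in> vecs_below k \<Longrightarrow> pvar k ^ D \<odot> x \<in> vecs_degree_below k (Suc D)"
  by (auto simp: vecs_degree_below_def vecs_below_def scale_apply
      intro: degree_below_Suc degree_below_monomial)

lemma vecs_degree_below_0 [simp]: "vecs_degree_below k 0 = {0}"
  by (auto simp: vecs_degree_below_def fun_eq_iff)

lemma vecs_degree_belowE:
  assumes "x \<in> vecs_degree_below k D"
  obtains z where "\<And>d. z d \<in> vecs_below k" "x = (\<Sum>d<D. pvar k ^ d \<odot> z d)"
proof -
  have "\<forall>i. \<exists>c. x i = (\<Sum>d<D. pvar k ^ d * c d) \<and> (\<forall>d. c d \<in> vars_below k)"
    using assms by (auto simp: vecs_degree_below_def degree_below_def)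
  then obtain c where c: "\<And>i. x i = (\<Sum>d<D. pvar k ^ d * c i d)" "\<And>i d. c i d \<in> vars_below k"
    by metis
  show thesis
  proof (rule that[of "\<lambda>d i. c i d"])
    show "x = (\<Sum>d<D. pvar k ^ d \<odot> (\<lambda>i. c i d))"
      by (auto simp: fun_eq_iff c(1) sum_fun_apply scale_apply)
  qed (simp add: vecs_below_def c(2))
qed

text \<open>The operator is linear over the whole polynomial ring and preserves vectors over the
  variables below \<open>k\<close>, so it acts on each coefficient of the expansion in powers of
  \<open>pvar k\<close> separately.\<close>

lemma matrix_op_degree_below:
  assumes "matrix_op k I T" "x \<in> vecs_degree_below k D"
  shows "T x \<in> vecs_degree_below k D"
proof -
  obtain z where z: "\<And>d. z d \<in> vecs_below k" "x = (\<Sum>d<D. pvar k ^ d \<odot> z d)"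
    using vecs_degree_belowE[OF assms(2)] by blast
  have "T x = (\<Sum>d<D. pvar k ^ d \<odot> T (z d))"
    using matrix_opD(1)[OF assms(1)] by (simp add: z(2) linear_op_sum linear_opD)
  then show ?thesis
    using matrix_opD(2)[OF assms(1) order.refl z(1)]
    by (auto simp: vecs_degree_below_def degree_below_def vecs_below_def sum_fun_apply scale_apply)
qed

lemma matrix_form_degree_below:
  assumes "matrix_form k I f" "x \<in> vecs_degree_below k D"
  shows "f x \<in> degree_below k D"
proof -
  obtain z where z: "\<And>d. z d \<in> vecs_below k" "x = (\<Sum>d<D. pvar k ^ d \<odot> z d)"
    using vecs_degree_belowE[OF assms(2)] by blast
  have "f x = (\<Sum>d<D. pvar k ^ d * f (z d))"
    using matrix_formD(1)[OF assms(1)] by (simp add: z(2) linear_form_sum linear_formD)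
  then show ?thesis
    using matrix_formD(2)[OF assms(1) order.refl z(1)] by (auto simp: degree_below_def)
qed

text \<open>The even and the odd coordinates identify the vectors with pairs of vectors.\<close>

definition evens :: "'p vec \<Rightarrow> 'p vec"
  where "evens x = (\<lambda>i. x (2 * i))"

definition odds :: "'p vec \<Rightarrow> 'p vec"
  where "odds x = (\<lambda>i. x (Suc (2 * i)))"

definition join :: "'p vec \<Rightarrow> 'p vec \<Rightarrow> 'p vec"
  where "join u w = (\<lambda>i. if even i then u (i div 2) else w (i div 2))"

definition join_index :: "nat set \<Rightarrow> nat set \<Rightarrow> nat set"
  where "join_index I J = (\<lambda>i. 2 * i) ` I \<union> (\<lambda>i. Suc (2 * i)) ` J"

lemma evens_odds_simps [simp]:
  "evens (join u w) = u" "odds (join u w) = w" "join (evens x) (odds x) = x"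
  by (auto simp: evens_def odds_def join_def fun_eq_iff)

lemma evens_odds_linear [simp]:
  "evens (x + y) = evens x + evens y" "odds (x + y) = odds x + odds y"
  "evens (c \<odot> z) = c \<odot> evens z" "odds (c \<odot> z) = c \<odot> odds z"
  "evens 0 = (0 :: 'p vec)" "odds 0 = (0 :: 'p vec)"
  for x y :: "'p::idom vec" and z :: "'q::idom vec"
  by (auto simp: evens_def odds_def fun_eq_iff scale_apply)

lemma join_linear:
  "join (u + u') (w + w') = join u w + join u' w'" "join (c \<odot> u) (c \<odot> w) = c \<odot> join u w"
  for u :: "'p::idom vec"
  by (auto simp: join_def fun_eq_iff scale_apply)

lemma join_eq_iff [simp]: "join u w = join u' w' \<longleftrightarrow> u = u' \<and> w = w'"
  by (metis evens_odds_simps(1,2))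

lemma agree_join_index: "agree (join_index I J) x y \<longleftrightarrow> agree I (evens x) (evens y) \<and> agree J (odds x) (odds y)"
  by (auto simp: agree_def join_index_def evens_def odds_def)

lemma finite_join_index: "finite I \<Longrightarrow> finite J \<Longrightarrow> finite (join_index I J)"
  by (simp add: join_index_def)

lemma vecs_below_join: "u \<in> vecs_below k \<Longrightarrow> w \<in> vecs_below k \<Longrightarrow> join u w \<in> vecs_below k"
  by (auto simp: vecs_below_def join_def)

lemma vecs_below_evens: "x \<in> vecs_below k \<Longrightarrow> evens x \<in> vecs_below k"
  and vecs_below_odds: "x \<in> vecs_below k \<Longrightarrow> odds x \<in> vecs_below k"
  by (auto simp: vecs_below_def evens_def odds_def)

lemma matrix_op_join:
  assumes "matrix_op k I S" "matrix_op k J T"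
  shows "matrix_op k (join_index I J) (\<lambda>x. join (S (evens x)) (T (odds x)))"
  using assms matrix_opD(1)[OF assms(1)] matrix_opD(1)[OF assms(2)]
  unfolding matrix_op_def
  by (auto simp: linear_op_def join_linear agree_join_index
      intro!: vecs_below_join vecs_below_evens vecs_below_odds)

section \<open>Representations separating the cosets of a subgroup\<close>

context graph_of_groups
begin

text \<open>The relations of the whole graph are required, on all vectors and not only modulo
  agreement on \<open>I\<close>. A representation of the subgroup of \<open>U\<close> fits this
  scheme by letting the letters outside \<open>U\<close> act trivially, that is, through the
  retraction onto that subgroup; congruence of words can then always be taken over
  \<open>V\<close>.\<close>

definition graph_rep :: "('v \<times> 'a \<Rightarrow> 'p vec \<Rightarrow> 'p vec) \<Rightarrow> bool"
  where "graph_rep T \<longleftrightarrow> (\<forall>v\<in>V. \<forall>x. T (v, \<one>\<^bsub>G v\<^esub>) x = x) \<and>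
    (\<forall>v\<in>V. \<forall>a\<in>carrier (G v). \<forall>b\<in>carrier (G v). \<forall>x. T (v, a) (T (v, b) x) = T (v, a \<otimes>\<^bsub>G v\<^esub> b) x) \<and>
    (\<forall>v u. {v, u} \<in> E \<longrightarrow> (\<forall>a\<in>carrier (G v). \<forall>b\<in>carrier (G u). \<forall>x.
      T (v, a) (T (u, b) x) = T (u, b) (T (v, a) x)))"

lemma graph_repD:
  assumes "graph_rep T"
  shows "\<And>v x. v \<in> V \<Longrightarrow> T (v, \<one>\<^bsub>G v\<^esub>) x = x"
    "\<And>v a b x. v \<in> V \<Longrightarrow> a \<in> carrier (G v) \<Longrightarrow> b \<in> carrier (G v) \<Longrightarrow>
      T (v, a) (T (v, b) x) = T (v, a \<otimes>\<^bsub>G v\<^esub> b) x"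
    "\<And>v u a b x. {v, u} \<in> E \<Longrightarrow> a \<in> carrier (G v) \<Longrightarrow> b \<in> carrier (G u) \<Longrightarrow>
      T (v, a) (T (u, b) x) = T (u, b) (T (v, a) x)"
  using assms unfolding graph_rep_def by blast+

lemma graph_rep_cong:
  assumes T: "graph_rep T" and "u \<simeq> w"
  shows "foldr T u x = foldr T w x"
  using assms(2)
proof (induction arbitrary: x rule: word_cong.induct)
  case (rel l r u w)
  have "foldr T l y = foldr T r y" for y
    using rel(1) T unfolding graph_word_rels_def free_product_rels_def graph_rep_def
    by (elim UnE) (auto, blast)
  then show ?case by simp
qed auto

text \<open>For empty \<open>S\<close> the representation is faithful on the words over \<open>U\<close>, as \<open>f e = 0\<close>.\<close>

definition separates :: "nat \<Rightarrow> 'v set \<Rightarrow> 'v set \<Rightarrow> ('v \<times> 'a \<Rightarrow> 'r::idom mvpoly vec \<Rightarrow> 'r mvpoly vec) \<Rightarrow>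
    'r mvpoly vec \<Rightarrow> ('r mvpoly vec \<Rightarrow> 'r mvpoly) \<Rightarrow> nat set \<Rightarrow> bool"
  where "separates k U S T e f I \<longleftrightarrow> finite I \<and> e \<in> vecs_below k \<and> matrix_form k I f \<and>
    (\<forall>l\<in>letters V G. matrix_op k I (T l)) \<and> (\<forall>l\<in>letters (V - U) G. \<forall>x. T l x = x) \<and>
    graph_rep T \<and> f e = 0 \<and> (\<forall>l\<in>letters S G. T l e = e \<and> (\<forall>x. f (T l x) = f x)) \<and>
    (\<forall>w\<in>words U. (\<exists>c\<in>words S. w \<simeq> c) \<or> f (foldr T w e) \<noteq> 0)"

definition vertex_separates :: "nat \<Rightarrow> 'v \<Rightarrow> ('a \<Rightarrow> 'r::idom mvpoly vec \<Rightarrow> 'r mvpoly vec) \<Rightarrow>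
    'r mvpoly vec \<Rightarrow> ('r mvpoly vec \<Rightarrow> 'r mvpoly) \<Rightarrow> nat set \<Rightarrow> bool"
  where "vertex_separates k v \<rho> \<xi> \<eta> I \<longleftrightarrow> finite I \<and> \<xi> \<in> vecs_below k \<and> matrix_form k I \<eta> \<and>
    (\<forall>b\<in>carrier (G v). matrix_op k I (\<rho> b)) \<and> (\<forall>x. \<rho> \<one>\<^bsub>G v\<^esub> x = x) \<and>
    (\<forall>a\<in>carrier (G v). \<forall>b\<in>carrier (G v). \<forall>x. \<rho> a (\<rho> b x) = \<rho> (a \<otimes>\<^bsub>G v\<^esub> b) x) \<and>
    \<eta> \<xi> = 0 \<and> (\<forall>b\<in>carrier (G v). b \<noteq> \<one>\<^bsub>G v\<^esub> \<longrightarrow> \<eta> (\<rho> b \<xi>) \<noteq> 0)"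

lemma separatesD:
  assumes "separates k U S T e f I"
  shows "finite I" "e \<in> vecs_below k" "matrix_form k I f" "\<And>l. l \<in> letters V G \<Longrightarrow> matrix_op k I (T l)"
    "\<And>l x. l \<in> letters (V - U) G \<Longrightarrow> T l x = x" "graph_rep T" "f e = 0"
    "\<And>l. l \<in> letters S G \<Longrightarrow> T l e = e" "\<And>l x. l \<in> letters S G \<Longrightarrow> f (T l x) = f x"
    "\<And>w. w \<in> words U \<Longrightarrow> (\<exists>c\<in>words S. w \<simeq> c) \<or> f (foldr T w e) \<noteq> 0"
proof -
  note d = assms[unfolded separates_def]
  show "finite I" "e \<in> vecs_below k" "matrix_form k I f" "graph_rep T" "f e = 0"
    using d by simp_all
  have "\<forall>l\<in>letters V G. matrix_op k I (T l)" "\<forall>l\<in>letters (V - U) G. \<forall>x. T l x = x"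
    "\<forall>l\<in>letters S G. T l e = e \<and> (\<forall>x. f (T l x) = f x)"
    "\<forall>w\<in>words U. (\<exists>c\<in>words S. w \<simeq> c) \<or> f (foldr T w e) \<noteq> 0"
    by (insert d, elim conjE, assumption)+
  note balls = this[THEN bspec]
  show "\<And>l. l \<in> letters V G \<Longrightarrow> matrix_op k I (T l)" by (rule balls(1))
  show "\<And>l x. l \<in> letters (V - U) G \<Longrightarrow> T l x = x" by (rule balls(2)[THEN spec])
  show "\<And>l. l \<in> letters S G \<Longrightarrow> T l e = e" by (rule balls(3)[THEN conjunct1])
  show "\<And>l x. l \<in> letters S G \<Longrightarrow> f (T l x) = f x" by (rule balls(3)[THEN conjunct2, THEN spec])
  show "\<And>w. w \<in> words U \<Longrightarrow> (\<exists>c\<in>words S. w \<simeq> c) \<or> f (foldr T w e) \<noteq> 0" by (rule balls(4))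
qed

lemma separates_mono: "separates k U S T e f I \<Longrightarrow> k \<le> l \<Longrightarrow> separates l U S T e f I"
  unfolding separates_def
  by (auto intro: vecs_below_mono matrix_form_mono matrix_op_mono)

text \<open>Every word over \<open>U\<close> falls under the first alternative of the separation
  condition, so the zero form and an empty index set suffice.\<close>

lemma separates_refl: "U \<subseteq> V \<Longrightarrow> separates k U U (\<lambda>_ x. x) 0 (\<lambda>_. 0) {}"
  unfolding separates_def
  by (auto simp: matrix_op_id graph_rep_def matrix_form_def linear_form_def
      intro!: bexI word_cong.refl dest: words_mono)

text \<open>On the direct sum the form is f + t f2 with the fresh variable t. A word outside the
  subgroup of \<open>U\<close> is detected by the constant term in t; for a word congruent to one
  over \<open>U\<close> and with vanishing constant term, f2 decides.\<close>

lemma separates_trans: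
  fixes T T2 :: "'v \<times> 'a \<Rightarrow> 'r::idom mvpoly vec \<Rightarrow> 'r mvpoly vec"
  assumes T: "separates k U' U T e f I" and T2: "separates k U S T2 e2 f2 I2"
    and sub: "S \<subseteq> U" "U \<subseteq> U'" "U' \<subseteq> V"
  shows "separates (Suc k) U' S (\<lambda>l x. join (T l (evens x)) (T2 l (odds x))) (join e e2)
    (\<lambda>x. f (evens x) + pvar k * f2 (odds x)) (join_index I I2)"
proof -
  let ?T = "\<lambda>l x. join (T l (evens x)) (T2 l (odds x))"
  let ?f = "\<lambda>x. f (evens x) + pvar k * f2 (odds x)"
  note [simp] = pvar_in_vars_below
  have T': "matrix_form k I f" "matrix_form k I2 f2" "finite I" "finite I2" "f e = 0" "f2 e2 = 0"
    "e \<in> vecs_below k" "e2 \<in> vecs_below k"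
    "\<forall>l\<in>letters V G. matrix_op k I (T l)" "\<forall>l\<in>letters V G. matrix_op k I2 (T2 l)"
    "graph_rep T" "graph_rep T2"
    using T T2 by (auto simp: separates_def)
  have lin: "linear_form ?f"
    using linear_formD[OF matrix_formD(1)[OF T'(1)]] linear_formD[OF matrix_formD(1)[OF T'(2)]]
    by (auto simp: linear_form_def algebra_simps)
  have foldr: "foldr ?T w x = join (foldr T w (evens x)) (foldr T2 w (odds x))" for w x
    by (induction w) auto
  have fix_T: "\<forall>l\<in>letters U G. T l e = e \<and> (\<forall>x. f (T l x) = f x)"
    and fix_T2: "\<forall>l\<in>letters S G. T2 l e2 = e2 \<and> (\<forall>x. f2 (T2 l x) = f2 x)"
    and sep: "\<And>w. w \<in> words U' \<Longrightarrow> (\<exists>c\<in>words U. w \<simeq> c) \<or> f (foldr T w e) \<noteq> 0"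
    and sep2: "\<And>w. w \<in> words U \<Longrightarrow> (\<exists>c\<in>words S. w \<simeq> c) \<or> f2 (foldr T2 w e2) \<noteq> 0"
    using T T2 by (auto simp: separates_def)
  show ?thesis
    unfolding separates_def
  proof (intro conjI ballI allI)
    show "finite (join_index I I2)" using T' by (simp add: finite_join_index)
    show "join e e2 \<in> vecs_below (Suc k)"
      using T'(7,8) by (intro vecs_below_join) (auto intro: vecs_below_mono)
    show "matrix_form (Suc k) (join_index I I2) ?f"
      unfolding matrix_form_def
    proof (intro conjI allI impI ballI lin)
      fix l and x :: "'r mvpoly vec" assume l: "Suc k \<le> l" and x: "x \<in> vecs_below l"
      then have "f (evens x) \<in> vars_below l" "f2 (odds x) \<in> vars_below l"
        using matrix_formD(2)[OF T'(1) _ vecs_below_evens[OF x]]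
          matrix_formD(2)[OF T'(2) _ vecs_below_odds[OF x]] by simp_all
      then show "?f x \<in> vars_below l" using l by (intro vars_below_add vars_below_mult) auto
    next
      fix x y :: "'r mvpoly vec" assume "agree (join_index I I2) x y"
      then have "f (evens x) = f (evens y)" "f2 (odds x) = f2 (odds y)"
        by (auto simp: agree_join_index intro: matrix_formD(3)[OF T'(1)] matrix_formD(3)[OF T'(2)])
      then show "?f x = ?f y" by simp
    qed
    show "matrix_op (Suc k) (join_index I I2) (?T l)" if "l \<in> letters V G" for l
      by (rule matrix_op_mono[OF matrix_op_join, OF T'(9)[rule_format, OF that] T'(10)[rule_format, OF that]])
        simp
    show "?T l x = x" if l: "l \<in> letters (V - U') G" for l x
    proof -
      have "l \<in> letters (V - U) G" using l sub by auto
      then show ?thesis using separatesD(5)[OF T l] separatesD(5)[OF T2] by simp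
    qed
    show "graph_rep ?T"
      unfolding graph_rep_def
    proof (intro conjI allI ballI impI)
      fix v u a b x assume "{v, u} \<in> E" "a \<in> carrier (G v)" "b \<in> carrier (G u)"
      then show "?T (v, a) (?T (u, b) x) = ?T (u, b) (?T (v, a) x)"
        using graph_repD(3)[OF T'(11)] graph_repD(3)[OF T'(12)] by simp
    qed (simp_all add: graph_repD(1,2)[OF T'(11)] graph_repD(1,2)[OF T'(12)])
    show "?f (join e e2) = 0" using T' by simp
    fix l assume l: "l \<in> letters S G"
    then have "l \<in> letters U G" using sub by auto
    with l show "?T l (join e e2) = join e e2" "\<And>x. ?f (?T l x) = ?f x"
      using fix_T fix_T2 by auto
  next
    fix w assume w: "w \<in> words U'"
    have nz: "f (foldr T w e) + pvar k * f2 (foldr T2 w e2) \<noteq> 0" if "f (foldr T w e) \<noteq> 0"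
    proof -
      have "w \<in> words V" using w sub(3) by (rule words_mono)
      then have "matrix_op k I (foldr T w)" "matrix_op k I2 (foldr T2 w)"
        using T'(9,10) by (auto intro!: matrix_op_foldr)
      then have "f (foldr T w e) \<in> vars_below k" "f2 (foldr T2 w e2) \<in> vars_below k"
        using T' by (auto dest: matrix_opD matrix_formD)
      \<comment> \<open>Both values are free of variable \<open>k\<close>, so the sum f + t f2 can
        vanish only if its constant term does.\<close>
      then have "(\<Sum>d<2. pvar k ^ d * (if d = 0 then f (foldr T w e) else f2 (foldr T2 w e2))) = 0 \<Longrightarrow>
          f (foldr T w e) = 0"
        using pvar_transcendental[of "{..<2}"
            "\<lambda>d. if d = 0 then f (foldr T w e) else f2 (foldr T2 w e2)" k 0] by auto
      then show ?thesis using that by (auto simp: numeral_2_eq_2)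
    qed
    show "(\<exists>c\<in>words S. w \<simeq> c) \<or> ?f (foldr ?T w (join e e2)) \<noteq> 0"
    proof (cases "f (foldr T w e) = 0")
      case False
      then show ?thesis using nz by (simp add: foldr)
    next
      case True
      then obtain c where c: "c \<in> words U" "w \<simeq> c" using sep[OF w] by blast
      from sep2[OF c(1)] show ?thesis
      proof
        assume "\<exists>c'\<in>words S. c \<simeq> c'"
        then show ?thesis using c(2) by (blast intro: word_cong.trans)
      next
        assume "f2 (foldr T2 c e2) \<noteq> 0"
        then show ?thesis using True graph_rep_cong[OF T'(12) c(2)] by (simp add: foldr)
      qed
    qed
  qed
qed

end

section \<open>Adding a vertex\<close>

locale vertex_extension = graph_of_groups V E G
  for V :: "'v set" and E and G :: "'v \<Rightarrow> ('a, 'm) monoid_scheme" +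
  fixes k :: nat and v :: 'v and U :: "'v set"
    and T :: "'v \<times> 'a \<Rightarrow> 'r::idom mvpoly vec \<Rightarrow> 'r mvpoly vec"
    and e :: "'r mvpoly vec" and f :: "'r mvpoly vec \<Rightarrow> 'r mvpoly" and I :: "nat set"
    and \<rho> :: "'a \<Rightarrow> 'r mvpoly vec \<Rightarrow> 'r mvpoly vec"
    and \<xi> :: "'r mvpoly vec" and \<eta> :: "'r mvpoly vec \<Rightarrow> 'r mvpoly" and J :: "nat set"
  assumes v: "v \<in> V" and U: "U \<subseteq> V" "v \<notin> U"
    and sep: "separates k U (link v \<inter> U) T e f I"
    and vertex: "vertex_separates k v \<rho> \<xi> \<eta> J"
begin

lemma vertexD: "finite J" "\<xi> \<in> vecs_below k" "matrix_form k J \<eta>"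
    "\<And>b. b \<in> carrier (G v) \<Longrightarrow> matrix_op k J (\<rho> b)" "\<And>x. \<rho> \<one>\<^bsub>G v\<^esub> x = x"
    "\<And>a b x. a \<in> carrier (G v) \<Longrightarrow> b \<in> carrier (G v) \<Longrightarrow> \<rho> a (\<rho> b x) = \<rho> (a \<otimes>\<^bsub>G v\<^esub> b) x"
    "\<eta> \<xi> = 0" "\<And>b. b \<in> carrier (G v) \<Longrightarrow> b \<noteq> \<one>\<^bsub>G v\<^esub> \<Longrightarrow> \<eta> (\<rho> b \<xi>) \<noteq> 0"
  using vertex unfolding vertex_separates_def by simp_all

lemmas sepD = separatesD[OF sep]
lemmas form_f [simp] = linear_formD[OF matrix_formD(1)[OF sepD(3)]]
lemmas form_\<eta> [simp] = linear_formD[OF matrix_formD(1)[OF vertexD(3)]]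

lemma op_T [simp]:
  assumes "l \<in> letters V G"
  shows "T l (x + y) = T l x + T l y" "T l (c \<odot> x) = c \<odot> T l x" "T l 0 = 0" "T l (x - y) = T l x - T l y"
  using linear_opD[OF matrix_opD(1)[OF sepD(4)[OF assms]]] by blast+

lemma op_\<rho> [simp]:
  assumes "b \<in> carrier (G v)"
  shows "\<rho> b (x + y) = \<rho> b x + \<rho> b y" "\<rho> b (c \<odot> x) = c \<odot> \<rho> b x" "\<rho> b 0 = 0" "\<rho> b (x - y) = \<rho> b x - \<rho> b y"
  using linear_opD[OF matrix_opD(1)[OF vertexD(4)[OF assms]]] by blast+

text \<open>On pairs \<open>(u, w)\<close> the maps \<open>\<pi> (u, w) = u + t f(w) \<xi>\<close> and \<open>\<iota> u = (u, \<eta>(u) e)\<close> satisfy \<open>\<pi> \<circ> \<iota> = id\<close>,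
  since \<open>f e = 0\<close>. So \<open>b \<mapsto> 1 + \<iota> (\<rho> b - 1) \<pi>\<close> is multiplicative, and it commutes with whatever fixes
  \<open>e\<close> and \<open>f\<close>.\<close>

definition proj :: "'r mvpoly vec \<Rightarrow> 'r mvpoly vec"
  where "proj x = evens x + (pvar k * f (odds x)) \<odot> \<xi>"

definition incr :: "'a \<Rightarrow> 'r mvpoly vec \<Rightarrow> 'r mvpoly vec"
  where "incr b x = \<rho> b (proj x) - proj x"

definition ext_rep :: "'v \<times> 'a \<Rightarrow> 'r mvpoly vec \<Rightarrow> 'r mvpoly vec"
  where "ext_rep l x = (if fst l = v
    then join (evens x + incr (snd l) x) (odds x + \<eta> (incr (snd l) x) \<odot> e)
    else join (evens x) (T l (odds x)))"

text \<open>Letters other than those of \<open>v\<close> act on the odd coordinates only. Hence they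
  fix this vector and any form that reads only the even coordinates, which gives separation relative
  to all of \<open>U\<close>.\<close>

definition ext_vec :: "'r mvpoly vec"
  where "ext_vec = join \<xi> 0"

definition ext_form :: "'r mvpoly vec \<Rightarrow> 'r mvpoly"
  where "ext_form x = \<eta> (evens x)"

lemma ext_rep_v: "ext_rep (v, b) x = join (evens x + incr b x) (odds x + \<eta> (incr b x) \<odot> e)"
  by (simp add: ext_rep_def)

lemma ext_rep_other: "fst l \<noteq> v \<Longrightarrow> ext_rep l x = join (evens x) (T l (odds x))"
  by (simp add: ext_rep_def)

text \<open>This is where \<open>f e = 0\<close> enters: the odd coordinates change by a multiple of
  \<open>e\<close>, which \<open>proj\<close> does not see.\<close>

lemma proj_ext_rep_v: "proj (ext_rep (v, b) x) = \<rho> b (proj x)"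
  by (simp add: ext_rep_v proj_def incr_def sepD(7) algebra_simps)

lemma graph_rep_ext: "graph_rep ext_rep"
  unfolding graph_rep_def
proof (intro conjI ballI allI impI)
  fix u x assume u: "u \<in> V"
  show "ext_rep (u, \<one>\<^bsub>G u\<^esub>) x = x"
    by (cases "u = v")
      (simp_all add: ext_rep_v ext_rep_other incr_def vertexD(5) graph_repD(1)[OF sepD(6) u])
next
  fix u a b x assume u: "u \<in> V" "a \<in> carrier (G u)" "b \<in> carrier (G u)"
  show "ext_rep (u, a) (ext_rep (u, b) x) = ext_rep (u, a \<otimes>\<^bsub>G u\<^esub> b) x"
  proof (cases "u = v")
    case True
    \<comment> \<open>The increments telescope: adding \<open>incr b x\<close> cancels the term
      \<open>\<rho> b (proj x)\<close>.\<close>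
    have "incr a (ext_rep (v, b) x) = \<rho> (a \<otimes>\<^bsub>G v\<^esub> b) (proj x) - \<rho> b (proj x)"
      using u True by (simp add: incr_def proj_ext_rep_v vertexD(6))
    then have eq: "incr b x + incr a (ext_rep (v, b) x) = incr (a \<otimes>\<^bsub>G v\<^esub> b) x"
      by (simp add: incr_def)
    have "ext_rep (v, a) (ext_rep (v, b) x) =
        join (evens x + (incr b x + incr a (ext_rep (v, b) x)))
          (odds x + \<eta> (incr b x + incr a (ext_rep (v, b) x)) \<odot> e)"
      by (subst ext_rep_v) (simp add: ext_rep_v[of b] add.assoc)
    then show ?thesis unfolding eq using True by (simp add: ext_rep_v)
  next
    case False
    then show ?thesis using graph_repD(2)[OF sepD(6) u] by (simp add: ext_rep_other)
  qed
next
  have link: "ext_rep (v, a) (ext_rep (u, b) x) = ext_rep (u, b) (ext_rep (v, a) x)"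
    if u: "{v, u} \<in> E" "a \<in> carrier (G v)" "b \<in> carrier (G u)" for u a b x
  proof -
    have "u \<noteq> v" "u \<in> V" using u(1) graph by (auto simp: finite_simplicial_graph_def)
    \<comment> \<open>Neighbours of \<open>v\<close> in \<open>U\<close> fix \<open>e\<close> and
      \<open>f\<close> by separation relative to the link; those outside \<open>U\<close> act
      trivially anyway.\<close>
    have "T (u, b) e = e \<and> (\<forall>y. f (T (u, b) y) = f y)"
    proof (cases "u \<in> U")
      case True
      then have "(u, b) \<in> letters (link v \<inter> U) G"
        using u by (simp add: link_def insert_commute)
      then show ?thesis using sepD(8,9) by blast
    next
      case False
      then have "(u, b) \<in> letters (V - U) G" using u \<open>u \<in> V\<close> by simp
      then show ?thesis using sepD(5) by simp
    qed
    then have fixed: "T (u, b) e = e" "\<And>y. f (T (u, b) y) = f y" by auto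
    have l: "(u, b) \<in> letters V G" using u(3) \<open>u \<in> V\<close> by simp
    have "proj (ext_rep (u, b) x) = proj x"
      using \<open>u \<noteq> v\<close> by (simp add: ext_rep_other proj_def fixed)
    then have "incr a (ext_rep (u, b) x) = incr a x" by (simp add: incr_def)
    then show ?thesis
      using \<open>u \<noteq> v\<close> by (simp add: ext_rep_v ext_rep_other op_T[OF l] fixed)
  qed
  fix u u' a b x assume u: "{u, u'} \<in> E" "a \<in> carrier (G u)" "b \<in> carrier (G u')"
  consider "u = v" | "u' = v" | "u \<noteq> v" "u' \<noteq> v" by blast
  then show "ext_rep (u, a) (ext_rep (u', b) x) = ext_rep (u', b) (ext_rep (u, a) x)"
  proof cases
    case 1
    then show ?thesis using link u by simp
  next
    case 2
    then show ?thesis using link[of u b a x] u by (simp add: insert_commute)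
  next
    case 3
    then show ?thesis using graph_repD(3)[OF sepD(6) u] by (simp add: ext_rep_other)
  qed
qed

lemma matrix_op_ext:
  assumes l: "l \<in> letters V G"
  shows "matrix_op (Suc k) (join_index J I) (ext_rep l)"
proof (cases "fst l = v")
  case False
  then have "ext_rep l = (\<lambda>x. join (evens x) (T l (odds x)))" by (simp add: fun_eq_iff ext_rep_other)
  then show ?thesis
    using matrix_op_mono[OF matrix_op_join[OF matrix_op_id sepD(4)[OF l]], of "Suc k"] by simp
next
  case True
  then obtain b where b: "l = (v, b)" "b \<in> carrier (G v)" using l by auto
  have lin: "linear_op (ext_rep l)"
    unfolding linear_op_def b(1) using b(2)
    by (simp add: ext_rep_v incr_def proj_def algebra_simps flip: join_linear)
  show ?thesis
    unfolding matrix_op_def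
  proof (intro conjI allI impI ballI lin)
    fix n and x :: "'r mvpoly vec" assume n: "Suc k \<le> n" and x: "x \<in> vecs_below n"
    then have kn: "k \<le> n" by simp
    have u: "evens x \<in> vecs_below n" "odds x \<in> vecs_below n"
      using x by (auto intro: vecs_below_evens vecs_below_odds)
    have \<xi>: "\<xi> \<in> vecs_below n" "e \<in> vecs_below n"
      using vecs_below_mono[OF vertexD(2) kn] vecs_below_mono[OF sepD(2) kn] .
    have "pvar k * f (odds x) \<in> vars_below n"
      using matrix_formD(2)[OF sepD(3) kn u(2)] pvar_in_vars_below[of k n] n by auto
    then have p: "proj x \<in> vecs_below n" unfolding proj_def using u(1) \<xi>(1) by blast
    have i: "incr b x \<in> vecs_below n"
      unfolding incr_def using matrix_opD(2)[OF vertexD(4)[OF b(2)] kn p] p by blast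
    have "\<eta> (incr b x) \<in> vars_below n" using matrix_formD(2)[OF vertexD(3) kn i] .
    then show "ext_rep l x \<in> vecs_below n"
      unfolding b(1) ext_rep_v using u i \<xi> by (intro vecs_below_join vecs_below_intros)
  next
    fix x y :: "'r mvpoly vec" assume "agree (join_index J I) x y"
    then have *: "agree J (evens x) (evens y)" "agree I (odds x) (odds y)"
      by (simp_all add: agree_join_index)
    have p: "agree J (proj x) (proj y)"
      unfolding proj_def matrix_formD(3)[OF sepD(3) *(2)] using *(1) by (intro agree_add) auto
    have i: "agree J (incr b x) (incr b y)"
      unfolding incr_def using matrix_opD(3)[OF vertexD(4)[OF b(2)] p] p by (rule agree_diff)
    show "agree (join_index J I) (ext_rep l x) (ext_rep l y)"
      unfolding b(1) ext_rep_v agree_join_index evens_odds_simps matrix_formD(3)[OF vertexD(3) i]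
      using * i by (intro conjI agree_add) auto
  qed
qed

lemma foldr_ext_rep_U:
  assumes "h \<in> words U"
  shows "foldr ext_rep h x = join (evens x) (foldr T h (odds x))"
  using assms
proof (induction h)
  case (Cons l h)
  then have "fst l \<noteq> v" using U(2) by auto
  then show ?case using Cons.IH by (simp add: ext_rep_other)
qed simp

lemma foldr_ext_rep_U_vec:
  assumes "h \<in> words U"
  shows "foldr ext_rep h ext_vec = ext_vec"
proof -
  have "matrix_op k I (foldr T h)"
    using words_mono[OF assms U(1)] sepD(4) by (intro matrix_op_foldr) auto
  then show ?thesis
    using foldr_ext_rep_U[OF assms, of ext_vec] linear_opD(3)[OF matrix_opD(1)]
    by (simp add: ext_vec_def)
qed

text \<open>The leading terms in \<open>t\<close> of the two components: this invariant shows that an alternating word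
  moves \<open>(\<xi>, 0)\<close> out of the kernel of the form \<open>\<eta>\<close>.\<close>

lemma alternating_leading_term:
  assumes "y \<in> alternating U v"
  shows "\<exists>D a r s. a \<in> vecs_below k \<and> \<eta> a \<noteq> 0 \<and> r \<in> vecs_degree_below k D \<and> s \<in> vecs_degree_below k D \<and>
    foldr ext_rep y ext_vec = join (pvar k ^ D \<odot> a + r) ((pvar k ^ D * \<eta> a) \<odot> e + s)"
  using assms
proof (induction rule: alternating.induct)
  case (base b h)
  let ?a = "\<rho> b \<xi>"
  \<comment> \<open>Here \<open>D = 0\<close> and both remainders are 0: the block \<open>h\<close>
    fixes the vector, its odd part is 0, so no power of t arises, and
    \<open>\<eta> \<xi> = 0\<close> simplifies the odd component.\<close>
  have "foldr ext_rep ((v, b) # h) ext_vec = join ?a (\<eta> ?a \<odot> e)"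
    using base by (simp add: foldr_ext_rep_U_vec ext_rep_v incr_def proj_def)
      (simp add: ext_vec_def vertexD(7))
  moreover have "?a \<in> vecs_below k"
    using matrix_opD(2)[OF vertexD(4)[OF base(1)] order.refl vertexD(2)] .
  ultimately show ?case
    using vertexD(8)[OF base(1,2)] by (intro exI[of _ 0] exI[of _ ?a]) auto
next
  case (step b h y)
  then obtain D a r s where a: "a \<in> vecs_below k" "\<eta> a \<noteq> 0" and r: "r \<in> vecs_degree_below k D"
    and s: "s \<in> vecs_degree_below k D"
    and y: "foldr ext_rep y ext_vec = join (pvar k ^ D \<odot> a + r) ((pvar k ^ D * \<eta> a) \<odot> e + s)"
    by blast
  have M: "matrix_op k I (foldr T h)"
    using words_mono[OF step(3) U(1)] sepD(4) by (intro matrix_op_foldr) auto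
  note linM = linear_opD[OF matrix_opD(1)[OF M]]
  note b = step(1,2)
  let ?t = "pvar k" and ?M = "foldr T h"
  \<comment> \<open>The scalar contributed by the block \<open>h\<close>; it is nonzero because
    \<open>h\<close> is not congruent to a word over the link.\<close>
  define \<mu> where "\<mu> = f (?M e)"
  have Me: "?M e \<in> vecs_below k" using matrix_opD(2)[OF M order.refl sepD(2)] .
  have \<mu>: "\<mu> \<noteq> 0" "\<mu> \<in> vars_below k"
    using sepD(10)[OF step(3)] step(4) matrix_formD(2)[OF sepD(3) order.refl Me] by (auto simp: \<mu>_def)
  have \<lambda>: "\<eta> a \<in> vars_below k" using matrix_formD(2)[OF vertexD(3) order.refl a(1)] .
  have Ms: "?M s \<in> vecs_degree_below k D" using matrix_op_degree_below[OF M s] .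
  \<comment> \<open>The terms of \<open>proj z\<close> of degree at most \<open>D\<close>. The
    single term of degree \<open>Suc D\<close> comes from the factor t in \<open>proj\<close>,
    applied to the leading odd term; so each inner block raises the degree by one.\<close>
  define q where "q = ?t ^ D \<odot> a + r + (?t * f (?M s)) \<odot> \<xi>"
  have q: "q \<in> vecs_degree_below k (Suc D)"
    unfolding q_def
    by (intro vecs_degree_below_intros(2,4,6) vecs_degree_below_intros(5)[OF r] a vertexD(2)
        degree_below_shift matrix_form_degree_below[OF sepD(3) Ms])
  define w where "w = (?t ^ D * \<eta> a) \<odot> ?M e + ?M s"
  have w: "w \<in> vecs_degree_below k (Suc D)"
    unfolding w_def using Me \<lambda>
    by (intro vecs_degree_below_intros(2) vecs_degree_below_intros(5)[OF Ms]
        vecs_degree_below_intros(4) degree_below_monomial)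
  define z where "z = join (?t ^ D \<odot> a + r) w"
  have hy: "foldr ext_rep (h @ y) ext_vec = z"
    by (simp add: y foldr_ext_rep_U[OF step(3)] linM z_def w_def)
  define c where "c = \<eta> a * \<mu>"
  have c: "c \<in> vars_below k" "c \<noteq> 0" using a(2) \<mu> \<lambda> by (auto simp: c_def)
  have proj_z: "proj z = (?t ^ Suc D * c) \<odot> \<xi> + q"
    by (simp add: proj_def z_def w_def q_def c_def \<mu>_def algebra_simps)
  \<comment> \<open>The new leading vector. Since \<open>\<eta> \<xi> = 0\<close>, its value under
    \<open>\<eta>\<close> is \<open>c * \<eta> (\<rho> b \<xi>)\<close>: the old leading coefficient
    times one nonzero factor for \<open>h\<close> and one for \<open>b\<close>.\<close>
  define a' where "a' = c \<odot> (\<rho> b \<xi> - \<xi>)"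
  define r' where "r' = \<rho> b q - q"
  have incr_z: "incr b z = ?t ^ Suc D \<odot> a' + r'"
    using b(1) by (simp add: incr_def proj_z a'_def r'_def algebra_simps)
  have r': "r' \<in> vecs_degree_below k (Suc D)"
    unfolding r'_def
    by (intro vecs_degree_below_intros(3) matrix_op_degree_below[OF vertexD(4)[OF b(1)]] q)
  have \<rho>\<xi>: "\<rho> b \<xi> \<in> vecs_below k"
    using matrix_opD(2)[OF vertexD(4)[OF b(1)] order.refl vertexD(2)] .
  have a': "a' \<in> vecs_below k" unfolding a'_def using c(1) \<rho>\<xi> vertexD(2) by blast
  have "\<eta> a' \<noteq> 0"
    using c(2) vertexD(8)[OF b] by (simp add: a'_def vertexD(7) right_diff_distrib[symmetric])
  moreover have "?t ^ D \<odot> a + r + r' \<in> vecs_degree_below k (Suc D)"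
    by (intro vecs_degree_below_intros(2,6) vecs_degree_below_intros(5)[OF r] a r')
  moreover have "w + \<eta> r' \<odot> e \<in> vecs_degree_below k (Suc D)"
    by (intro vecs_degree_below_intros(2,4) w matrix_form_degree_below[OF vertexD(3) r'] sepD(2))
  moreover have "foldr ext_rep ((v, b) # h @ y) ext_vec =
      join (?t ^ Suc D \<odot> a' + (?t ^ D \<odot> a + r + r')) ((?t ^ Suc D * \<eta> a') \<odot> e + (w + \<eta> r' \<odot> e))"
  proof -
    have "foldr ext_rep ((v, b) # h @ y) ext_vec = ext_rep (v, b) z"
      using hy by simp
    also have "\<dots> = join (?t ^ D \<odot> a + r + incr b z) (w + \<eta> (incr b z) \<odot> e)"
      by (simp add: ext_rep_v z_def)
    also have "\<dots> = join (?t ^ Suc D \<odot> a' + (?t ^ D \<odot> a + r + r'))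
        ((?t ^ Suc D * \<eta> a') \<odot> e + (w + \<eta> r' \<odot> e))"
      unfolding incr_z by (simp add: algebra_simps)
    finally show ?thesis .
  qed
  ultimately show ?case using a' by blast
qed

lemma ext_form_alternating:
  assumes "y \<in> alternating U v"
  shows "ext_form (foldr ext_rep y ext_vec) \<noteq> 0"
proof -
  obtain D a r s where a: "a \<in> vecs_below k" "\<eta> a \<noteq> 0" and r: "r \<in> vecs_degree_below k D"
    and y: "foldr ext_rep y ext_vec = join (pvar k ^ D \<odot> a + r) ((pvar k ^ D * \<eta> a) \<odot> e + s)"
    using alternating_leading_term[OF assms] by blast
  have "\<eta> r + pvar k ^ D * \<eta> a \<noteq> 0"
    using matrix_form_degree_below[OF vertexD(3) r] matrix_formD(2)[OF vertexD(3) order.refl a(1)] a(2)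
    by (rule degree_below_nonzero)
  then show ?thesis by (simp add: ext_form_def y add.commute)
qed

text \<open>In the decomposition of a word into an initial block over \<open>U\<close> and an
  alternating word, the initial block does not change the form, and the alternating part makes its
  value nonzero.\<close>

lemma separates_ext: "separates (Suc k) (insert v U) U ext_rep ext_vec ext_form (join_index J I)"
  unfolding separates_def
proof (intro conjI ballI allI)
  show "finite (join_index J I)" using vertexD(1) sepD(1) by (rule finite_join_index)
  show "ext_vec \<in> vecs_below (Suc k)"
    unfolding ext_vec_def
    by (intro vecs_below_join vecs_below_intros(1) vecs_below_mono[OF vertexD(2)]) simp
  show "matrix_form (Suc k) (join_index J I) ext_form"
    unfolding matrix_form_def ext_form_def
  proof (intro conjI allI impI ballI)
    show "linear_form (\<lambda>x. \<eta> (evens x))" by (simp add: linear_form_def)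
    fix n and x :: "'r mvpoly vec" assume "Suc k \<le> n" "x \<in> vecs_below n"
    then show "\<eta> (evens x) \<in> vars_below n"
      by (intro matrix_formD(2)[OF vertexD(3)] vecs_below_evens) simp_all
  next
    fix x y :: "'r mvpoly vec" assume "agree (join_index J I) x y"
    then show "\<eta> (evens x) = \<eta> (evens y)"
      by (intro matrix_formD(3)[OF vertexD(3)]) (simp add: agree_join_index)
  qed
  show "matrix_op (Suc k) (join_index J I) (ext_rep l)" if "l \<in> letters V G" for l
    using that by (rule matrix_op_ext)
  show "ext_rep l x = x" if "l \<in> letters (V - insert v U) G" for l x
  proof -
    have "l \<in> letters (V - U) G" "fst l \<noteq> v" using that by auto
    then show ?thesis using sepD(5)[of l "odds x"] by (simp add: ext_rep_other)
  qed
  show "graph_rep ext_rep" by (rule graph_rep_ext)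
  show "ext_form ext_vec = 0" by (simp add: ext_form_def ext_vec_def vertexD(7))
  fix l assume l: "l \<in> letters U G"
  then have "fst l \<noteq> v" using U(2) by auto
  then show "ext_form (ext_rep l x) = ext_form x" for x by (simp add: ext_rep_other ext_form_def)
  show "ext_rep l ext_vec = ext_vec" using foldr_ext_rep_U_vec[of "[l]"] l by simp
next
  fix w assume "w \<in> words (insert v U)"
  from words_insert_cases[OF v U(1) this]
  show "(\<exists>c\<in>words U. w \<simeq> c) \<or> ext_form (foldr ext_rep w ext_vec) \<noteq> 0"
  proof (elim disjE bexE)
    fix h y assume h: "h \<in> words U" and y: "y \<in> alternating U v" and w: "w \<simeq> h @ y"
    have "foldr ext_rep w ext_vec = foldr ext_rep h (foldr ext_rep y ext_vec)"
      using graph_rep_cong[OF graph_rep_ext w] by simp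
    then have "ext_form (foldr ext_rep w ext_vec) = ext_form (foldr ext_rep y ext_vec)"
      by (simp add: foldr_ext_rep_U[OF h] ext_form_def)
    then show ?thesis using ext_form_alternating[OF y] by simp
  qed blast
qed

end

section \<open>Vertex groups\<close>

lemma linear_over_matrices:
  assumes "group G" "linear_over TYPE('r::comm_ring_1) G"
  shows "\<exists>n (M :: 'a \<Rightarrow> 'r mat). (\<forall>a\<in>carrier G. M a \<in> carrier_mat n n) \<and>
    (\<forall>a\<in>carrier G. \<forall>b\<in>carrier G. M (a \<otimes>\<^bsub>G\<^esub> b) = M a * M b) \<and> M \<one>\<^bsub>G\<^esub> = 1\<^sub>m n \<and> inj_on M (carrier G)"
proof -
  obtain n H where H: "subgroup H (GL n :: 'r mat monoid)"
    and iso: "G \<cong> (GL n :: 'r mat monoid)\<lparr>carrier := H\<rparr>"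
    using assms(2) by (auto simp: linear_over_def)
  interpret GL: group "GL n :: 'r mat monoid" by (rule group_GL)
  obtain M where M: "M \<in> iso G ((GL n :: 'r mat monoid)\<lparr>carrier := H\<rparr>)"
    using iso by (auto simp: is_iso_def)
  have "H \<subseteq> carrier (GL n)" using H by (rule subgroup.subset)
  also have "\<dots> \<subseteq> carrier_mat n n" by (auto simp: GL_def units_of_def Units_def ring_mat_def)
  finally have HM: "H \<subseteq> carrier_mat n n" .
  have hom: "M \<in> hom G ((GL n :: 'r mat monoid)\<lparr>carrier := H\<rparr>)" and inj: "inj_on M (carrier G)"
    using M by (auto simp: iso_def bij_betw_def)
  interpret M: group_hom G "(GL n :: 'r mat monoid)\<lparr>carrier := H\<rparr>" M
    using hom assms(1) GL.subgroup_imp_group[OF H] by (simp add: group_hom_def group_hom_axioms_def)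
  have "M a \<in> carrier_mat n n" if "a \<in> carrier G" for a using M.hom_closed[OF that] HM by auto
  moreover have "M (a \<otimes>\<^bsub>G\<^esub> b) = M a * M b" if "a \<in> carrier G" "b \<in> carrier G" for a b
    using M.hom_mult[OF that] by (simp add: GL_def units_of_def ring_mat_def)
  moreover have "M \<one>\<^bsub>G\<^esub> = 1\<^sub>m n"
    using M.hom_one by (simp add: GL_def units_of_def ring_mat_def)
  ultimately show ?thesis using inj by blast
qed

section \<open>A separating representation of a matrix group\<close>

abbreviation const_poly :: "'r::idom \<Rightarrow> 'r mvpoly"
  where "const_poly \<equiv> Poly_Mapping.single 0"

lemma const_poly_sum: "const_poly (\<Sum>i\<in>I. c i) = (\<Sum>i\<in>I. const_poly (c i))"
  by (induction I rule: infinite_finite_induct) (auto simp: single_add)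

lemma const_poly_mult: "const_poly (a * b) = const_poly a * const_poly b"
  by (simp add: mult_single)

text \<open>A vector consists of a scalar, at index \<open>0\<close>, and an infinite matrix, on whose top left block the
  matrix group acts by left multiplication.\<close>

definition mat_op :: "nat \<Rightarrow> 'r::idom mat \<Rightarrow> 'r mvpoly vec \<Rightarrow> 'r mvpoly vec"
  where "mat_op n A x m = (case m of 0 \<Rightarrow> x 0 | Suc m' \<Rightarrow> (case prod_decode m' of (i, j) \<Rightarrow>
    if i < n \<and> j < n then \<Sum>l<n. const_poly (A $$ (i, l)) * x (Suc (prod_encode (l, j))) else x m))"

definition mat_vec :: "'r::idom mvpoly vec"
  where "mat_vec m = (case m of 0 \<Rightarrow> 1 | Suc m' \<Rightarrow> (case prod_decode m' of (i, j) \<Rightarrow> if i = j then 1 else 0))"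

text \<open>The condition A = 1 is affine in A; the scalar coordinate makes it linear. Distinct
  powers of a fresh variable combine the conditions for all entries into a single form.\<close>

definition mat_form :: "nat \<Rightarrow> nat \<Rightarrow> 'r::idom mvpoly vec \<Rightarrow> 'r mvpoly"
  where "mat_form k n x = (\<Sum>p\<in>{..<n} \<times> {..<n}. pvar k ^ prod_encode p *
    (x (Suc (prod_encode p)) - (if fst p = snd p then x 0 else 0)))"

definition mat_index :: "nat \<Rightarrow> nat set"
  where "mat_index n = insert 0 ((\<lambda>p. Suc (prod_encode p)) ` ({..<n} \<times> {..<n}))"

lemma mat_op_simps:
  "mat_op n A x 0 = x 0"
  "i < n \<Longrightarrow> j < n \<Longrightarrow> mat_op n A x (Suc (prod_encode (i, j))) =
    (\<Sum>l<n. const_poly (A $$ (i, l)) * x (Suc (prod_encode (l, j))))"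
  "\<not> (i < n \<and> j < n) \<Longrightarrow> mat_op n A x (Suc (prod_encode (i, j))) = x (Suc (prod_encode (i, j)))"
  by (auto simp: mat_op_def)

lemma vec_eqI:
  assumes "x 0 = y 0" "\<And>i j. x (Suc (prod_encode (i, j))) = y (Suc (prod_encode (i, j)))"
  shows "x = y"
proof
  fix m
  show "x m = y m"
  proof (cases m)
    case (Suc m')
    then show ?thesis using assms(2)[of "fst (prod_decode m')" "snd (prod_decode m')"] by simp
  qed (simp add: assms(1))
qed

lemma mat_op_one: "mat_op n (1\<^sub>m n) x = x"
proof (rule vec_eqI)
  fix i j
  show "mat_op n (1\<^sub>m n) x (Suc (prod_encode (i, j))) = x (Suc (prod_encode (i, j)))"
  proof (cases "i < n \<and> j < n")
    case True
    then have ij: "i < n" "j < n" by auto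
    have "mat_op n (1\<^sub>m n) x (Suc (prod_encode (i, j))) =
        (\<Sum>l<n. if i = l then x (Suc (prod_encode (l, j))) else 0)"
      unfolding mat_op_simps(2)[OF ij] by (rule sum.cong) (use ij in auto)
    then show ?thesis using True by simp
  qed (rule mat_op_simps(3))
qed (simp add: mat_op_simps)

lemma mat_op_mult:
  assumes "A \<in> carrier_mat n n" "B \<in> carrier_mat n n"
  shows "mat_op n A (mat_op n B x) = mat_op n (A * B) x"
proof (rule vec_eqI)
  fix i j
  show "mat_op n A (mat_op n B x) (Suc (prod_encode (i, j))) = mat_op n (A * B) x (Suc (prod_encode (i, j)))"
  proof (cases "i < n \<and> j < n")
    case True
    then have ij: "i < n" "j < n" by auto
    have "mat_op n A (mat_op n B x) (Suc (prod_encode (i, j))) =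
        (\<Sum>l<n. \<Sum>l'<n. const_poly (A $$ (i, l)) * const_poly (B $$ (l, l')) * x (Suc (prod_encode (l', j))))"
      using ij by (simp add: mat_op_simps(2) sum_distrib_left mult.assoc)
    also have "\<dots> = (\<Sum>l'<n. \<Sum>l<n. const_poly (A $$ (i, l)) * const_poly (B $$ (l, l')) * x (Suc (prod_encode (l', j))))"
      by (rule sum.swap)
    also have "\<dots> = (\<Sum>l'<n. const_poly ((A * B) $$ (i, l')) * x (Suc (prod_encode (l', j))))"
      using ij assms
      by (intro sum.cong) (auto simp: scalar_prod_def const_poly_sum const_poly_mult sum_distrib_right lessThan_atLeast0)
    finally show ?thesis using ij by (simp add: mat_op_simps(2))
  qed (simp add: mat_op_simps(3))
qed (simp add: mat_op_simps)

lemma matrix_op_mat_op: "matrix_op k (mat_index n) (mat_op n A)"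
  unfolding matrix_op_def
proof (intro conjI allI impI ballI)
  show "linear_op (mat_op n A)"
    by (auto simp: linear_op_def mat_op_def fun_eq_iff scale_apply sum.distrib sum_distrib_left
        algebra_simps split: nat.splits prod.splits)
  fix l and x :: "'a mvpoly vec" assume "k \<le> l" and x: "x \<in> vecs_below l"
  then show "mat_op n A x \<in> vecs_below l"
    by (auto simp: vecs_below_def mat_op_def intro!: vars_below_sum split: nat.splits prod.splits)
next
  fix x y :: "'a mvpoly vec" assume "agree (mat_index n) x y"
  then show "agree (mat_index n) (mat_op n A x) (mat_op n A y)"
    by (auto simp: agree_def mat_index_def mat_op_simps intro!: sum.cong)
qed

lemma matrix_form_mat_form: "matrix_form (Suc k) (mat_index n) (mat_form k n)"
  unfolding matrix_form_def
proof (intro conjI allI impI ballI)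
  show "linear_form (mat_form k n)"
    by (auto simp: linear_form_def mat_form_def scale_apply sum_distrib_left algebra_simps
        simp flip: sum.distrib intro!: sum.cong)
  fix l and x :: "'a mvpoly vec" assume "Suc k \<le> l" and x: "x \<in> vecs_below l"
  then show "mat_form k n x \<in> vars_below l"
    using pvar_in_vars_below[of k l]
    by (auto simp: vecs_below_def mat_form_def
        intro!: vars_below_sum vars_below_mult vars_below_diff vars_below_power)
next
  fix x y :: "'a mvpoly vec" assume "agree (mat_index n) x y"
  then show "mat_form k n x = mat_form k n y"
    by (auto simp: agree_def mat_index_def mat_form_def intro!: sum.cong)
qed

text \<open>The value is a polynomial in the fresh variable whose coefficients are the entries of A
  - 1, and \<open>prod_encode\<close> gives different entries different exponents.\<close>

lemma mat_form_zero_iff: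
  assumes A: "A \<in> carrier_mat n n"
  shows "mat_form k n (mat_op n A mat_vec) = 0 \<longleftrightarrow> A = 1\<^sub>m n"
proof
  assume zero: "mat_form k n (mat_op n A mat_vec) = 0"
  \<comment> \<open>The entries of A - 1, indexed by their exponents as required for
    \<open>pvar_transcendental\<close>.\<close>
  let ?c = "\<lambda>m. case prod_decode m of (i, j) \<Rightarrow> const_poly (A $$ (i, j)) - (if i = j then 1 else 0)"
  let ?P = "{..<n} \<times> {..<n}"
  have entry: "mat_op n A mat_vec (Suc (prod_encode (i, j))) = const_poly (A $$ (i, j))"
    if "i < n" "j < n" for i j
  proof -
    have "mat_op n A mat_vec (Suc (prod_encode (i, j))) =
        (\<Sum>l<n. if l = j then const_poly (A $$ (i, l)) else 0)"
      unfolding mat_op_simps(2)[OF that] by (rule sum.cong) (auto simp: mat_vec_def)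
    then show ?thesis using that by simp
  qed
  have "mat_form k n (mat_op n A mat_vec) = (\<Sum>p\<in>?P. pvar k ^ prod_encode p * ?c (prod_encode p))"
    unfolding mat_form_def by (rule sum.cong) (auto simp: entry mat_op_simps(1) mat_vec_def)
  also have "\<dots> = (\<Sum>m\<in>prod_encode ` ?P. pvar k ^ m * ?c m)"
    by (simp add: sum.reindex inj_prod_encode)
  finally have sum: "(\<Sum>m\<in>prod_encode ` ?P. pvar k ^ m * ?c m) = 0" using zero by simp
  have c: "?c m \<in> vars_below k" for m by (auto split: prod.splits)
  show "A = 1\<^sub>m n"
  proof (rule eq_matI)
    fix i j assume "i < dim_row (1\<^sub>m n :: 'a mat)" "j < dim_col (1\<^sub>m n :: 'a mat)"
    then have ij: "i < n" "j < n" by auto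
    have "?c (prod_encode (i, j)) = 0"
      by (rule pvar_transcendental[OF _ c sum]) (use ij in auto)
    then have "const_poly (A $$ (i, j)) = const_poly (if i = j then 1 else 0)" by auto
    then have "A $$ (i, j) = (if i = j then 1 else 0)" by (rule injD[OF inj_single])
    then show "A $$ (i, j) = 1\<^sub>m n $$ (i, j)" using ij by simp
  qed (use A in auto)
next
  assume "A = 1\<^sub>m n"
  then show "mat_form k n (mat_op n A mat_vec) = 0"
    by (auto simp: mat_op_one mat_form_def mat_vec_def intro!: sum.neutral)
qed

context graph_of_groups
begin

lemma ex_vertex_separates:
  assumes v: "v \<in> V" and "linear_over TYPE('r::idom) (G v)"
  shows "\<exists>\<rho> (\<xi> :: 'r mvpoly vec) \<eta> I. vertex_separates (Suc k) v \<rho> \<xi> \<eta> I"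
proof -
  interpret group "G v" using v by (rule group_G)
  obtain n and M :: "'a \<Rightarrow> 'r mat" where M: "\<And>a. a \<in> carrier (G v) \<Longrightarrow> M a \<in> carrier_mat n n"
    "\<And>a b. a \<in> carrier (G v) \<Longrightarrow> b \<in> carrier (G v) \<Longrightarrow> M (a \<otimes>\<^bsub>G v\<^esub> b) = M a * M b"
    "M \<one>\<^bsub>G v\<^esub> = 1\<^sub>m n" "inj_on M (carrier (G v))"
    using linear_over_matrices[OF group_G[OF v] assms(2)] by metis
  have "vertex_separates (Suc k) v (\<lambda>a. mat_op n (M a)) mat_vec (mat_form k n) (mat_index n)"
    unfolding vertex_separates_def
  proof (intro conjI ballI allI impI)
    show "finite (mat_index n)" by (simp add: mat_index_def)
    show "mat_vec \<in> vecs_below (Suc k)"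
      by (auto simp: vecs_below_def mat_vec_def split: nat.splits prod.splits)
    show "matrix_form (Suc k) (mat_index n) (mat_form k n)" by (rule matrix_form_mat_form)
    show "matrix_op (Suc k) (mat_index n) (mat_op n (M b))" for b by (rule matrix_op_mat_op)
    show "mat_op n (M \<one>\<^bsub>G v\<^esub>) x = x" for x by (simp add: M(3) mat_op_one)
    show "mat_op n (M a) (mat_op n (M b) x) = mat_op n (M (a \<otimes>\<^bsub>G v\<^esub> b)) x"
      if "a \<in> carrier (G v)" "b \<in> carrier (G v)" for a b x
      using that by (simp add: M mat_op_mult)
    show "mat_form k n mat_vec = 0"
      using mat_form_zero_iff[of "1\<^sub>m n" n k] by (simp add: mat_op_one)
    show "mat_form k n (mat_op n (M b) mat_vec) \<noteq> 0"
      if "b \<in> carrier (G v)" "b \<noteq> \<one>\<^bsub>G v\<^esub>" for b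
      using that inj_onD[OF M(4), of b "\<one>\<^bsub>G v\<^esub>"] M(3) mat_form_zero_iff[OF M(1)] by auto
  qed
  then show ?thesis by blast
qed

section \<open>Graph products\<close>

text \<open>\<open>S\<close> is arbitrary in the induction because the hypothesis for
  \<open>U - {v}\<close> is used twice: relative to the link of \<open>v\<close> for the gluing, and
  relative to \<open>S\<close> for the descent. The case \<open>S = U\<close> includes the empty
  \<open>U\<close>.\<close>

lemma ex_separates:
  assumes lin: "\<And>v. v \<in> V \<Longrightarrow> linear_over TYPE('r::idom) (G v)"
    and "U \<subseteq> V" "S \<subseteq> U"
  shows "\<exists>k T (e :: 'r mvpoly vec) f I. separates k U S T e f I"
proof -
  have "finite U" using graph assms(2) by (auto simp: finite_simplicial_graph_def intro: finite_subset)
  then show ?thesis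
    using assms(2,3)
  proof (induction U arbitrary: S rule: finite_psubset_induct)
    case (psubset U)
    show ?case
    proof (cases "S = U")
      case True
      then show ?thesis using separates_refl[OF psubset.prems(1)] by blast
    next
      case False
      then obtain v where v: "v \<in> U" "v \<notin> S" using psubset.prems(2) by blast
      let ?U = "U - {v}"
      have UV: "?U \<subset> U" "?U \<subseteq> V" "v \<in> V" "v \<notin> ?U" "insert v ?U = U" "S \<subseteq> ?U" "U \<subseteq> V"
        using v psubset.prems by auto
      obtain k1 T1 f1 I1 and e1 :: "'r mvpoly vec" where 1: "separates k1 ?U (link v \<inter> ?U) T1 e1 f1 I1"
        using psubset.IH[OF UV(1,2), of "link v \<inter> ?U"] by blast
      obtain k2 T2 f2 I2 and e2 :: "'r mvpoly vec" where 2: "separates k2 ?U S T2 e2 f2 I2"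
        using psubset.IH[OF UV(1,2,6)] by blast
      \<comment> \<open>Variable \<open>k1\<close> goes into the form of the vertex group, variable
        \<open>Suc k1\<close> into the gluing, and the variable with index \<open>?k\<close> below
        into the direct sum.\<close>
      obtain \<rho> \<eta> J and \<xi> :: "'r mvpoly vec" where "vertex_separates (Suc k1) v \<rho> \<xi> \<eta> J"
        using ex_vertex_separates[OF UV(3) lin[OF UV(3)]] by blast
      then interpret vertex_extension V E G "Suc k1" v ?U T1 e1 f1 I1 \<rho> \<xi> \<eta> J
        using UV separates_mono[OF 1, of "Suc k1"] by unfold_locales auto
      let ?k = "max (Suc (Suc k1)) k2"
      have "separates ?k U ?U ext_rep ext_vec ext_form (join_index J I1)"
        using separates_mono[OF separates_ext, of ?k] UV(5) by simp
      from separates_trans[OF this separates_mono[OF 2, of ?k] UV(6) _ UV(7)] show ?thesis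
        by (intro exI) auto
    qed
  qed
qed

end

text \<open>The action modulo vectors vanishing on \<open>I\<close> is by matrices over
  \<open>I\<close>. An element with the same matrix as the identity moves \<open>e\<close> to a
  vector agreeing with \<open>e\<close> on \<open>I\<close>, where \<open>f\<close> is 0; separation
  from the empty set of letters leaves only the class of the empty word.\<close>

lemma equationally_noetherian_if_separates:
  fixes e :: "'r::idom mvpoly vec"
  assumes "graph_of_groups V E G" "graph_of_groups.separates V E G k V {} T e f I"
  shows "equationally_noetherian (graph_product V E G)"
proof -
  interpret graph_of_groups V E G by fact
  note sep = separatesD[OF assms(2)]
  let ?Q = "graph_product V E G"
  interpret Q: group ?Q using graph group_G by (rule group_graph_product)
  from graph_product_words[OF graph group_G] obtain \<pi> where
    words: "carrier ?Q = \<pi> ` words V \<and> \<pi> [] = \<one>\<^bsub>?Q\<^esub> \<and>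
      (\<forall>u\<in>words V. \<forall>w\<in>words V. \<pi> (u @ w) = \<pi> u \<otimes>\<^bsub>?Q\<^esub> \<pi> w) \<and>
      (\<forall>u\<in>words V. \<forall>w\<in>words V. \<pi> u = \<pi> w \<longleftrightarrow> u \<simeq> w)"
    by (rule exE)
  have \<pi>: "carrier ?Q = \<pi> ` words V" "\<pi> [] = \<one>\<^bsub>?Q\<^esub>"
    by (insert words, elim conjE, assumption)+
  have \<pi>_append: "\<pi> (u @ w) = \<pi> u \<otimes>\<^bsub>?Q\<^esub> \<pi> w" if "u \<in> words V" "w \<in> words V" for u w
    by (rule words[THEN conjunct2, THEN conjunct2, THEN conjunct1, rule_format, OF that])
  have \<pi>_eq_iff: "\<pi> u = \<pi> w \<longleftrightarrow> u \<simeq> w" if "u \<in> words V" "w \<in> words V" for u w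
    by (rule words[THEN conjunct2, THEN conjunct2, THEN conjunct2, rule_format, OF that])
  define rep where "rep q = (SOME w. w \<in> words V \<and> \<pi> w = q)" for q
  have rep: "rep q \<in> words V" "\<pi> (rep q) = q" if "q \<in> carrier ?Q" for q
    using someI_ex[of "\<lambda>w. w \<in> words V \<and> \<pi> w = q"] that \<pi>(1) by (auto simp: rep_def)
  have cong: "foldr T (rep q) x = foldr T w x" if "w \<in> words V" "\<pi> w = q" for q w x
  proof -
    have "q \<in> carrier ?Q" using that \<pi>(1) by blast
    then have "rep q \<simeq> w" using rep[of q] \<pi>_eq_iff[of "rep q" w] that by simp
    then show ?thesis by (rule graph_rep_cong[OF sep(6)])
  qed
  define unit :: "nat \<Rightarrow> 'r mvpoly vec" where "unit j = (\<lambda>i. if i = j then 1 else 0)" for j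
  define \<theta> where "\<theta> q i j = foldr T (rep q) (unit j) i" for q i j
  have op: "matrix_op k I (foldr T w)" if "w \<in> words V" for w
    using that sep(4) by (intro matrix_op_foldr) auto
  have expand: "foldr T w x i = (\<Sum>j\<in>I. foldr T w (unit j) i * x j)" if w: "w \<in> words V" and i: "i \<in> I" for w x i
  proof -
    \<comment> \<open>The expansion in unit vectors is correct only on \<open>I\<close>; the
      operators respect agreement on \<open>I\<close>, so the coordinates in \<open>I\<close> of the
      image are still right.\<close>
    have "agree I x (\<Sum>j\<in>I. x j \<odot> unit j)"
      using sep(1) by (auto simp: agree_def sum_fun_apply scale_apply unit_def if_distrib[of "times _"] cong: if_cong)
    then have "foldr T w x i = foldr T w (\<Sum>j\<in>I. x j \<odot> unit j) i"
      using matrix_opD(3)[OF op[OF w]] i unfolding agree_def by blast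
    also have "foldr T w (\<Sum>j\<in>I. x j \<odot> unit j) = (\<Sum>j\<in>I. x j \<odot> foldr T w (unit j))"
      using matrix_opD(1)[OF op[OF w]] by (simp add: linear_op_sum linear_opD)
    finally show ?thesis by (simp add: sum_fun_apply scale_apply mult.commute)
  qed
  show ?thesis
  proof (rule equationally_noetherian_if_linear[OF Q.is_group sep(1), of \<theta>])
    fix q r i j assume qr: "q \<in> carrier ?Q" "r \<in> carrier ?Q" and ij: "i \<in> I" "j \<in> I"
    have w: "rep q @ rep r \<in> words V" "\<pi> (rep q @ rep r) = q \<otimes>\<^bsub>?Q\<^esub> r"
      using rep[OF qr(1)] rep[OF qr(2)] \<pi>_append by auto
    have "\<theta> (q \<otimes>\<^bsub>?Q\<^esub> r) i j = foldr T (rep q) (foldr T (rep r) (unit j)) i"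
      unfolding \<theta>_def cong[OF w] by simp
    also have "\<dots> = (\<Sum>l\<in>I. \<theta> q i l * \<theta> r l j)"
      unfolding \<theta>_def using rep(1)[OF qr(1)] ij(1) by (rule expand)
    finally show "\<theta> (q \<otimes>\<^bsub>?Q\<^esub> r) i j = (\<Sum>l\<in>I. \<theta> q i l * \<theta> r l j)" .
  next
    fix q assume q: "q \<in> carrier ?Q" and eq: "\<And>i j. i \<in> I \<Longrightarrow> j \<in> I \<Longrightarrow> \<theta> q i j = \<theta> \<one>\<^bsub>?Q\<^esub> i j"
    have "foldr T (rep q) e i = foldr T (rep \<one>\<^bsub>?Q\<^esub>) e i" if "i \<in> I" for i
      using expand[OF rep(1)[OF q] that, of e] expand[OF rep(1)[OF Q.one_closed] that, of e]
        eq[OF that, unfolded \<theta>_def] by simp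
    \<comment> \<open>The word chosen for the identity may be nonempty, but it is congruent to the
      empty word.\<close>
    moreover have "foldr T (rep \<one>\<^bsub>?Q\<^esub>) e = e" using cong[of "[]"] \<pi>(2) by simp
    ultimately have "agree I (foldr T (rep q) e) e" by (simp add: agree_def)
    then have "f (foldr T (rep q) e) = 0" using matrix_formD(3)[OF sep(3)] sep(7) by metis
    then obtain c where "c \<in> words {}" "rep q \<simeq> c" using sep(10)[OF rep(1)[OF q]] by blast
    then have "rep q \<simeq> []" by auto
    then show "q = \<one>\<^bsub>?Q\<^esub>" using \<pi>_eq_iff[of "rep q" "[]"] \<pi>(2) rep[OF q] by simp
  qed
qed

theorem corollary3:
  fixes V :: "'v set" and E :: "'v set set" and G :: "'v \<Rightarrow> ('a, 'm) monoid_scheme"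
  assumes "finite_simplicial_graph V E"
    and "\<And>v. v \<in> V \<Longrightarrow> group (G v)"
    and "\<And>v. v \<in> V \<Longrightarrow> linear_over TYPE('r::idom) (G v)"
  shows "group (graph_product V E G) \<and> equationally_noetherian (graph_product V E G)"
proof -
  interpret graph_of_groups V E G using assms(1,2) by (rule graph_of_groups.intro)
  obtain k T f I and e :: "'r mvpoly vec" where "separates k V {} T e f I"
    using ex_separates[OF assms(3) order.refl empty_subsetI] by blast
  then have "equationally_noetherian (graph_product V E G)"
    by (rule equationally_noetherian_if_separates[OF graph_of_groups_axioms])
  then show ?thesis using group_graph_product[OF assms(1,2)] by simp
qed

end
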